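(* Let $G$ be an amenable graph, $A_i$ an anisotropic component of $C(G)$ with root $R_i$, $G_i=G[\bigcup_{X\in A_i}X]$, and let $J_i$ be the graph obtained from $G_i$ by the modifications (M1), (M2), (M3). Then $J_i$ is a jellyfish graph (with head $J_i[R_i]$ and a leg rooted at each vertex of $R_i$), and its legs are pairwise cell-isomorphic.
   Context: Color refinement on a graph $K$: start with $\mathcal{P}_0=\{V(K)\}$; given $\mathcal{P}_{i-1}$, two vertices lie in the same cell of $\mathcal{P}_i$ iff they lie in the same cell of $\mathcal{P}_{i-1}$ and have the same number of neighbors in every cell of $\mathcal{P}_{i-1}$; stop when stable; for $K=G$ the result is the stable partition $\mathcal{P}_G$. $G$ is amenable if, for every graph $H$, running color refinement on $G\cup H$ and declaring $G\cong H$ iff each final cell contains equally many vertices of $G$ and $H$ gives the correct answer. The cell graph $C(G)$ is the complete graph on $\mathcal{P}_G$. A cell $X$ is homogeneous if $G[X]$ is empty or complete, heterogeneous otherwise. A pair of distinct cells $X,Y$ is isotropic if the bipartite graph $G[X,Y]$ between them is empty or complete bipartite, anisotropic otherwise; anisotropic components are the connected components of the graph on $\mathcal{P}_G$ formed by the anisotropic pairs. Known facts for amenable $G$ (Arvind et al.): each $G[X]$ is a 5-cycle, empty, complete, a matching graph $rK_2$ ($r\ge2$) or its complement; each $G[X,Y]$ is empty, complete bipartite, a disjoint union of stars $sK_{1,t}$ with centers on one side, or the bipartite complement of such; each anisotropic component is a tree with at most one heterogeneous cell, which has least cardinality in the component, and when rooted at a cell of least cardinality, cell sizes are non-decreasing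 from parent to child. The root $R_i$ of $A_i$ is its heterogeneous cell if one exists, otherwise a cell of least cardinality in $A_i$. Modifications applied to $G_i$: (M1) if $G_i[R_i]$ is a matching graph or empty, replace it by its complement; (M2) for every other cell $X$ of $A_i$, if $G_i[X]$ is complete, replace it by its complement; (M3) for each pair of distinct cells $X,Y$ of $A_i$: if $XY$ is isotropic and $G_i[X,Y]$ is complete bipartite, replace it by the empty bipartite graph; if $XY$ is anisotropic and $G_i[X,Y]$ is the bipartite complement of $sK_{1,t}$, replace it by $sK_{1,t}$. A jellyfish graph consists of a head $H$, a graph containing a Hamiltonian cycle, and for each $v\in V(H)$ a leg $L_v$, a rooted tree with root $v$; the legs are pairwise vertex-disjoint and pairwise isomorphic as rooted trees, the vertex set is the union of the legs, and the edges are those of $H$ plus those of the legs. Two legs $L_v,L_w$ are cell-isomorphic if there is an isomorphism $\pi$ from $L_v$ to $L_w$ such that $a$ and $\pi(a)$ lie in the same cell of $\mathcal{P}_G$ for every vertex $a$ of $L_v$.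
   Formalization: When the root cell has one or two vertices, the head is K_1 or K_2 and has no Hamiltonian cycle in the strict sense (e.g. G = K_1), so K_1 and K_2 are counted as containing a Hamiltonian cycle; for heads with at least three vertices the usual notion is used. *)

theory Defs
  imports "Graph_Theory.Graph_Theory" "HOL-Library.Disjoint_Sets"
begin

text \<open>
  Finite simple graphs are the values \<open>G :: 'a pair_pre_digraph\<close> with \<open>pair_graph G\<close>: finitely
  many vertices, and a symmetric, loop-free arc relation \<open>parcs G\<close>, in which an edge \<open>uv\<close> is
  represented by both \<open>(u, v)\<close> and \<open>(v, u)\<close>.
\<close>

section \<open>Graphs\<close>

definition induced :: "'a pair_pre_digraph \<Rightarrow> 'a set \<Rightarrow> 'a pair_pre_digraph" where
  "induced G X = \<lparr> pverts = X, parcs = parcs G \<inter> (X \<times> X) \<rparr>"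

lemma with_proj_induced: "with_proj (induced G X) = with_proj G \<restriction> X"
  by (auto simp: induced_def with_proj_def induce_subgraph_def)

definition complement :: "'a pair_pre_digraph \<Rightarrow> 'a pair_pre_digraph" where
  "complement G = \<lparr> pverts = pverts G,
     parcs = {(u, v) \<in> pverts G \<times> pverts G. u \<noteq> v \<and> (u, v) \<notin> parcs G} \<rparr>"

definition empty_graph :: "'a pair_pre_digraph \<Rightarrow> bool" where
  "empty_graph G \<longleftrightarrow> parcs G = {}"

definition complete_graph :: "'a pair_pre_digraph \<Rightarrow> bool" where
  "complete_graph G \<longleftrightarrow> parcs G = {(u, v) \<in> pverts G \<times> pverts G. u \<noteq> v}"

text \<open>\<open>G = rK\<^sub>2\<close> with \<open>r \<ge> 2\<close>; the copies of \<open>K\<^sub>2\<close> are the members of \<open>M\<close>.\<close>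

definition matching_graph :: "'a pair_pre_digraph \<Rightarrow> bool" where
  "matching_graph G \<longleftrightarrow> (\<exists>M. partition_on (pverts G) M \<and> (\<forall>e\<in>M. card e = 2) \<and> 2 \<le> card M \<and>
     parcs G = {(u, v). u \<noteq> v \<and> {u, v} \<in> M})"

definition disj_union ::
  "'a pair_pre_digraph \<Rightarrow> 'b pair_pre_digraph \<Rightarrow> ('a + 'b) pair_pre_digraph" where
  "disj_union G H = \<lparr> pverts = pverts G <+> pverts H,
     parcs = map_prod Inl Inl ` parcs G \<union> map_prod Inr Inr ` parcs H \<rparr>"

definition graph_isomorphism ::
  "('a \<Rightarrow> 'b) \<Rightarrow> 'a pair_pre_digraph \<Rightarrow> 'b pair_pre_digraph \<Rightarrow> bool" where
  "graph_isomorphism \<pi> G H \<longleftrightarrow> bij_betw \<pi> (pverts G) (pverts H) \<and>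
     (\<forall>u\<in>pverts G. \<forall>v\<in>pverts G. (u, v) \<in> parcs G \<longleftrightarrow> (\<pi> u, \<pi> v) \<in> parcs H)"

lemma digraph_iso_iff_graph_isomorphism:
  assumes G: "pair_graph G" and H: "pair_graph H"
  shows "digraph_iso (with_proj G) (with_proj H) \<longleftrightarrow> (\<exists>\<pi>. graph_isomorphism \<pi> G H)"
proof
  interpret G: pair_graph G by (rule G)
  assume "digraph_iso (with_proj G) (with_proj H)"
  then obtain f where f: "pre_digraph.digraph_isomorphism (with_proj G) f"
    and app: "with_proj H = app_iso f (with_proj G)"
    unfolding digraph_iso_def by blast
  from app have vH: "pverts H = iso_verts f ` pverts G"
    and aH: "parcs H = iso_arcs f ` parcs G"
    and t: "iso_tail f = fst" and h: "iso_head f = snd"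
    by (auto simp: app_iso_def with_proj_def)
  from f have inj: "inj_on (iso_verts f) (pverts G)"
    and arc: "\<And>a. a \<in> parcs G \<Longrightarrow> iso_arcs f a = (iso_verts f (fst a), iso_verts f (snd a))"
    unfolding pre_digraph.digraph_isomorphism_def by (auto simp: t h prod_eq_iff)
  have "graph_isomorphism (iso_verts f) G H"
    unfolding graph_isomorphism_def
  proof (intro conjI ballI iffI)
    show "bij_betw (iso_verts f) (pverts G) (pverts H)"
      using inj vH by (simp add: bij_betw_def)
  next
    fix u v assume "(u, v) \<in> parcs G"
    then show "(iso_verts f u, iso_verts f v) \<in> parcs H"
      using arc[of "(u, v)"] aH by force
  next
    fix u v assume uv: "u \<in> pverts G" "v \<in> pverts G" "(iso_verts f u, iso_verts f v) \<in> parcs H"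
    then obtain a b where ab: "(a, b) \<in> parcs G"
      and "(iso_verts f u, iso_verts f v) = iso_arcs f (a, b)"
      using aH by auto
    then have "iso_verts f u = iso_verts f a" "iso_verts f v = iso_verts f b"
      using arc[OF ab] by auto
    then have "u = a" "v = b"
      using inj uv G.in_arcsD1[OF ab] G.in_arcsD2[OF ab] by (auto dest: inj_onD)
    then show "(u, v) \<in> parcs G" using ab by simp
  qed
  then show "\<exists>\<pi>. graph_isomorphism \<pi> G H" by blast
next
  interpret G: pair_graph G by (rule G)
  interpret H: pair_graph H by (rule H)
  assume "\<exists>\<pi>. graph_isomorphism \<pi> G H"
  then obtain \<pi> where bij: "bij_betw \<pi> (pverts G) (pverts H)"
    and arc: "\<And>u v. u \<in> pverts G \<Longrightarrow> v \<in> pverts G \<Longrightarrow> (u, v) \<in> parcs G \<longleftrightarrow> (\<pi> u, \<pi> v) \<in> parcs H"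
    unfolding graph_isomorphism_def by blast
  define f where "f = \<lparr> iso_verts = \<pi>, iso_arcs = map_prod \<pi> \<pi>, iso_head = snd, iso_tail = fst \<rparr>"
  have inj: "inj_on \<pi> (pverts G)" and im: "\<pi> ` pverts G = pverts H"
    using bij by (auto simp: bij_betw_def)
  have "inj_on (map_prod \<pi> \<pi>) (pverts G \<times> pverts G)"
    using inj by (intro map_prod_inj_on)
  moreover have sub: "parcs G \<subseteq> pverts G \<times> pverts G"
    by (auto dest: G.in_arcsD1 G.in_arcsD2)
  ultimately have "inj_on (map_prod \<pi> \<pi>) (parcs G)"
    by (rule inj_on_subset)
  then have 1: "pre_digraph.digraph_isomorphism (with_proj G) f"
    unfolding pre_digraph.digraph_isomorphism_def f_def
    using inj G.wf_digraph by (auto simp: map_prod_def split_beta)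
  have "map_prod \<pi> \<pi> ` parcs G = parcs H"
  proof (intro equalityI subsetI)
    fix e assume "e \<in> map_prod \<pi> \<pi> ` parcs G"
    then obtain u v where "(u, v) \<in> parcs G" "e = (\<pi> u, \<pi> v)" by auto
    then show "e \<in> parcs H" using arc sub by blast
  next
    fix e assume e: "e \<in> parcs H"
    then obtain x y where xy: "e = (x, y)" "x \<in> pverts H" "y \<in> pverts H"
      by (cases e) (auto dest: H.in_arcsD1 H.in_arcsD2)
    then obtain u v where "x = \<pi> u" "y = \<pi> v" "u \<in> pverts G" "v \<in> pverts G"
      using im by blast
    then show "e \<in> map_prod \<pi> \<pi> ` parcs G" using arc e xy by force
  qed
  then have "with_proj H = app_iso f (with_proj G)"
    using im by (simp add: app_iso_def f_def with_proj_def)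
  with 1 show "digraph_iso (with_proj G) (with_proj H)"
    unfolding digraph_iso_def by blast
qed


section \<open>Color refinement and amenability\<close>

definition refine :: "'a pair_pre_digraph \<Rightarrow> 'a set set \<Rightarrow> 'a set set" where
  "refine K P = pverts K // {(u, v) \<in> pverts K \<times> pverts K.
     (\<exists>X\<in>P. u \<in> X \<and> v \<in> X) \<and>
     (\<forall>Y\<in>P. card {w \<in> Y. (u, w) \<in> parcs K} = card {w \<in> Y. (v, w) \<in> parcs K})}"

primrec color_refinement :: "'a pair_pre_digraph \<Rightarrow> nat \<Rightarrow> 'a set set" where
  "color_refinement K 0 = {pverts K}"
| "color_refinement K (Suc i) = refine K (color_refinement K i)"

definition stable_partition :: "'a pair_pre_digraph \<Rightarrow> 'a set set" where
  "stable_partition K =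
     color_refinement K (LEAST i. color_refinement K (Suc i) = color_refinement K i)"

text \<open>
  A definition cannot quantify over the vertex type of \<open>H\<close>; as every finite graph is isomorphic
  to one with vertices in \<open>nat\<close>, the latter represent all graphs.
\<close>

definition amenable :: "'a pair_pre_digraph \<Rightarrow> bool" where
  "amenable G \<longleftrightarrow> (\<forall>H :: nat pair_pre_digraph. pair_graph H \<longrightarrow>
     (digraph_iso (with_proj G) (with_proj H) \<longleftrightarrow>
      (\<forall>X\<in>stable_partition (disj_union G H).
         card {v \<in> pverts G. Inl v \<in> X} = card {v \<in> pverts H. Inr v \<in> X})))"


section \<open>Anisotropic components\<close>

definition heterogeneous :: "'a pair_pre_digraph \<Rightarrow> 'a set \<Rightarrow> bool" where
  "heterogeneous G X \<longleftrightarrow> \<not> (empty_graph (induced G X) \<or> complete_graph (induced G X))"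

text \<open>
  For disjoint \<open>X\<close> and \<open>Y\<close>, the bipartite graph \<open>G[X, Y]\<close> is given by its edges, oriented
  from \<open>X\<close> to \<open>Y\<close>.
\<close>

definition between :: "'a pair_pre_digraph \<Rightarrow> 'a set \<Rightarrow> 'a set \<Rightarrow> ('a \<times> 'a) set" where
  "between G X Y = parcs G \<inter> (X \<times> Y)"

definition isotropic :: "'a pair_pre_digraph \<Rightarrow> 'a set \<Rightarrow> 'a set \<Rightarrow> bool" where
  "isotropic G X Y \<longleftrightarrow> between G X Y = {} \<or> between G X Y = X \<times> Y"

definition cell_graph :: "'a pair_pre_digraph \<Rightarrow> 'a set pair_pre_digraph" where
  "cell_graph G = \<lparr> pverts = stable_partition G,
     parcs = {(X, Y) \<in> stable_partition G \<times> stable_partition G. X \<noteq> Y} \<rparr>"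

definition anisotropic_graph :: "'a pair_pre_digraph \<Rightarrow> 'a set pair_pre_digraph" where
  "anisotropic_graph G = \<lparr> pverts = pverts (cell_graph G),
     parcs = {(X, Y) \<in> parcs (cell_graph G). \<not> isotropic G X Y} \<rparr>"

text \<open>
  The anisotropic graph is symmetric, so its strongly connected components are its connected
  components.
\<close>

definition anisotropic_components :: "'a pair_pre_digraph \<Rightarrow> 'a set set set" where
  "anisotropic_components G = pre_digraph.sccs_verts (with_proj (anisotropic_graph G))"

definition root_cell :: "'a pair_pre_digraph \<Rightarrow> 'a set set \<Rightarrow> 'a set \<Rightarrow> bool" where
  "root_cell G A R \<longleftrightarrow> R \<in> A \<and>
     (heterogeneous G R \<or>
      (\<forall>X\<in>A. \<not> heterogeneous G X) \<and> (\<forall>X\<in>A. card R \<le> card X))"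


section \<open>The modifications\<close>

text \<open>
  \<open>B \<subseteq> X \<times> Y\<close> is \<open>sK\<^bsub>1,t\<^esub>\<close> with center set \<open>X\<close>; \<open>L x\<close> is the set of leaves at the center \<open>x\<close>.
\<close>

definition star_forest :: "('a \<times> 'a) set \<Rightarrow> 'a set \<Rightarrow> 'a set \<Rightarrow> bool" where
  "star_forest B X Y \<longleftrightarrow> (\<exists>L t. 1 \<le> t \<and> (\<forall>x\<in>X. finite (L x) \<and> card (L x) = t) \<and>
     disjoint_family_on L X \<and> Y = (\<Union>x\<in>X. L x) \<and> B = Sigma X L)"

definition bipartite_stars :: "('a \<times> 'a) set \<Rightarrow> 'a set \<Rightarrow> 'a set \<Rightarrow> bool" where
  "bipartite_stars B X Y \<longleftrightarrow> star_forest B X Y \<or> star_forest (B\<inverse>) Y X"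

definition modify_root :: "'a pair_pre_digraph \<Rightarrow> 'a set \<Rightarrow> ('a \<times> 'a) set" where
  "modify_root K X =
     (if matching_graph (induced K X) \<or> empty_graph (induced K X)
      then parcs (complement (induced K X)) else parcs (induced K X))"

definition modify_cell :: "'a pair_pre_digraph \<Rightarrow> 'a set \<Rightarrow> ('a \<times> 'a) set" where
  "modify_cell K X =
     (if complete_graph (induced K X)
      then parcs (complement (induced K X)) else parcs (induced K X))"

definition modify_between :: "'a pair_pre_digraph \<Rightarrow> 'a set \<Rightarrow> 'a set \<Rightarrow> ('a \<times> 'a) set" where
  "modify_between K X Y =
     (if isotropic K X Y
      then (if between K X Y = X \<times> Y then {} else between K X Y)
      else (if bipartite_stars (X \<times> Y - between K X Y) X Y
            then X \<times> Y - between K X Y else between K X Y))"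

definition modified_component ::
  "'a pair_pre_digraph \<Rightarrow> 'a set set \<Rightarrow> 'a set \<Rightarrow> 'a pair_pre_digraph" where
  "modified_component G A R =
     (let K = induced G (\<Union>A) in
      \<lparr> pverts = \<Union>A,
        parcs = modify_root K R \<union> (\<Union>X\<in>A - {R}. modify_cell K X) \<union>
          (\<Union>X\<in>A. \<Union>Y\<in>A - {X}. modify_between K X Y) \<rparr>)"


section \<open>Jellyfish graphs\<close>

text \<open>
  On three or more vertices this is the usual notion. It is also satisfied by \<open>K\<^sub>1\<close> (by the first
  disjunct) and by \<open>K\<^sub>2\<close> (whose edge, traversed forth and back, is a cycle in the sense of
  \<open>pre_digraph.cycle\<close>), and by no other graph on at most two vertices: these occur as heads when
  the root cell has one or two elements.
\<close>

definition hamiltonian :: "'a pair_pre_digraph \<Rightarrow> bool" where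
  "hamiltonian H \<longleftrightarrow> card (pverts H) = 1 \<or>
     (\<exists>p. pre_digraph.cycle (with_proj H) p \<and> fst ` set p = pverts H)"

text \<open>
  The library's \<open>tree\<close> is not suitable here: in a symmetric digraph every edge gives a cycle of
  length two. The cycles of the graph are the ones of length at least three.
\<close>

definition rooted_tree :: "'a pair_pre_digraph \<Rightarrow> 'a \<Rightarrow> bool" where
  "rooted_tree T r \<longleftrightarrow> pair_graph T \<and> r \<in> pverts T \<and>
     Digraph_Component.connected (with_proj T) \<and>
     \<not> (\<exists>p. pre_digraph.cycle (with_proj T) p \<and> 3 \<le> length p)"

definition rooted_isomorphism ::
  "('a \<Rightarrow> 'b) \<Rightarrow> 'a pair_pre_digraph \<Rightarrow> 'a \<Rightarrow> 'b pair_pre_digraph \<Rightarrow> 'b \<Rightarrow> bool" where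
  "rooted_isomorphism \<pi> T r T' r' \<longleftrightarrow> graph_isomorphism \<pi> T T' \<and> \<pi> r = r'"

definition jellyfish ::
  "'a pair_pre_digraph \<Rightarrow> 'a pair_pre_digraph \<Rightarrow> ('a \<Rightarrow> 'a pair_pre_digraph) \<Rightarrow> bool" where
  "jellyfish J H L \<longleftrightarrow> pair_graph H \<and> hamiltonian H \<and>
     (\<forall>v\<in>pverts H. rooted_tree (L v) v) \<and>
     disjoint_family_on (\<lambda>v. pverts (L v)) (pverts H) \<and>
     (\<forall>v\<in>pverts H. \<forall>w\<in>pverts H. \<exists>\<pi>. rooted_isomorphism \<pi> (L v) v (L w) w) \<and>
     pverts J = (\<Union>v\<in>pverts H. pverts (L v)) \<and>
     parcs J = parcs H \<union> (\<Union>v\<in>pverts H. parcs (L v))"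

definition cell_isomorphic ::
  "'a pair_pre_digraph \<Rightarrow> 'a pair_pre_digraph \<Rightarrow> 'a \<Rightarrow> 'a pair_pre_digraph \<Rightarrow> 'a \<Rightarrow> bool" where
  "cell_isomorphic G T r T' r' \<longleftrightarrow> (\<exists>\<pi>. rooted_isomorphism \<pi> T r T' r' \<and>
     (\<forall>a\<in>pverts T. \<exists>X\<in>stable_partition G. a \<in> X \<and> \<pi> a \<in> X))"

end

theory Submission
  imports Defs "HOL-Combinatorics.Transposition"
begin

text \<open>
  Amenability says that every graph \<open>H\<close> on \<open>V(G)\<close> whose vertices have the same numbers of neighbors
  in the cells of \<open>\<P>\<^sub>G\<close> as in \<open>G\<close> is isomorphic to \<open>G\<close>, by an isomorphism that fixes each cell.
  Equivalently, once the vertices of every cell \<open>X\<close> are numbered from \<open>0\<close> to \<open>|X| - 1\<close>, any pattern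
  (a ``template'') with the right degrees between the cells is realized by \<open>G\<close> under a suitable
  numbering, and any two such patterns differ by permutations of the cells.

  Comparing patterns that differ in one place only gives the structure of an anisotropic component:
  two biregular bipartite graphs with different numbers of components \<open>K\<^bsub>b,a\<^esub>\<close> show that \<open>G[X, Y]\<close> is
  a star forest or the complement of one; twisting one edge of a cycle of equally large cells shows
  that there is no such cycle; and permuting two ``slots'' (heterogeneous cells or smaller neighbors)
  of a connected set of equally large cells against each other shows that there is at most one slot.
  Growing a tree from the root, these facts force the cell sizes not to decrease and leave no further
  anisotropic pair and no further heterogeneous cell.

  Finally \<open>G\<close> itself is numbered such that \<open>G[R]\<close> is circulant and every star forest joins \<open>j\<close> to
  \<open>j div t\<close>. Then the head visibly has a Hamiltonian cycle, and the legs are the blocks of labels with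
  equal quotient by \<open>|X| / |R|\<close>, which are matched by translations.
\<close>

section \<open>Biregular relations and circulant graphs\<close>

text \<open>The isomorphism that rigidity returns may permute every cell in an unknown way. So each
  comparison needs a quantity that all cell permutations preserve: for a pair of cells the number of
  vertices in components K_{b,a}, for a cycle the composition of its matchings, for two slots the
  number of common edges of two graphs read on one set of labels. The last one is the reason for
  traces: a smaller neighbor of C must become a graph on C itself before it can be compared with
  G[C]. The overlap need not be computed; it only has to vary, and a mixed second difference shows
  this for any two graphs that contain an alternating 4-cycle.

  The definition of the root does not bound the size of a heterogeneous R, so monotone cell sizes
  cannot be read off from minimality. They hold because such an R occupies the slot of its own class
  of equally large cells, and every other class reached so far has its slot at the cell with a
  smaller parent; a new cell that is too small would be a second slot. A homogeneous R is minimal by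
  definition, which covers the remaining case.\<close>

lemma bij_betw_extend:
  assumes "finite S" "A \<subseteq> S" "inj_on f A" "f ` A \<subseteq> S"
  shows "\<exists>\<tau>. bij_betw \<tau> S S \<and> (\<forall>a\<in>A. \<tau> a = f a)"
proof -
  have "card (S - A) = card (S - f ` A)"
    using assms by (simp add: card_Diff_subset card_image finite_subset)
  then obtain g where g: "bij_betw g (S - A) (S - f ` A)"
    using assms(1) finite_same_card_bij by blast
  define \<tau> where "\<tau> = (\<lambda>x. if x \<in> A then f x else g x)"
  have "bij_betw \<tau> A (f ` A)"
    using assms(3) by (auto simp: bij_betw_def \<tau>_def inj_on_def)
  moreover have "bij_betw \<tau> (S - A) (S - f ` A)"
    using g by (rule bij_betw_cong[THEN iffD1, rotated]) (simp add: \<tau>_def)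
  ultimately have "bij_betw \<tau> (A \<union> (S - A)) (f ` A \<union> (S - f ` A))"
    by (rule bij_betw_combine) auto
  then have "bij_betw \<tau> S S" using assms by (simp add: Un_absorb1)
  then show ?thesis by (auto simp: \<tau>_def)
qed

text \<open>An alternating 4-cycle: edges vy, wz and non-edges vz, wy, with the pairs vw and yz left
  open. Threshold graphs are exactly the graphs without one.\<close>

definition alternating_square :: "nat \<Rightarrow> (nat \<Rightarrow> nat \<Rightarrow> bool) \<Rightarrow> bool" where
  "alternating_square n e \<longleftrightarrow> (\<exists>v<n. \<exists>w<n. \<exists>y<n. \<exists>z<n.
     distinct [v, w, y, z] \<and> e v y \<and> e w z \<and> \<not> e v z \<and> \<not> e w y)"

text \<open>A neighbor y and a non-neighbor z of vertex 0 have equally many neighbors once z and y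
  themselves are disregarded. As 0 is counted for y only, some w is counted for z only, and 0, w, y,
  z alternate.\<close>

lemma alternating_square_if_regular:
  assumes sym: "\<And>i j. i < n \<Longrightarrow> j < n \<Longrightarrow> e i j = e j i"
    and irrefl: "\<And>i. i < n \<Longrightarrow> \<not> e i i"
    and deg: "\<And>i. i < n \<Longrightarrow> card {j. j < n \<and> e i j} = d"
    and d: "1 \<le> d" "d + 2 \<le> n"
  shows "alternating_square n e"
proof -
  define N where "N i = {j. j < n \<and> e i j}" for i
  have fin: "finite (N i)" for i by (simp add: N_def)
  have cN: "card (N i) = d" if "i < n" for i using deg that by (simp add: N_def)
  have "N 0 \<noteq> {}" using cN[of 0] d by auto
  then obtain y where y: "y < n" "e 0 y" by (auto simp: N_def)
  have "\<not> {..<n} - {0} \<subseteq> N 0"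
  proof
    assume "{..<n} - {0} \<subseteq> N 0"
    from card_mono[OF fin this] show False using cN[of 0] d by simp
  qed
  then obtain z where z: "z < n" "z \<noteq> 0" "\<not> e 0 z" by (auto simp: N_def)
  have n0: "0 < n" using d by simp
  have ne: "y \<noteq> 0" "y \<noteq> z" using irrefl[OF n0] y z by metis+
  have card_eq: "card (N y - {z}) = card (N z - {y})"
    using cN[OF y(1)] cN[OF z(1)] sym[OF y(1) z(1)] y z fin
    by (cases "e y z") (auto simp: N_def card_Diff_singleton_if)
  have "0 \<in> N y - {z}" "0 \<notin> N z - {y}"
    using y z n0 sym[of 0 y] sym[of 0 z] by (auto simp: N_def)
  then have "\<not> N z - {y} \<subseteq> N y - {z}"
    using card_subset_eq[OF _ _ card_eq[symmetric]] fin by blast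
  then obtain w where w: "w \<in> N z" "w \<noteq> y" "w \<notin> N y - {z}" by blast
  have "w \<noteq> z" using w irrefl by (auto simp: N_def)
  then have "\<not> e y w" using w by (auto simp: N_def)
  moreover have "w \<noteq> 0" using w(1) z sym[of 0 z] n0 by (cases "w = 0") (auto simp: N_def)
  moreover have "w < n" "e w z" "\<not> e w y"
    using w(1) y(1) z(1) \<open>\<not> e y w\<close> sym by (auto simp: N_def)
  ultimately have "distinct [0, w, y, z]" using ne w(2) z(2) \<open>w \<noteq> z\<close> by simp
  then show ?thesis unfolding alternating_square_def
    using n0 \<open>w < n\<close> y z \<open>e w z\<close> \<open>\<not> e w y\<close> by blast
qed

text \<open>If the overlap were constant, every alternating sum of overlaps would vanish. One square
  is laid over the other; swapping v, w and swapping y, z, separately and together, then gives a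
  mixed second difference that lives only on pairs between {v, w} and {y, z}, where the two graphs
  agree and nothing cancels.\<close>

lemma overlap_not_constant:
  assumes sym1: "\<And>i j. i < n \<Longrightarrow> j < n \<Longrightarrow> e1 i j = e1 j i"
    and sym2: "\<And>i j. i < n \<Longrightarrow> j < n \<Longrightarrow> e2 i j = e2 j i"
    and alt1: "alternating_square n e1" and alt2: "alternating_square n e2"
  shows "\<exists>\<tau> \<tau>'. bij_betw \<tau> {..<n} {..<n} \<and> bij_betw \<tau>' {..<n} {..<n} \<and>
    card {(i, j). i < n \<and> j < n \<and> e1 i j \<and> e2 (\<tau> i) (\<tau> j)} \<noteq>
    card {(i, j). i < n \<and> j < n \<and> e1 i j \<and> e2 (\<tau>' i) (\<tau>' j)}"
proof (rule ccontr)
  assume contra: "\<not> ?thesis"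
  obtain v w y z where A1: "v < n" "w < n" "y < n" "z < n" "distinct [v, w, y, z]"
      "e1 v y" "e1 w z" "\<not> e1 v z" "\<not> e1 w y"
    using alt1 unfolding alternating_square_def by blast
  obtain v' w' y' z' where A2: "v' < n" "w' < n" "y' < n" "z' < n" "distinct [v', w', y', z']"
      "e2 v' y'" "e2 w' z'" "\<not> e2 v' z'" "\<not> e2 w' y'"
    using alt2 unfolding alternating_square_def by blast
  define f where "f = id(v := v', w := w', y := y', z := z')"
  have fv: "f v = v'" "f w = w'" "f y = y'" "f z = z'" using A1(5) by (auto simp: f_def)
  have "inj_on f {v, w, y, z}"
    using A2(5) by (auto simp: inj_on_def fv)
  moreover have "f ` {v, w, y, z} \<subseteq> {..<n}" using A2 by (simp add: fv)
  ultimately obtain \<tau> where \<tau>: "bij_betw \<tau> {..<n} {..<n}" and "\<forall>a\<in>{v, w, y, z}. \<tau> a = f a"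
    using bij_betw_extend[of "{..<n}" "{v, w, y, z}" f] A1 by auto
  then have \<tau>v: "\<tau> v = v'" "\<tau> w = w'" "\<tau> y = y'" "\<tau> z = z'" using fv by auto
  define e where "e i j = e2 (\<tau> i) (\<tau> j)" for i j
  have \<tau>lt: "\<tau> i < n" if "i < n" for i using \<tau> that by (auto simp: bij_betw_def)
  have esym: "e i j = e j i" if "i < n" "j < n" for i j
    using sym2 \<tau>lt that by (simp add: e_def)
  have e: "e v y" "e w z" "\<not> e v z" "\<not> e w y" using A2 \<tau>v by (auto simp: e_def)
  define s where "s = transpose v w"
  define r where "r = transpose y z"
  have bs: "bij_betw s {..<n} {..<n}" and br: "bij_betw r {..<n} {..<n}"
    using A1 by (auto simp: s_def r_def intro!: bij_betw_byWitness[where f' = "transpose v w"]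
        bij_betw_byWitness[where f' = "transpose y z"] simp: transpose_def)
  define F :: "(nat \<Rightarrow> nat) \<Rightarrow> int" where
    "F \<sigma> = (\<Sum>(i, j)\<in>{..<n} \<times> {..<n}. of_bool (e1 i j) * of_bool (e (\<sigma> i) (\<sigma> j)))" for \<sigma>
  have F: "F \<sigma> = int (card {(i, j). i < n \<and> j < n \<and> e1 i j \<and> e2 ((\<tau> \<circ> \<sigma>) i) ((\<tau> \<circ> \<sigma>) j)})" for \<sigma>
  proof -
    have "{(i, j). i < n \<and> j < n \<and> e1 i j \<and> e2 ((\<tau> \<circ> \<sigma>) i) ((\<tau> \<circ> \<sigma>) j)} =
      ({..<n} \<times> {..<n}) \<inter> {p. e1 (fst p) (snd p) \<and> e (\<sigma> (fst p)) (\<sigma> (snd p))}"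
      by (auto simp: e_def)
    then show ?thesis
      by (simp only: F_def case_prod_unfold of_bool_conj[symmetric] sum_of_bool_eq finite_cartesian_product
          finite_lessThan)
  qed
  have const: "F \<sigma> = F id" if "bij_betw \<sigma> {..<n} {..<n}" for \<sigma>
  proof -
    have "bij_betw (\<tau> \<circ> \<sigma>) {..<n} {..<n}" "bij_betw (\<tau> \<circ> id) {..<n} {..<n}"
      using bij_betw_trans[OF that \<tau>] \<tau> by simp_all
    with contra show ?thesis unfolding F int_int_eq by blast
  qed
  define g :: "nat \<Rightarrow> nat \<Rightarrow> int" where
    "g i j = of_bool (e i j) - of_bool (e (s i) (s j)) - of_bool (e (r i) (r j)) +
       of_bool (e (s (r i)) (s (r j)))" for i j
  have "0 = F id - F s - F r + F (s \<circ> r)"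
    using const[OF bs] const[OF br] const[OF bij_betw_trans[OF br bs]] by simp
  also have "\<dots> = (\<Sum>(i, j)\<in>{..<n} \<times> {..<n}. of_bool (e1 i j) * g i j)"
    by (simp add: F_def g_def split_beta sum_subtractf sum.distrib distrib_left right_diff_distrib)
  also have "\<dots> = (\<Sum>(i, j)\<in>{v, w} \<times> {y, z} \<union> {y, z} \<times> {v, w}. of_bool (e1 i j) * g i j)"
  \<comment> \<open>A pair not moved by both transpositions cancels: if it avoids {v, w}, the terms
    with \<open>s\<close> repeat those without it; if it avoids {y, z}, the terms with
    \<open>r\<close> do.\<close>
  proof (rule sum.mono_neutral_right, goal_cases)
    case 3
    have "g i j = 0" if "(i, j) \<notin> {v, w} \<times> {y, z} \<union> {y, z} \<times> {v, w}" for i j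
    proof (cases "i \<notin> {v, w} \<and> j \<notin> {v, w}")
      case True
      then have "s i = i" "s j = j" "s (r i) = r i" "s (r j) = r j"
        using A1(5) by (auto simp: s_def r_def transpose_def)
      then show ?thesis by (simp add: g_def)
    next
      case False
      then have "i \<notin> {y, z} \<and> j \<notin> {y, z}" using that A1(5) by auto
      then have "r i = i" "r j = j" by (auto simp: r_def transpose_def)
      then show ?thesis by (simp add: g_def)
    qed
    then have "of_bool (e1 (fst p) (snd p)) * g (fst p) (snd p) = 0"
      if "p \<in> {..<n} \<times> {..<n} - ({v, w} \<times> {y, z} \<union> {y, z} \<times> {v, w})" for p
      using that by (metis DiffD2 mult_zero_right prod.collapse)
    then show ?case by (intro ballI) (simp only: case_prod_unfold)
  qed (use A1 in auto)
  \<comment> \<open>The four ordered pairs that are edges of \<open>e1\<close> contribute 2 each; on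
    the other four \<open>e1\<close> is false.\<close>
  also have "\<dots> = 8"
  proof -
    have "s v = w" "s w = v" "s y = y" "s z = z" "r v = v" "r w = w" "r y = z" "r z = y"
      using A1(5) by (auto simp: s_def r_def transpose_def)
    moreover have e': "e y v" "e z w" "\<not> e z v" "\<not> e y w" "e1 y v" "e1 z w" "\<not> e1 z v" "\<not> e1 y w"
      using A1 e esym sym1 by blast+
    ultimately have g: "g v y = 2" "g w z = 2" "g y v = 2" "g z w = 2"
      using e by (simp_all only: g_def of_bool_eq)
    have S: "{v, w} \<times> {y, z} \<union> {y, z} \<times> {v, w} =
      set [(v, y), (v, z), (w, y), (w, z), (y, v), (y, w), (z, v), (z, w)]" by auto
    have "distinct [(v, y), (v, z), (w, y), (w, z), (y, v), (y, w), (z, v), (z, w)]"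
      using A1(5) by auto
    then show ?thesis
      unfolding S sum.distinct_set_conv_list[OF \<open>distinct [(v, y), _, _, _, _, _, _, _]\<close>]
      using A1(6-9) e'(5-8) g by (simp only: list.map prod.case sum_list.Cons sum_list.Nil) simp
  qed
  finally show False by simp
qed

section \<open>Biregular relations with prescribed degrees\<close>

lemma card_mod_eq:
  assumes "j < (m::nat)"
  shows "card {q. q < m * b \<and> q mod m = j} = b"
proof -
  have "{q. q < m * b \<and> q mod m = j} = (\<lambda>c. j + m * c) ` {..<b}"
  proof (intro equalityI subsetI)
    fix q assume "q \<in> {q. q < m * b \<and> q mod m = j}"
    then have "q div m < b" "q = j + m * (q div m)"
      using less_mult_imp_div_less[of q b m] by (auto simp: mult.commute)
    then show "q \<in> (\<lambda>c. j + m * c) ` {..<b}" by blast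
  next
    fix q assume "q \<in> (\<lambda>c. j + m * c) ` {..<b}"
    then obtain c where c: "q = j + m * c" "c < b" by auto
    have "j + m * c < m * (c + 1)" using assms by simp
    also have "\<dots> \<le> m * b" using c by (intro mult_le_mono2) simp
    finally show "q \<in> {q. q < m * b \<and> q mod m = j}" using c assms by simp
  qed
  moreover have "inj_on (\<lambda>c. j + m * c) {..<b}" using assms by (auto simp: inj_on_def)
  ultimately show ?thesis by (simp add: card_image)
qed

definition biregular :: "nat \<Rightarrow> nat \<Rightarrow> nat \<Rightarrow> nat \<Rightarrow> (nat \<Rightarrow> nat \<Rightarrow> bool) \<Rightarrow> bool" where
  "biregular n m a b \<beta> \<longleftrightarrow> (\<forall>i<n. card {j. j < m \<and> \<beta> i j} = a) \<and> (\<forall>j<m. card {i. i < n \<and> \<beta> i j} = b)"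

lemma mod_add_eq_nat_lt:
  fixes k k' m c :: nat
  assumes "(c + k) mod m = (c + k') mod m" "k < m" "k' < m"
  shows "k = k'"
proof -
  have *: "k = k'" if "(c + k) mod m = (c + k') mod m" "k \<le> k'" "k' < m" for k k'
  proof -
    have "m dvd (c + k') - (c + k)" using that by (intro mod_eq_dvd_iff_nat[THEN iffD1]) auto
    then have "m dvd k' - k" by simp
    then show ?thesis using that nat_dvd_not_less[of "k' - k" m] by (cases "k = k'") auto
  qed
  show ?thesis using *[of k k'] *[of k' k] assms by (cases "k \<le> k'") auto
qed

text \<open>Columns are dealt out cyclically: the numbers below \<open>n * a\<close>, read modulo
  \<open>m\<close>, are cut into n runs of length a, one for each row. A run has no repetition since
  \<open>a \<le> m\<close>, and each residue occurs b times among the first \<open>m * b\<close>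
  numbers.\<close>

lemma biregular_exists:
  assumes "n * a = m * b" "a \<le> m"
  shows "\<exists>\<beta>. biregular n m a b \<beta>"
proof -
  define \<beta> where "\<beta> i j \<longleftrightarrow> (\<exists>k<a. (i * a + k) mod m = j)" for i j
  have "card {j. j < m \<and> \<beta> i j} = a" for i
  proof -
    have "{j. j < m \<and> \<beta> i j} = (\<lambda>k. (i * a + k) mod m) ` {..<a}"
      using assms(2) by (auto simp: \<beta>_def)
    moreover have "inj_on (\<lambda>k. (i * a + k) mod m) {..<a}"
      using assms(2) by (auto simp: inj_on_def dest!: mod_add_eq_nat_lt)
    ultimately show ?thesis by (simp add: card_image)
  qed
  moreover have "card {i. i < n \<and> \<beta> i j} = b" if j: "j < m" for j
  proof -
    have "{i. i < n \<and> \<beta> i j} = (\<lambda>q. q div a) ` {q. q < m * b \<and> q mod m = j}"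
    proof (intro equalityI subsetI)
      fix i assume "i \<in> {i. i < n \<and> \<beta> i j}"
      then obtain k where k: "i < n" "k < a" "(i * a + k) mod m = j" by (auto simp: \<beta>_def)
      have "i * a + k < (i + 1) * a" using k by simp
      also have "\<dots> \<le> n * a" using k by (intro mult_le_mono1) simp
      finally have "i * a + k < m * b" using assms(1) by simp
      moreover have "(i * a + k) div a = i" using k by simp
      ultimately show "i \<in> (\<lambda>q. q div a) ` {q. q < m * b \<and> q mod m = j}" using k by force
    next
      fix i assume "i \<in> (\<lambda>q. q div a) ` {q. q < m * b \<and> q mod m = j}"
      then obtain q where q: "i = q div a" "q < n * a" "q mod m = j" using assms(1) by auto
      then have "a > 0" by (cases a) auto
      then show "i \<in> {i. i < n \<and> \<beta> i j}"
        using q by (auto simp: \<beta>_def less_mult_imp_div_less intro!: exI[of _ "q mod a"])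
    qed
    moreover have "inj_on (\<lambda>q. q div a) {q. q < m * b \<and> q mod m = j}"
    proof (rule inj_onI)
      fix q q' assume q: "q \<in> {q. q < m * b \<and> q mod m = j}" "q' \<in> {q. q < m * b \<and> q mod m = j}"
        "q div a = q' div a"
      then have "a > 0" using assms(1) by (cases a) auto
      then have "q mod a < m" "q' mod a < m"
        using assms(2) mod_less_divisor less_le_trans by blast+
      moreover have "(q div a * a + q mod a) mod m = (q div a * a + q' mod a) mod m"
        using q by (metis (mono_tags, lifting) div_mult_mod_eq mem_Collect_eq)
      ultimately have "q mod a = q' mod a" by (metis mod_add_eq_nat_lt)
      then show "q = q'" using q(3) by (metis div_mult_mod_eq)
    qed
    ultimately show ?thesis using card_mod_eq[OF j] by (simp add: card_image)
  qed
  ultimately show ?thesis unfolding biregular_def by blast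
qed


section \<open>Circulant graphs\<close>

lemma even_degree_sum:
  assumes sym: "\<And>i j. i < n \<Longrightarrow> j < n \<Longrightarrow> e i j = e j i"
    and irrefl: "\<And>i. i < n \<Longrightarrow> \<not> e i i"
    and deg: "\<And>i. i < n \<Longrightarrow> card {j. j < n \<and> e i j} = d"
  shows "even (n * d)"
proof -
  define U where "U = {(i, j). i < j \<and> j < n \<and> e i j}"
  have fU: "finite U" by (rule finite_subset[of _ "{..<n} \<times> {..<n}"]) (auto simp: U_def)
  have "Sigma {..<n} (\<lambda>i. {j. j < n \<and> e i j}) = U \<union> prod.swap ` U"
  proof (intro equalityI subsetI)
    fix p assume "p \<in> Sigma {..<n} (\<lambda>i. {j. j < n \<and> e i j})"
    then obtain i j where p: "p = (i, j)" "i < n" "j < n" "e i j" by auto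
    then consider "i < j" | "j < i" using irrefl by (metis linorder_neqE_nat)
    then show "p \<in> U \<union> prod.swap ` U" using p sym[of i j] by cases (auto simp: U_def)
  qed (use sym in \<open>auto simp: U_def\<close>)
  moreover have "U \<inter> prod.swap ` U = {}" by (auto simp: U_def)
  ultimately have "card (Sigma {..<n} (\<lambda>i. {j. j < n \<and> e i j})) = card U + card (prod.swap ` U)"
    using fU by (simp add: card_Un_disjoint)
  then show ?thesis using deg by (simp add: card_image)
qed

text \<open>A Cayley graph of Z/n; \<open>(n - i + j) mod n\<close> is the difference j - i without
  negative numbers. The connection set is 1, ..., \<open>d div 2\<close> with the negatives, plus
  the antipode n/2 for odd d. It contains the steps of a Hamiltonian cycle if
  \<open>2 \<le> d\<close>, and is an antipodal matching if \<open>d = 1\<close>.\<close>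

definition circulant :: "nat \<Rightarrow> nat \<Rightarrow> nat \<Rightarrow> nat \<Rightarrow> bool" where
  "circulant n d i j \<longleftrightarrow> (let e = (n - i + j) mod n in
     0 < e \<and> (e \<le> d div 2 \<or> n - d div 2 \<le> e \<or> odd d \<and> 2 * e = n))"

lemma circulant_irrefl:
  assumes "i < n"
  shows "\<not> circulant n d i i"
proof -
  have "(n - i + i) mod n = 0" using assms by simp
  then show ?thesis unfolding circulant_def Let_def by (simp only: less_irrefl simp_thms)
qed

text \<open>The connection set, here \<open>P\<close>, is closed under negation, which sends c to
  \<open>n - c\<close>.\<close>

lemma circulant_sym:
  assumes "i < n" "j < n"
  shows "circulant n d i j = circulant n d j i"
proof -
  define P where "P c \<longleftrightarrow> 0 < c \<and> (c \<le> d div 2 \<or> n - d div 2 \<le> c \<or> odd d \<and> 2 * c = n)" for c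
  have circ: "circulant n d i j \<longleftrightarrow> P ((n - i + j) mod n)" for i j
    unfolding circulant_def Let_def P_def ..
  have P: "P (n - c) \<longleftrightarrow> P c" if "0 < c" "c < n" for c
  proof -
    have "n - c \<le> k \<longleftrightarrow> n - k \<le> c" "n - k \<le> n - c \<longleftrightarrow> c \<le> k \<or> n \<le> k" for k
      using that by auto
    moreover have "2 * (n - c) = n \<longleftrightarrow> 2 * c = n" "0 < n - c" using that by auto
    ultimately show ?thesis unfolding P_def using that by (metis diff_is_0_eq' zero_le)
  qed
  have *: "circulant n d i j = circulant n d j i" if "i < j" "j < n" for i j
  proof -
    have "(n - i + j) mod n = j - i" "(n - j + i) mod n = n - (j - i)"
      using that by (simp_all add: mod_if)
    then show ?thesis using P[of "j - i"] that unfolding circ by simp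
  qed
  show ?thesis using *[of i j] *[of j i] assms by (cases i j rule: linorder_cases) blast+
qed

text \<open>Rotation maps the neighborhood onto the connection set \<open>S\<close>. The two arcs of
  \<open>S\<close> are disjoint because \<open>d < n\<close>; for odd d the handshake parity makes n
  even, so the antipode exists.\<close>

lemma circulant_degree:
  assumes "d < n" "even (n * d)" "i < n"
  shows "card {j. j < n \<and> circulant n d i j} = d"
proof -
  define k where "k = d div 2"
  define S where "S = {e. e < n \<and> 0 < e \<and> (e \<le> k \<or> n - k \<le> e \<or> odd d \<and> 2 * e = n)}"
  define f where "f j = (n - i + j) mod n" for j
  have inj: "inj_on f {..<n}" by (auto simp: inj_on_def f_def dest!: mod_add_eq_nat_lt)
  have "f ` {..<n} \<subseteq> {..<n}" using assms by (auto simp: f_def)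
  then have img: "f ` {..<n} = {..<n}" using inj by (simp add: endo_inj_surj)
  have "f ` {j. j < n \<and> circulant n d i j} = S"
  proof (intro equalityI subsetI)
    fix e assume "e \<in> S"
    moreover from this obtain j where "j < n" "e = f j" using img by (auto simp: S_def)
    ultimately show "e \<in> f ` {j. j < n \<and> circulant n d i j}"
      by (auto simp: S_def circulant_def f_def k_def)
  qed (use assms in \<open>auto simp: S_def circulant_def f_def k_def Let_def\<close>)
  moreover have "inj_on f {j. j < n \<and> circulant n d i j}"
    using inj by (rule inj_on_subset) auto
  ultimately have "card {j. j < n \<and> circulant n d i j} = card S"
    by (metis card_image)
  also have "card S = d"
  proof (cases "even d")
    case True
    then have d: "d = 2 * k" by (simp add: k_def)
    then have "S = {1..k} \<union> {n - k..<n}" "{1..k} \<inter> {n - k..<n} = {}"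
      using assms(1) by (auto simp: S_def)
    then show ?thesis using d assms(1) by (simp add: card_Un_disjoint)
  next
    case False
    then have d: "d = 2 * k + 1" by (simp add: k_def)
    obtain h where h: "n = 2 * h" using assms(2) False by auto
    have "S = insert h ({1..k} \<union> {n - k..<n})" "{1..k} \<inter> {n - k..<n} = {}"
      "h \<notin> {1..k} \<union> {n - k..<n}"
      using assms(1) False d h by (auto simp: S_def)
    then show ?thesis using d assms(1) by (simp add: card_Un_disjoint)
  qed
  finally show ?thesis .
qed

lemma circulant_Suc:
  assumes "2 \<le> d" "Suc i < n"
  shows "circulant n d i (Suc i)"
proof -
  have "(n - i + Suc i) mod n = 1" using assms by (simp add: mod_if)
  moreover have "1 \<le> d div 2" using assms by simp
  ultimately show ?thesis by (simp add: circulant_def)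
qed

lemma circulant_last:
  assumes "2 \<le> d" "2 \<le> n"
  shows "circulant n d (n - 1) 0"
proof -
  have "1 \<le> d div 2" using assms by simp
  then show ?thesis using assms by (simp add: circulant_def)
qed

text \<open>The antipodal distance is 1 only for n = 2. Hence a matching labeled in this way avoids
  the cyclic order of the labels, which survives in the complement taken by (M1).\<close>

lemma not_circulant_one_Suc:
  assumes "3 \<le> n" "Suc i < n"
  shows "\<not> circulant n 1 i (Suc i)"
proof -
  have "(n - i + Suc i) mod n = 1" using assms by (simp add: mod_if)
  then show ?thesis using assms by (simp add: circulant_def)
qed

lemma not_circulant_one_last:
  assumes "3 \<le> n"
  shows "\<not> circulant n 1 (n - 1) 0"
proof -
  have "(n - (n - 1) + 0) mod n = 1" using assms by simp
  then show ?thesis using assms by (simp add: circulant_def)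
qed

section \<open>Biregular relations that are not isomorphic\<close>

definition twin_class :: "nat \<Rightarrow> nat \<Rightarrow> (nat \<Rightarrow> nat \<Rightarrow> bool) \<Rightarrow> nat \<Rightarrow> nat set" where
  "twin_class n m \<beta> i = {i'. i' < n \<and> (\<forall>j<m. \<beta> i' j = \<beta> i j)}"

text \<open>If all columns have degree \<open>b\<close>, then \<open>b\<close> twin rows with a
  common neighbor fill each of their columns and hence form a component K_{b,a}. The cardinality of
  this set thus measures the number of such components.\<close>

definition twins :: "nat \<Rightarrow> nat \<Rightarrow> nat \<Rightarrow> (nat \<Rightarrow> nat \<Rightarrow> bool) \<Rightarrow> nat set" where
  "twins n m b \<beta> = {i. i < n \<and> card (twin_class n m \<beta> i) = b}"

lemma card_twins_iso:
  assumes \<sigma>: "bij_betw \<sigma> {..<n} {..<n}" and \<rho>: "bij_betw \<rho> {..<m} {..<m}"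
    and iso: "\<And>i j. i < n \<Longrightarrow> j < m \<Longrightarrow> \<beta> i j = \<beta>' (\<sigma> i) (\<rho> j)"
  shows "card (twins n m b \<beta>) = card (twins n m b \<beta>')"
proof -
  have \<sigma>im: "\<sigma> ` {..<n} = {..<n}" and \<rho>im: "\<rho> ` {..<m} = {..<m}"
    and inj: "inj_on \<sigma> {..<n}" using \<sigma> \<rho> by (auto simp: bij_betw_def)
  have row: "(\<forall>j<m. \<beta>' (\<sigma> i') j = \<beta>' (\<sigma> i) j) \<longleftrightarrow> (\<forall>j<m. \<beta> i' j = \<beta> i j)"
    if "i < n" "i' < n" for i i'
  proof -
    have "(\<forall>j\<in>{..<m}. \<beta>' (\<sigma> i') j = \<beta>' (\<sigma> i) j) \<longleftrightarrow> (\<forall>j\<in>\<rho> ` {..<m}. \<beta>' (\<sigma> i') j = \<beta>' (\<sigma> i) j)"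
      unfolding \<rho>im ..
    also have "\<dots> \<longleftrightarrow> (\<forall>j\<in>{..<m}. \<beta> i' j = \<beta> i j)" using that iso by simp
    finally show ?thesis by (simp add: lessThan_def)
  qed
  have cl: "twin_class n m \<beta>' (\<sigma> i) = \<sigma> ` twin_class n m \<beta> i" if "i < n" for i
  proof (intro equalityI subsetI)
    fix x assume x: "x \<in> twin_class n m \<beta>' (\<sigma> i)"
    then obtain i' where "i' < n" "x = \<sigma> i'" using \<sigma>im by (auto simp: twin_class_def)
    then show "x \<in> \<sigma> ` twin_class n m \<beta> i"
      using x row[OF that] by (auto simp: twin_class_def)
  next
    fix x assume "x \<in> \<sigma> ` twin_class n m \<beta> i"
    then obtain i' where i': "i' < n" "x = \<sigma> i'" "\<forall>j<m. \<beta> i' j = \<beta> i j"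
      by (auto simp: twin_class_def)
    moreover have "\<sigma> i' < n" using \<sigma>im i'(1) by auto
    ultimately show "x \<in> twin_class n m \<beta>' (\<sigma> i)"
      using row[OF that i'(1)] by (simp add: twin_class_def)
  qed
  have card_cl: "card (twin_class n m \<beta>' (\<sigma> i)) = card (twin_class n m \<beta> i)" if "i < n" for i
    unfolding cl[OF that]
    by (intro card_image inj_on_subset[OF inj]) (auto simp: twin_class_def)
  have "twins n m b \<beta>' = \<sigma> ` twins n m b \<beta>"
  proof (intro equalityI subsetI)
    fix x assume x: "x \<in> twins n m b \<beta>'"
    then obtain i where "i < n" "x = \<sigma> i" using \<sigma>im by (auto simp: twins_def)
    then show "x \<in> \<sigma> ` twins n m b \<beta>" using x card_cl by (auto simp: twins_def)
  qed (use \<sigma>im card_cl in \<open>auto simp: twins_def\<close>)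
  moreover have "inj_on \<sigma> (twins n m b \<beta>)"
    by (intro inj_on_subset[OF inj]) (auto simp: twins_def)
  ultimately show ?thesis by (simp add: card_image)
qed

definition biregular_iso ::
  "nat \<Rightarrow> nat \<Rightarrow> (nat \<Rightarrow> nat \<Rightarrow> bool) \<Rightarrow> (nat \<Rightarrow> nat \<Rightarrow> bool) \<Rightarrow> bool" where
  "biregular_iso n m \<beta> \<beta>' \<longleftrightarrow> (\<exists>\<sigma> \<rho>. bij_betw \<sigma> {..<n} {..<n} \<and> bij_betw \<rho> {..<m} {..<m} \<and>
     (\<forall>i<n. \<forall>j<m. \<beta> i j = \<beta>' (\<sigma> i) (\<rho> j)))"

text \<open>Next to a component K_{b,a} on the first b rows and a columns,
  \<open>2 * a \<le> m\<close> leaves room for a biregular \<open>\<gamma>\<close> on the rest. A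
  switch between the two parts keeps all degrees and strictly shrinks \<open>twins\<close>.\<close>

lemma nonisomorphic_biregular_sparse:
  assumes nm: "n * a = m * b" and a: "2 \<le> a" "2 * a \<le> m" and b: "2 \<le> b"
  shows "\<exists>\<beta> \<beta>'. biregular n m a b \<beta> \<and> biregular n m a b \<beta>' \<and> \<not> biregular_iso n m \<beta> \<beta>'"
proof -
  have "2 * b * a \<le> n * a" using nm mult_le_mono1[OF a(2), of b] by (simp add: mult_ac)
  then have bn: "2 * b \<le> n" using a by simp
  have "(n - b) * a = (m - a) * b"
    using nm by (simp add: diff_mult_distrib diff_mult_distrib2 mult.commute)
  moreover have "a \<le> m - a" using a by simp
  ultimately obtain \<gamma> where \<gamma>: "biregular (n - b) (m - a) a b \<gamma>"
    using biregular_exists by blast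
  have \<gamma>r: "card {j. j < m - a \<and> \<gamma> i j} = a" if "i < n - b" for i
    using \<gamma> that by (simp add: biregular_def)
  have \<gamma>c: "card {i. i < n - b \<and> \<gamma> i j} = b" if "j < m - a" for j
    using \<gamma> that by (simp add: biregular_def)
  define \<beta> where "\<beta> i j \<longleftrightarrow> (if i < b then j < a else a \<le> j \<and> \<gamma> (i - b) (j - a))" for i j
  have row: "card {j. j < m \<and> \<beta> i j} = a" if "i < n" for i
  proof (cases "i < b")
    case True
    then have "{j. j < m \<and> \<beta> i j} = {..<a}" using a by (auto simp: \<beta>_def)
    then show ?thesis by simp
  next
    case False
    have "{j. j < m \<and> \<beta> i j} = (\<lambda>j. j + a) ` {j. j < m - a \<and> \<gamma> (i - b) j}"
    proof (intro equalityI subsetI)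
      fix j assume "j \<in> {j. j < m \<and> \<beta> i j}"
      then show "j \<in> (\<lambda>j. j + a) ` {j. j < m - a \<and> \<gamma> (i - b) j}"
        using False by (intro image_eqI[of _ _ "j - a"]) (auto simp: \<beta>_def)
    qed (use False in \<open>auto simp: \<beta>_def\<close>)
    then show ?thesis using \<gamma>r[of "i - b"] that False by (simp add: card_image)
  qed
  have col: "card {i. i < n \<and> \<beta> i j} = b" if "j < m" for j
  proof (cases "j < a")
    case True
    then have "{i. i < n \<and> \<beta> i j} = {..<b}" using bn by (auto simp: \<beta>_def)
    then show ?thesis by simp
  next
    case False
    have "{i. i < n \<and> \<beta> i j} = (\<lambda>i. i + b) ` {i. i < n - b \<and> \<gamma> i (j - a)}"
    proof (intro equalityI subsetI)
      fix i assume "i \<in> {i. i < n \<and> \<beta> i j}"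
      then show "i \<in> (\<lambda>i. i + b) ` {i. i < n - b \<and> \<gamma> i (j - a)}"
        using False by (intro image_eqI[of _ _ "i - b"]) (auto simp: \<beta>_def split: if_splits)
    qed (use False in \<open>auto simp: \<beta>_def\<close>)
    then show ?thesis using \<gamma>c[of "j - a"] that False by (simp add: card_image)
  qed
  have "0 < n - b" using b bn by simp
  then have "card {j. j < m - a \<and> \<gamma> 0 j} \<noteq> 0" using \<gamma>r[of 0] a(1) by linarith
  then obtain y' where y': "y' < m - a" "\<gamma> 0 y'"
    by (metis (mono_tags, lifting) Collect_empty_eq card.empty)
  obtain y where y: "a \<le> y" "y < m" "\<beta> b y"
  proof (rule that)
    show "a \<le> y' + a" "y' + a < m" "\<beta> b (y' + a)" using y' by (simp_all add: \<beta>_def less_diff_conv)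
  qed
  \<comment> \<open>Switching along the 4-cycle \<open>0 0 b y\<close> destroys the component \<open>K\<^bsub>b,a\<^esub>\<close> and creates no new one.\<close>
  define \<beta>' where "\<beta>' i j \<longleftrightarrow> (if (i, j) \<in> {(0, 0), (b, y)} then False
     else if (i, j) \<in> {(0, y), (b, 0)} then True else \<beta> i j)" for i j
  have ineq: "0 < b" "b < n" "0 < a" "a < m" "0 < y" "1 < a" using a b bn y by auto
  have row': "card {j. j < m \<and> \<beta>' i j} = a" if "i < n" for i
  proof -
    consider "i = 0" | "i = b" | "i \<noteq> 0" "i \<noteq> b" by blast
    then show ?thesis
    proof cases
      case 1
      have "{j. j < m \<and> \<beta>' i j} = insert y ({j. j < m \<and> \<beta> i j} - {0})" "y \<notin> {j. j < m \<and> \<beta> i j}"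
        "0 \<in> {j. j < m \<and> \<beta> i j}"
        using 1 ineq y by (auto simp: \<beta>'_def \<beta>_def)
      then show ?thesis using row[OF that] ineq by (simp add: card_insert_if)
    next
      case 2
      have "{j. j < m \<and> \<beta>' i j} = insert 0 ({j. j < m \<and> \<beta> i j} - {y})" "0 \<notin> {j. j < m \<and> \<beta> i j}"
        "y \<in> {j. j < m \<and> \<beta> i j}"
        using 2 ineq y by (auto simp: \<beta>'_def \<beta>_def)
      then show ?thesis using row[OF that] ineq by (simp add: card_insert_if)
    next
      case 3
      then have "{j. j < m \<and> \<beta>' i j} = {j. j < m \<and> \<beta> i j}" by (auto simp: \<beta>'_def)
      then show ?thesis using row[OF that] by simp
    qed
  qed
  have col': "card {i. i < n \<and> \<beta>' i j} = b" if "j < m" for j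
  proof -
    consider "j = 0" | "j = y" | "j \<noteq> 0" "j \<noteq> y" by blast
    then show ?thesis
    proof cases
      case 1
      have "{i. i < n \<and> \<beta>' i j} = insert b ({i. i < n \<and> \<beta> i j} - {0})" "b \<notin> {i. i < n \<and> \<beta> i j}"
        "0 \<in> {i. i < n \<and> \<beta> i j}"
        using 1 ineq y by (auto simp: \<beta>'_def \<beta>_def)
      then show ?thesis using col[OF that] ineq by (simp add: card_insert_if)
    next
      case 2
      have "{i. i < n \<and> \<beta>' i j} = insert 0 ({i. i < n \<and> \<beta> i j} - {b})" "0 \<notin> {i. i < n \<and> \<beta> i j}"
        "b \<in> {i. i < n \<and> \<beta> i j}"
        using 2 ineq y by (auto simp: \<beta>'_def \<beta>_def)
      then show ?thesis using col[OF that] ineq by (simp add: card_insert_if)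
    next
      case 3
      then have "{i. i < n \<and> \<beta>' i j} = {i. i < n \<and> \<beta> i j}" by (auto simp: \<beta>'_def)
      then show ?thesis using col[OF that] by simp
    qed
  qed
  have fin: "finite (twin_class n m f i)" for f i by (simp add: twin_class_def)
  have small: "i \<in> twins n m b \<beta>" if "i < b" for i
  proof -
    have "twin_class n m \<beta> i = {..<b}"
    proof (intro equalityI subsetI)
      fix i' assume "i' \<in> twin_class n m \<beta> i"
      then have "\<beta> i' 0 = \<beta> i 0" using ineq by (simp add: twin_class_def)
      then show "i' \<in> {..<b}" using that ineq by (auto simp: \<beta>_def split: if_splits)
    qed (use that ineq in \<open>auto simp: twin_class_def \<beta>_def\<close>)
    then show ?thesis using that ineq by (simp add: twins_def)
  qed
  have not0: "0 \<notin> twins n m b \<beta>'"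
  proof -
    \<comment> \<open>As \<open>1 < a\<close>, a twin of row 0 contains column 1 and so lies among
      the first b rows; of these only row 0 misses column 0.\<close>
    have "i' = 0" if "i' \<in> twin_class n m \<beta>' 0" for i'
    proof (rule ccontr)
      assume i': "i' \<noteq> 0"
      have "\<beta>' i' 1 = \<beta>' 0 1" "\<beta>' i' 0 = \<beta>' 0 0" using that ineq by (auto simp: twin_class_def)
      then show False using ineq i' y by (auto simp: \<beta>'_def \<beta>_def split: if_splits)
    qed
    then have "twin_class n m \<beta>' 0 \<subseteq> {0}" by auto
    then have "card (twin_class n m \<beta>' 0) \<le> 1" using card_mono[of "{0}"] by simp
    then show ?thesis using b by (auto simp: twins_def)
  qed
  have "twins n m b \<beta>' \<subseteq> twins n m b \<beta>"
  proof
    fix z assume z: "z \<in> twins n m b \<beta>'"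
    then have zn: "z < n" and zc: "card (twin_class n m \<beta>' z) = b" by (auto simp: twins_def)
    \<comment> \<open>After the switch, row b is the only one that contains column 0 but not column
      1, so it has no twin, whereas b is at least 2.\<close>
    have "z \<noteq> b"
    proof
      assume "z = b"
      have "i' = b" if "i' \<in> twin_class n m \<beta>' b" for i'
      proof (rule ccontr)
        assume i': "i' \<noteq> b"
        have "\<beta>' i' 1 = \<beta>' b 1" "\<beta>' i' 0 = \<beta>' b 0" using that ineq by (auto simp: twin_class_def)
        then show False using ineq i' y by (auto simp: \<beta>'_def \<beta>_def split: if_splits)
      qed
      then have "twin_class n m \<beta>' b \<subseteq> {b}" by auto
      then have "card (twin_class n m \<beta>' b) \<le> 1" using card_mono[of "{b}"] by simp
      then show False using b zc \<open>z = b\<close> by simp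
    qed
    show "z \<in> twins n m b \<beta>"
    proof (cases "z < b")
      case False
      \<comment> \<open>All twins of an untouched row z are untouched too, so the switch has not
        enlarged its class. The old class in turn has at most b members, as it fits into a single
        column.\<close>
      have sub: "twin_class n m \<beta>' z \<subseteq> twin_class n m \<beta> z"
      proof
        fix i' assume i': "i' \<in> twin_class n m \<beta>' z"
        then have eq: "\<beta>' i' j = \<beta>' z j" if "j < m" for j using that by (auto simp: twin_class_def)
        have "1 < m" using ineq by simp
        have "\<not> \<beta>' z 1" "\<not> \<beta>' z 0" "\<beta>' 0 1" "\<beta>' b 0"
          using ineq y(1,2) False \<open>z \<noteq> b\<close> by (auto simp: \<beta>'_def \<beta>_def)
        moreover have "\<beta>' i' 1 = \<beta>' z 1" "\<beta>' i' 0 = \<beta>' z 0"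
          using eq \<open>1 < m\<close> by simp_all
        ultimately have "i' \<noteq> 0" "i' \<noteq> b" by metis+
        then have "\<beta>' i' j = \<beta> i' j" "\<beta>' z j = \<beta> z j" for j
          using False \<open>z \<noteq> b\<close> ineq by (auto simp: \<beta>'_def)
        then show "i' \<in> twin_class n m \<beta> z"
          using i' by (simp add: twin_class_def)
      qed
      have "card {j. j < m \<and> \<beta> z j} \<noteq> 0" using row[OF zn] ineq(3) by linarith
      then obtain j where j: "j < m" "\<beta> z j"
        by (metis (mono_tags, lifting) Collect_empty_eq card.empty)
      then have "twin_class n m \<beta> z \<subseteq> {i. i < n \<and> \<beta> i j}" by (auto simp: twin_class_def)
      then have "card (twin_class n m \<beta> z) \<le> card {i. i < n \<and> \<beta> i j}" by (intro card_mono) simp_all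
      then have "card (twin_class n m \<beta> z) \<le> b" using col[OF j(1)] by simp
      moreover have "b \<le> card (twin_class n m \<beta> z)" using card_mono[OF fin sub] unfolding zc .
      ultimately show ?thesis using zn by (simp add: twins_def)
    qed (use small in simp)
  qed
  moreover have "0 \<in> twins n m b \<beta>" using small ineq by simp
  ultimately have "twins n m b \<beta>' \<subset> twins n m b \<beta>" using not0 by blast
  then have "card (twins n m b \<beta>') < card (twins n m b \<beta>)"
    by (intro psubset_card_mono) (simp_all add: twins_def)
  have "\<not> biregular_iso n m \<beta> \<beta>'"
  proof
    assume "biregular_iso n m \<beta> \<beta>'"
    then obtain \<sigma> \<rho> where "bij_betw \<sigma> {..<n} {..<n}" "bij_betw \<rho> {..<m} {..<m}"
        "\<And>i j. i < n \<Longrightarrow> j < m \<Longrightarrow> \<beta> i j = \<beta>' (\<sigma> i) (\<rho> j)"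
      unfolding biregular_iso_def by blast
    then have "card (twins n m b \<beta>) = card (twins n m b \<beta>')"
      using card_twins_iso[of \<sigma> n \<rho> m \<beta> \<beta>' b] by simp
    then show False using \<open>card (twins n m b \<beta>') < _\<close> by simp
  qed
  moreover have "biregular n m a b \<beta>" "biregular n m a b \<beta>'"
    unfolding biregular_def using row col row' col' by simp_all
  ultimately show ?thesis by blast
qed

lemma card_not_lt: "card {j. j < m \<and> \<not> Q j} = m - card {j. j < (m::nat) \<and> Q j}"
proof -
  have "{j. j < m \<and> \<not> Q j} = {..<m} - {j. j < m \<and> Q j}" by auto
  then show ?thesis by (simp add: card_Diff_subset subset_iff)
qed

lemma biregular_complement:
  assumes "biregular n m a b \<beta>"
  shows "biregular n m (m - a) (n - b) (\<lambda>i j. \<not> \<beta> i j)"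
  using assms unfolding biregular_def card_not_lt by auto

text \<open>For \<open>2 * a > m\<close>, complementing turns the degrees into \<open>m - a\<close>
  and \<open>n - b\<close>, which are still at least 2 and fall under the sparse case.\<close>

lemma nonisomorphic_biregular:
  assumes nm: "n * a = m * b" and a: "2 \<le> a" "a + 2 \<le> m" and b: "2 \<le> b" "b + 2 \<le> n"
  shows "\<exists>\<beta> \<beta>'. biregular n m a b \<beta> \<and> biregular n m a b \<beta>' \<and> \<not> biregular_iso n m \<beta> \<beta>'"
proof (cases "2 * a \<le> m")
  case True
  then show ?thesis using assms nonisomorphic_biregular_sparse by blast
next
  case False
  have "n * (m - a) = m * (n - b)" using nm by (simp add: diff_mult_distrib2 mult.commute)
  then have "\<exists>\<beta> \<beta>'. biregular n m (m - a) (n - b) \<beta> \<and> biregular n m (m - a) (n - b) \<beta>' \<and>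
      \<not> biregular_iso n m \<beta> \<beta>'"
    by (rule nonisomorphic_biregular_sparse) (use a b False in auto)
  then obtain \<beta> \<beta>' where *: "biregular n m (m - a) (n - b) \<beta>" "biregular n m (m - a) (n - b) \<beta>'"
      "\<not> biregular_iso n m \<beta> \<beta>'"
    by blast
  have "m - (m - a) = a" "n - (n - b) = b" using a b by auto
  then have "biregular n m a b (\<lambda>i j. \<not> \<beta> i j)" "biregular n m a b (\<lambda>i j. \<not> \<beta>' i j)"
    using *(1,2)[THEN biregular_complement] by simp_all
  moreover have "\<not> biregular_iso n m (\<lambda>i j. \<not> \<beta> i j) (\<lambda>i j. \<not> \<beta>' i j)"
    using *(3) by (simp add: biregular_iso_def)
  ultimately show ?thesis by blast
qed

section \<open>Templates\<close>

text \<open>\<open>P\<close>, \<open>n\<close> and \<open>d\<close> are the cells, sizes and degree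
  matrix of an equitable partition. \<open>b X Y i j\<close> is adjacency of label i in X and label
  j in Y, with \<open>b X X\<close> for the inner graph; values at labels beyond the sizes are
  arbitrary.\<close>

definition valid_template ::
  "'c set \<Rightarrow> ('c \<Rightarrow> nat) \<Rightarrow> ('c \<Rightarrow> 'c \<Rightarrow> nat) \<Rightarrow> ('c \<Rightarrow> 'c \<Rightarrow> nat \<Rightarrow> nat \<Rightarrow> bool) \<Rightarrow> bool" where
  "valid_template P n d b \<longleftrightarrow>
     (\<forall>X\<in>P. \<forall>Y\<in>P. \<forall>i<n X. \<forall>j<n Y. b X Y i j = b Y X j i) \<and>
     (\<forall>X\<in>P. \<forall>i<n X. \<not> b X X i i) \<and>
     (\<forall>X\<in>P. \<forall>Y\<in>P. \<forall>i<n X. card {j. j < n Y \<and> b X Y i j} = d X Y)"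

definition template_iso ::
  "'c set \<Rightarrow> ('c \<Rightarrow> nat) \<Rightarrow> ('c \<Rightarrow> nat \<Rightarrow> nat) \<Rightarrow> ('c \<Rightarrow> 'c \<Rightarrow> nat \<Rightarrow> nat \<Rightarrow> bool) \<Rightarrow>
   ('c \<Rightarrow> 'c \<Rightarrow> nat \<Rightarrow> nat \<Rightarrow> bool) \<Rightarrow> bool" where
  "template_iso P n \<sigma> b b' \<longleftrightarrow> (\<forall>X\<in>P. bij_betw (\<sigma> X) {..<n X} {..<n X}) \<and>
     (\<forall>X\<in>P. \<forall>Y\<in>P. \<forall>i<n X. \<forall>j<n Y. b X Y i j = b' X Y (\<sigma> X i) (\<sigma> Y j))"

definition replace_between ::
  "('c \<Rightarrow> 'c \<Rightarrow> nat \<Rightarrow> nat \<Rightarrow> bool) \<Rightarrow> 'c \<Rightarrow> 'c \<Rightarrow> (nat \<Rightarrow> nat \<Rightarrow> bool) \<Rightarrow> 'c \<Rightarrow> 'c \<Rightarrow> nat \<Rightarrow> nat \<Rightarrow> bool" where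
  "replace_between b X Y \<beta> U V i j =
     (if U = X \<and> V = Y then \<beta> i j else if U = Y \<and> V = X then \<beta> j i else b U V i j)"

definition replace_inside ::
  "('c \<Rightarrow> 'c \<Rightarrow> nat \<Rightarrow> nat \<Rightarrow> bool) \<Rightarrow> 'c \<Rightarrow> (nat \<Rightarrow> nat \<Rightarrow> bool) \<Rightarrow> 'c \<Rightarrow> 'c \<Rightarrow> nat \<Rightarrow> nat \<Rightarrow> bool" where
  "replace_inside b X e U V i j = (if U = X \<and> V = X then e i j else b U V i j)"

lemma replace_between_other:
  assumes "(U, V) \<noteq> (X, Y)" "(U, V) \<noteq> (Y, X)"
  shows "replace_between b X Y \<beta> U V = b U V"
proof -
  have "\<not> (U = X \<and> V = Y)" "\<not> (U = Y \<and> V = X)" using assms by simp_all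
  then show ?thesis unfolding fun_eq_iff replace_between_def by (simp only: if_False simp_thms)
qed

lemma replace_inside_other:
  assumes "(U, V) \<noteq> (X, X)"
  shows "replace_inside b X e U V = b U V"
proof -
  have "\<not> (U = X \<and> V = X)" using assms by simp
  then show ?thesis unfolding fun_eq_iff replace_inside_def by (simp only: if_False simp_thms)
qed

lemma card_bij_preimage:
  assumes "bij_betw \<tau> {..<n} {..<n::nat}"
  shows "card {i. i < n \<and> Q (\<tau> i)} = card {i. i < n \<and> Q i}"
proof -
  have "bij_betw \<tau> {i. i < n \<and> Q (\<tau> i)} {i. i < n \<and> Q i}"
    unfolding bij_betw_def
  proof
    show "inj_on \<tau> {i. i < n \<and> Q (\<tau> i)}"
      by (rule inj_on_subset[of \<tau> "{..<n}"]) (use assms in \<open>auto simp: bij_betw_def\<close>)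
    have "\<tau> ` {..<n} = {..<n}" using assms by (simp add: bij_betw_def)
    show "\<tau> ` {i. i < n \<and> Q (\<tau> i)} = {i. i < n \<and> Q i}"
    proof (intro equalityI subsetI)
      fix x assume x: "x \<in> {i. i < n \<and> Q i}"
      then obtain i where "i < n" "x = \<tau> i" using \<open>\<tau> ` {..<n} = {..<n}\<close> by blast
      then show "x \<in> \<tau> ` {i. i < n \<and> Q (\<tau> i)}" using x by blast
    qed (use \<open>\<tau> ` {..<n} = {..<n}\<close> in blast)
  qed
  then show ?thesis by (rule bij_betw_same_card)
qed

lemma biregular_permute:
  assumes "bij_betw \<tau> {..<n} {..<n}" and "biregular n m a b \<beta>"
  shows "biregular n m a b (\<lambda>i j. \<beta> (\<tau> i) j)"
proof -
  have "\<tau> i < n" if "i < n" for i using assms(1) that by (auto simp: bij_betw_def)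
  moreover have "card {i. i < n \<and> \<beta> (\<tau> i) j} = card {i. i < n \<and> \<beta> i j}" for j
    by (rule card_bij_preimage[OF assms(1), of "\<lambda>i. \<beta> i j"])
  ultimately show ?thesis using assms(2) unfolding biregular_def by simp
qed

lemma biregular_double_count:
  assumes "biregular n m a b \<beta>"
  shows "n * a = m * b"
proof -
  have "n * a = card (Sigma {..<n} (\<lambda>i. {j. j < m \<and> \<beta> i j}))"
    using assms by (simp add: biregular_def)
  also have "Sigma {..<n} (\<lambda>i. {j. j < m \<and> \<beta> i j}) =
      prod.swap ` Sigma {..<m} (\<lambda>j. {i. i < n \<and> \<beta> i j})"
    by auto
  also have "card \<dots> = card (Sigma {..<m} (\<lambda>j. {i. i < n \<and> \<beta> i j}))"
    by (simp add: card_image)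
  also have "\<dots> = m * b" using assms by (simp add: biregular_def)
  finally show ?thesis .
qed

text \<open>The leaves of center i form the block of t labels starting at \<open>i * t\<close>.
  These blocks later make the legs intervals of labels.\<close>

lemma biregular_star:
  assumes t: "0 < t" and m: "m = n * t"
  shows "biregular n m t 1 (\<lambda>i j. i = j div t)"
  unfolding biregular_def
proof (intro conjI allI impI)
  fix i assume "i < n"
  then have "(i + 1) * t \<le> m" using m by (simp only: mult_le_mono1)
  moreover have "i = j div t \<longleftrightarrow> i * t \<le> j \<and> j < (i + 1) * t" for j
    using t div_nat_eqI[of t i j] dividend_less_times_div[of t j] times_div_less_eq_dividend[of t j]
    by (auto simp: mult.commute)
  ultimately have "{j. j < m \<and> i = j div t} = {i * t..<(i + 1) * t}"
    using less_le_trans by (intro set_eqI) (simp, blast)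
  then show "card {j. j < m \<and> i = j div t} = t" by simp
next
  fix j assume "j < m"
  then have "j div t < n" using m by (simp add: less_mult_imp_div_less)
  then have "{i. i < n \<and> i = j div t} = {j div t}" by auto
  then show "card {i. i < n \<and> i = j div t} = 1" by simp
qed

lemma biregular_flip: "biregular n m a b \<beta> \<Longrightarrow> biregular m n b a (\<lambda>i j. \<beta> j i)"
  by (simp add: biregular_def)

locale rigid_type =
  fixes P :: "'c set" and n :: "'c \<Rightarrow> nat" and d :: "'c \<Rightarrow> 'c \<Rightarrow> nat"
  assumes pos: "X \<in> P \<Longrightarrow> 0 < n X"
    and template_exists: "\<exists>b. valid_template P n d b"
    and rigid: "valid_template P n d b \<Longrightarrow> valid_template P n d b' \<Longrightarrow> \<exists>\<sigma>. template_iso P n \<sigma> b b'"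
begin

abbreviation "valid \<equiv> valid_template P n d"

definition aniso :: "'c \<Rightarrow> 'c \<Rightarrow> bool" where
  "aniso X Y \<longleftrightarrow> X \<in> P \<and> Y \<in> P \<and> X \<noteq> Y \<and> 0 < d X Y \<and> d X Y < n Y"

definition het :: "'c \<Rightarrow> bool" where
  "het X \<longleftrightarrow> X \<in> P \<and> 0 < d X X \<and> d X X + 1 < n X"

lemma validD:
  assumes "valid b"
  shows "X \<in> P \<Longrightarrow> Y \<in> P \<Longrightarrow> i < n X \<Longrightarrow> j < n Y \<Longrightarrow> b X Y i j = b Y X j i"
    and "X \<in> P \<Longrightarrow> i < n X \<Longrightarrow> \<not> b X X i i"
    and "X \<in> P \<Longrightarrow> Y \<in> P \<Longrightarrow> i < n X \<Longrightarrow> card {j. j < n Y \<and> b X Y i j} = d X Y"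
proof -
  note v = assms[unfolded valid_template_def]
  show "X \<in> P \<Longrightarrow> Y \<in> P \<Longrightarrow> i < n X \<Longrightarrow> j < n Y \<Longrightarrow> b X Y i j = b Y X j i"
    by (rule v[THEN conjunct1, THEN bspec, THEN bspec, THEN spec, THEN mp, THEN spec, THEN mp])
  show "X \<in> P \<Longrightarrow> i < n X \<Longrightarrow> \<not> b X X i i"
    by (rule v[THEN conjunct2, THEN conjunct1, THEN bspec, THEN spec, THEN mp])
  show "X \<in> P \<Longrightarrow> Y \<in> P \<Longrightarrow> i < n X \<Longrightarrow> card {j. j < n Y \<and> b X Y i j} = d X Y"
    by (rule v[THEN conjunct2, THEN conjunct2, THEN bspec, THEN bspec, THEN spec, THEN mp])
qed

lemma valid_biregular:
  assumes "valid b" "X \<in> P" "Y \<in> P"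
  shows "biregular (n X) (n Y) (d X Y) (d Y X) (b X Y)"
proof -
  have "{i. i < n X \<and> b X Y i j} = {i. i < n X \<and> b Y X j i}" if "j < n Y" for j
    using validD(1)[OF assms(1)] assms that by blast
  then show ?thesis using validD(3)[OF assms(1)] assms(2,3) by (simp add: biregular_def)
qed

lemma double_count:
  assumes "X \<in> P" "Y \<in> P"
  shows "n X * d X Y = n Y * d Y X"
proof -
  obtain b where "valid b" using template_exists by blast
  then show ?thesis by (rule biregular_double_count[OF valid_biregular[OF _ assms]])
qed

lemma degree_le:
  assumes "X \<in> P" "Y \<in> P"
  shows "d X Y \<le> n Y"
proof -
  obtain b where b: "valid b" using template_exists by blast
  have "card {j. j < n Y \<and> b X Y 0 j} \<le> card {..<n Y}" by (intro card_mono) auto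
  then show ?thesis using validD(3)[OF b assms pos[OF assms(1)]] by simp
qed

lemma inner_degree_less:
  assumes "X \<in> P"
  shows "d X X < n X"
proof -
  obtain b where b: "valid b" using template_exists by blast
  have "{j. j < n X \<and> b X X 0 j} \<subset> {..<n X}"
    using validD(2)[OF b assms] pos[OF assms] by auto
  then have "card {j. j < n X \<and> b X X 0 j} < card {..<n X}" by (intro psubset_card_mono) auto
  then show ?thesis using validD(3)[OF b assms assms pos[OF assms]] by simp
qed

lemma even_inner_degree_sum:
  assumes "X \<in> P"
  shows "even (n X * d X X)"
proof -
  obtain b where b: "valid b" using template_exists by blast
  show ?thesis
    by (rule even_degree_sum[of _ "b X X"]) (use validD[OF b] assms in blast)+
qed

lemma aniso_sym: "aniso X Y \<Longrightarrow> aniso Y X"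
proof -
  assume a: "aniso X Y"
  then have XY: "X \<in> P" "Y \<in> P" "0 < d X Y" "d X Y < n Y" by (auto simp: aniso_def)
  have eq: "n X * d X Y = n Y * d Y X" using double_count XY by blast
  then have "0 < d Y X" using XY pos[of X] by (metis gr0I mult_eq_0_iff not_gr0)
  moreover have "n Y * d Y X < n Y * n X"
    using eq mult_strict_left_mono[OF XY(4) pos[OF XY(1)]] by (simp add: mult.commute)
  then have "d Y X < n X" by simp
  ultimately show ?thesis using a by (auto simp: aniso_def)
qed

lemma valid_replace_between:
  assumes b: "valid b" and XY: "X \<noteq> Y" and \<beta>: "biregular (n X) (n Y) (d X Y) (d Y X) \<beta>"
  shows "valid (replace_between b X Y \<beta>)"
  unfolding valid_template_def
proof (intro conjI ballI allI impI)
  fix U V i j assume "U \<in> P" "V \<in> P" "i < n U" "j < n V"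
  then show "replace_between b X Y \<beta> U V i j = replace_between b X Y \<beta> V U j i"
    using XY validD(1)[OF b, of U V i j] by (auto simp: replace_between_def)
next
  fix U i assume "U \<in> P" "i < n U"
  then show "\<not> replace_between b X Y \<beta> U U i i"
    using XY validD(2)[OF b] by (auto simp: replace_between_def)
next
  fix U V i assume "U \<in> P" "V \<in> P" "i < n U"
  then show "card {j. j < n V \<and> replace_between b X Y \<beta> U V i j} = d U V"
    using XY validD(3)[OF b, of U V i] \<beta>
    by (cases "U = X \<and> V = Y"; cases "U = Y \<and> V = X")
      (simp_all add: replace_between_def biregular_def, auto)
qed

lemma valid_replace_inside:
  assumes b: "valid b"
    and "\<And>i j. i < n X \<Longrightarrow> j < n X \<Longrightarrow> e i j = e j i" "\<And>i. i < n X \<Longrightarrow> \<not> e i i"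
      "\<And>i. i < n X \<Longrightarrow> card {j. j < n X \<and> e i j} = d X X"
  shows "valid (replace_inside b X e)"
  unfolding valid_template_def
proof (intro conjI ballI allI impI)
  fix U V i j assume "U \<in> P" "V \<in> P" "i < n U" "j < n V"
  then show "replace_inside b X e U V i j = replace_inside b X e V U j i"
    using assms(2)[of i j] validD(1)[OF b, of U V i j] by (auto simp: replace_inside_def)
next
  fix U i assume "U \<in> P" "i < n U"
  then show "\<not> replace_inside b X e U U i i"
    using assms(3) validD(2)[OF b] by (auto simp: replace_inside_def)
next
  fix U V i assume "U \<in> P" "V \<in> P" "i < n U"
  then show "card {j. j < n V \<and> replace_inside b X e U V i j} = d U V"
    using validD(3)[OF b, of U V i] assms(4)
    by (cases "U = X \<and> V = X") (auto simp: replace_inside_def)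
qed

text \<open>Otherwise two non-isomorphic patterns with these degrees exist and can be planted into
  one and the same template. An isomorphism of the two resulting templates, restricted to X and Y,
  would be an isomorphism of the patterns.\<close>

lemma aniso_degree:
  assumes "aniso X Y"
  shows "d X Y = 1 \<or> d X Y + 1 = n Y \<or> d Y X = 1 \<or> d Y X + 1 = n X"
proof (rule ccontr)
  assume contra: "\<not> ?thesis"
  have XY: "X \<in> P" "Y \<in> P" "X \<noteq> Y" "0 < d X Y" "d X Y < n Y" "0 < d Y X" "d Y X < n X"
    using assms aniso_sym[OF assms] by (auto simp: aniso_def)
  then have "2 \<le> d X Y" "d X Y + 2 \<le> n Y" "2 \<le> d Y X" "d Y X + 2 \<le> n X"
    using contra by auto
  from nonisomorphic_biregular[OF double_count[OF XY(1,2)] this]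
  obtain \<beta> \<beta>' where \<beta>: "biregular (n X) (n Y) (d X Y) (d Y X) \<beta>"
      "biregular (n X) (n Y) (d X Y) (d Y X) \<beta>'" "\<not> biregular_iso (n X) (n Y) \<beta> \<beta>'" by blast
  obtain b where b: "valid b" using template_exists by blast
  obtain \<sigma> where \<sigma>: "template_iso P n \<sigma> (replace_between b X Y \<beta>) (replace_between b X Y \<beta>')"
    using rigid[OF valid_replace_between[OF b XY(3) \<beta>(1)] valid_replace_between[OF b XY(3) \<beta>(2)]]
    by blast
  have "\<forall>i<n X. \<forall>j<n Y. replace_between b X Y \<beta> X Y i j =
      replace_between b X Y \<beta>' X Y (\<sigma> X i) (\<sigma> Y j)"
    using \<sigma> XY(1,2) unfolding template_iso_def by blast
  then have "\<forall>i<n X. \<forall>j<n Y. \<beta> i j = \<beta>' (\<sigma> X i) (\<sigma> Y j)"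
    unfolding replace_between_def by simp
  then have "biregular_iso (n X) (n Y) \<beta> \<beta>'"
    unfolding biregular_iso_def using \<sigma> XY(1,2) unfolding template_iso_def by blast
  then show False using \<beta>(3) by blast
qed

text \<open>Since \<open>n X \<le> n Y\<close>, double counting shows that degree 1 from X to Y
  forces degree 1 from Y to X as well, and likewise in the complement. So the larger cell can always
  be taken to hold the leaves.\<close>

lemma aniso_degree_small:
  assumes a: "aniso X Y" and le: "n X \<le> n Y"
  shows "n Y = n X * (n Y div n X)"
    and "d Y X = 1 \<and> d X Y = n Y div n X \<or> d Y X + 1 = n X \<and> d X Y = n Y - n Y div n X"
proof -
  have XY: "X \<in> P" "Y \<in> P" "0 < d X Y" "d X Y < n Y" "0 < d Y X" "d Y X < n X"
    using assms aniso_sym[OF a] by (auto simp: aniso_def)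
  have eq: "n X * d X Y = n Y * d Y X" using double_count XY by blast
  have eq': "n X * (n Y - d X Y) = n Y * (n X - d Y X)"
    using eq by (simp add: diff_mult_distrib2 mult.commute)
  have one: "k = 1 \<and> n X = n Y" if "n X = n Y * k" for k
  proof (cases k)
    case (Suc k')
    then have "n X = n Y + n Y * k'" using that by simp
    moreover have "0 < n Y" using XY(4) by simp
    ultimately have "k' = 0" using le by (cases k') auto
    then show ?thesis using that Suc by simp
  qed (use that XY(6) in simp)
  consider "d Y X = 1" | "d Y X + 1 = n X"
  proof -
    have "d Y X = 1" if "d X Y = 1" using one[of "d Y X"] eq that by simp
    moreover have "d Y X + 1 = n X" if "d X Y + 1 = n Y"
    proof -
      have "n Y - d X Y = 1" using that by simp
      then have "n X - d Y X = 1" using one[of "n X - d Y X"] eq' by (metis mult.right_neutral)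
      then show ?thesis by simp
    qed
    ultimately show ?thesis using aniso_degree[OF a] that by blast
  qed
  then have "n Y = n X * (n Y div n X) \<and>
    (d Y X = 1 \<and> d X Y = n Y div n X \<or> d Y X + 1 = n X \<and> d X Y = n Y - n Y div n X)"
  proof cases
    case 1
    then have "n Y = n X * d X Y" using eq by simp
    moreover from this have "n Y div n X = d X Y" using XY(6) by simp
    ultimately show ?thesis using 1 by simp
  next
    case 2
    then have "n X - d Y X = 1" by simp
    then have *: "n Y = n X * (n Y - d X Y)" using eq' by simp
    have "n X * (n Y - d X Y) div n X = n Y - d X Y" using XY(6) by simp
    then have "n Y div n X = n Y - d X Y" using * by simp
    then show ?thesis using 2 * XY(4) by auto
  qed
  then show "n Y = n X * (n Y div n X)"
    "d Y X = 1 \<and> d X Y = n Y div n X \<or> d Y X + 1 = n X \<and> d X Y = n Y - n Y div n X" by blast+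
qed

lemma aniso_size:
  assumes "aniso X Y"
  shows "2 \<le> n X" "2 \<le> n Y"
  using assms aniso_sym[OF assms] by (auto simp: aniso_def)

text \<open>
  If \<open>X\<close> has two vertices, then \<open>sK\<^bsub>1,t\<^esub>\<close> is isomorphic to its bipartite complement, and (M3) takes the
  complement; this is why the complement is preferred in the definition of \<open>canonical\<close>.
\<close>

definition star_template :: "'c \<Rightarrow> 'c \<Rightarrow> nat \<Rightarrow> nat \<Rightarrow> bool" where
  "star_template X Y i j \<longleftrightarrow> (i = j div (n Y div n X)) \<noteq> (d Y X + 1 = n X)"

definition canonical :: "'c \<Rightarrow> 'c \<Rightarrow> nat \<Rightarrow> nat \<Rightarrow> bool" where
  "canonical X Y i j \<longleftrightarrow>
     (if X = Y then circulant (n X) (d X X) i j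
      else if \<not> aniso X Y then d X Y \<noteq> 0
      else if n X \<le> n Y then star_template X Y i j else star_template Y X j i)"

lemma biregular_star_template:
  assumes a: "aniso X Y" and le: "n X \<le> n Y"
  shows "biregular (n X) (n Y) (d X Y) (d Y X) (star_template X Y)"
proof -
  define t where "t = n Y div n X"
  have s: "n Y = n X * t" using aniso_degree_small(1)[OF a le] by (simp add: t_def)
  have t: "0 < t" using s aniso_size(2)[OF a] by (cases t) auto
  note star = biregular_star[OF t s]
  show ?thesis
  proof (cases "d Y X + 1 = n X")
    case True
    then have "n X - 1 = d Y X" by simp
    moreover have "n Y - t = d X Y"
    \<comment> \<open>For \<open>n X = 2\<close> the stars and their complement have the same
      degrees: \<open>n Y = 2 * t\<close>, so \<open>n Y - t\<close> is again
      \<open>t\<close>.\<close>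
    proof (cases "d Y X = 1")
      case True
      then have "n X = 2" using \<open>d Y X + 1 = n X\<close> by simp
      then show ?thesis using aniso_degree_small(2)[OF a le] s True unfolding t_def[symmetric] by auto
    next
      case False
      then show ?thesis using aniso_degree_small(2)[OF a le] unfolding t_def[symmetric] by auto
    qed
    ultimately show ?thesis
      using biregular_complement[OF star] True by (simp add: star_template_def[abs_def] t_def)
  next
    case False
    then have "d Y X = 1" "d X Y = t"
      using aniso_degree_small(2)[OF a le] unfolding t_def[symmetric] by auto
    then show ?thesis using star False by (simp add: star_template_def[abs_def] t_def)
  qed
qed

lemma star_template_uniform:
  assumes "n X = n Y" "0 < n X"
  shows "star_template X Y i j \<longleftrightarrow> (i = j) \<noteq> (d Y X + 1 = n X)"
  using assms by (simp add: star_template_def)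

lemma uniform_degree: "X \<in> P \<Longrightarrow> Y \<in> P \<Longrightarrow> n X = n Y \<Longrightarrow> d X Y = d Y X"
  using double_count[of X Y] pos[of X] by simp

text \<open>For equal sizes both cells qualify as centers, and the two orientations agree: the stars
  degenerate to the symmetric relation i = j, and \<open>d X Y = d Y X\<close>.\<close>

lemma canonical_aniso:
  assumes "aniso X Y" "n X \<le> n Y"
  shows "canonical X Y i j \<longleftrightarrow> star_template X Y i j"
    and "canonical Y X j i \<longleftrightarrow> star_template X Y i j"
proof -
  have XY: "X \<noteq> Y" "X \<in> P" "Y \<in> P" using assms by (auto simp: aniso_def)
  show "canonical X Y i j \<longleftrightarrow> star_template X Y i j" using assms XY by (simp add: canonical_def)
  have "star_template Y X j i = star_template X Y i j" if "n Y \<le> n X"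
    using that assms(2) pos[OF XY(2)] uniform_degree[OF XY(2,3)]
    by (auto simp: star_template_uniform)
  then show "canonical Y X j i \<longleftrightarrow> star_template X Y i j"
    using assms XY aniso_sym by (auto simp: canonical_def)
qed

lemma biregular_canonical:
  assumes XY: "X \<in> P" "Y \<in> P" "X \<noteq> Y"
  shows "biregular (n X) (n Y) (d X Y) (d Y X) (canonical X Y)"
proof (cases "aniso X Y")
  case True
  show ?thesis
  proof (cases "n X \<le> n Y")
    case le: True
    then have "canonical X Y = star_template X Y" using canonical_aniso(1)[OF True] by blast
    then show ?thesis using biregular_star_template[OF True le] by simp
  next
    case False
    then have "canonical X Y = (\<lambda>i j. star_template Y X j i)"
      using canonical_aniso(2)[OF aniso_sym[OF True]] by (simp add: fun_eq_iff)
    then show ?thesis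
      using biregular_flip[OF biregular_star_template[OF aniso_sym[OF True]]] False by simp
  qed
next
  case False
  have eq: "canonical X Y = (\<lambda>i j. d X Y \<noteq> 0)" using False XY by (simp add: canonical_def fun_eq_iff)
  show ?thesis
  proof (cases "d X Y = 0")
    case True
    then have "d Y X = 0" using double_count[OF XY(1,2)] pos[OF XY(2)] by simp
    then show ?thesis using True eq by (simp add: biregular_def)
  next
    case nz: False
    then have "d X Y = n Y" using False XY degree_le[OF XY(1,2)] by (auto simp: aniso_def)
    then have "d Y X = n X" using double_count[OF XY(1,2)] pos[OF XY(2)] by simp
    then show ?thesis using nz eq \<open>d X Y = n Y\<close> by (simp add: biregular_def)
  qed
qed

lemma canonical_flip:
  assumes "X \<in> P" "Y \<in> P" "X \<noteq> Y"
  shows "canonical X Y i j = canonical Y X j i"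
proof (cases "aniso X Y")
  case True
  then show ?thesis using canonical_aniso aniso_sym by (metis nat_le_linear)
next
  case False
  then have "\<not> aniso Y X" using aniso_sym by blast
  have "d X Y = 0 \<longleftrightarrow> d Y X = 0"
    using double_count[OF assms(1,2)] pos[OF assms(1)] pos[OF assms(2)] by (metis mult_is_0 not_gr0)
  then show ?thesis using False \<open>\<not> aniso Y X\<close> assms(3) by (simp add: canonical_def)
qed

lemma valid_canonical: "valid canonical"
  unfolding valid_template_def
proof (intro conjI ballI allI impI)
  fix X Y i j assume "X \<in> P" "Y \<in> P" "i < n X" "j < n Y"
  then show "canonical X Y i j = canonical Y X j i"
    using canonical_flip circulant_sym by (cases "X = Y") (auto simp: canonical_def)
next
  fix X i assume "X \<in> P" "i < n X"
  then show "\<not> canonical X X i i" using circulant_irrefl by (simp add: canonical_def)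
next
  fix X Y i assume XY: "X \<in> P" "Y \<in> P" "i < n X"
  show "card {j. j < n Y \<and> canonical X Y i j} = d X Y"
  proof (cases "X = Y")
    case True
    then show ?thesis
      using circulant_degree[OF inner_degree_less even_inner_degree_sum] XY by (simp add: canonical_def)
  next
    case False
    then show ?thesis using biregular_canonical XY by (simp add: biregular_def)
  qed
qed

section \<open>Equally large cells and slots\<close>

definition uniform :: "('c \<times> 'c) set" where
  "uniform = {(X, Y). aniso X Y \<and> n X = n Y}"

text \<open>On a uniform pair the canonical pattern is i = j or its negation, so an isomorphism of
  templates that are canonical there must relabel both cells by the same permutation. This
  propagates along a path.\<close>

lemma template_iso_uniform:
  assumes iso: "template_iso P n \<sigma> b b'" and F: "F \<subseteq> uniform"
    and b: "\<And>X Y. (X, Y) \<in> F \<Longrightarrow> b X Y = canonical X Y"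
    and b': "\<And>X Y. (X, Y) \<in> F \<Longrightarrow> b' X Y = canonical X Y"
    and CD: "(C, D) \<in> F\<^sup>*" "C \<in> P"
  shows "D \<in> P \<and> n D = n C \<and> (\<forall>i<n C. \<sigma> D i = \<sigma> C i)"
  using CD(1)
proof induction
  case base
  then show ?case using CD(2) by simp
next
  case (step X Y)
  have XY: "aniso X Y" "n X = n Y" "X \<in> P" "Y \<in> P"
    using step.hyps F by (auto simp: uniform_def aniso_def)
  have can: "canonical X Y i j \<longleftrightarrow> (i = j) \<noteq> (d Y X + 1 = n X)" for i j
    using canonical_aniso(1)[OF XY(1)] star_template_uniform[OF XY(2) pos[OF XY(3)]] XY(2) by simp
  have "\<sigma> X i = \<sigma> Y i" if "i < n X" for i
  proof -
    have "b X Y i i = b' X Y (\<sigma> X i) (\<sigma> Y i)"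
      using iso XY that unfolding template_iso_def by simp
    then show ?thesis unfolding b[OF step.hyps(2)] b'[OF step.hyps(2)] can by auto
  qed
  then show ?case using step.IH XY by simp
qed

text \<open>
  Around a uniform cycle the canonical template composes to the identity; twisting one edge of the
  cycle by a transposition yields a template that is not isomorphic to it.
\<close>

lemma no_uniform_cycle:
  assumes F: "F \<subseteq> uniform" and CD: "(C, D) \<in> uniform" "(C, D) \<notin> F" "(D, C) \<notin> F"
  shows "(C, D) \<notin> F\<^sup>*"
proof
  assume path: "(C, D) \<in> F\<^sup>*"
  have a: "aniso C D" "n C = n D" "C \<in> P" "D \<in> P" "C \<noteq> D"
    using CD(1) by (auto simp: uniform_def aniso_def)
  have n2: "2 \<le> n C" using aniso_size(1)[OF a(1)] .
  define \<tau> where "\<tau> = transpose (0::nat) 1"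
  have \<tau>: "bij_betw \<tau> {..<n C} {..<n C}"
    unfolding \<tau>_def using n2
    by (intro bij_betw_byWitness[where f' = "transpose 0 1"]) (auto simp: transpose_def)
  define b' where "b' = replace_between canonical C D (\<lambda>i j. canonical C D (\<tau> i) j)"
  have "valid b'" unfolding b'_def
    by (intro valid_replace_between[OF valid_canonical a(5)] biregular_permute[OF \<tau>]
        biregular_canonical a)
  then obtain \<sigma> where \<sigma>: "template_iso P n \<sigma> canonical b'" using rigid valid_canonical by blast
  have "b' X Y = canonical X Y" if "(X, Y) \<in> F" for X Y
    unfolding b'_def by (rule replace_between_other) (use that CD in blast)+
  from template_iso_uniform[OF \<sigma> F refl this path a(3)]
  have eq: "\<sigma> D i = \<sigma> C i" if "i < n C" for i using that by blast
  have can: "canonical C D i j \<longleftrightarrow> (i = j) \<noteq> (d D C + 1 = n C)" for i j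
    using canonical_aniso(1)[OF a(1)] star_template_uniform[OF a(2) pos[OF a(3)]] a(2) by simp
  \<comment> \<open>The path makes \<open>\<sigma> C\<close> and \<open>\<sigma> D\<close> agree,
    and then the twisted pair admits only labels fixed by \<open>\<tau>\<close>. But
    \<open>\<sigma> C\<close> is onto, so it also takes the value 0, which \<open>\<tau>\<close>
    moves.\<close>
  have fixp: "\<tau> (\<sigma> C i) = \<sigma> C i" if "i < n C" for i
  proof -
    have "canonical C D i i = b' C D (\<sigma> C i) (\<sigma> D i)"
      using \<sigma> a that unfolding template_iso_def by simp
    then show ?thesis unfolding b'_def replace_between_def can eq[OF that] by auto
  qed
  have "\<sigma> C ` {..<n C} = {..<n C}" using \<sigma> a(3) by (simp add: template_iso_def bij_betw_def)
  then obtain i where "i < n C" "\<sigma> C i = 0" using n2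
    by (metis (no_types, lifting) imageE lessThan_iff less_le_trans pos2)
  then show False using fixp[of i] by (simp add: \<tau>_def)
qed

text \<open>With \<open>D = C\<close> standing for the inner graph, a slot of either kind is an
  entry of a template, indexed by C and D, that can be replaced on its own.\<close>

definition slot :: "'c \<Rightarrow> 'c \<Rightarrow> bool" where
  "slot C D \<longleftrightarrow> C = D \<and> het C \<or> aniso C D \<and> n D < n C"

text \<open>
  A slot at \<open>C\<close> induces a regular graph on \<open>C\<close> that is neither empty nor complete: \<open>G[C]\<close> itself if
  \<open>C\<close> is heterogeneous, and otherwise the union of the cliques formed by the leaves of the stars.
\<close>

definition trace :: "('c \<Rightarrow> 'c \<Rightarrow> nat \<Rightarrow> nat \<Rightarrow> bool) \<Rightarrow> 'c \<Rightarrow> 'c \<Rightarrow> nat \<Rightarrow> nat \<Rightarrow> bool" where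
  "trace b C D i j \<longleftrightarrow>
     (if C = D then b C C i j else i \<noteq> j \<and> (\<forall>k<n D. b C D i k = b C D j k))"

lemma trace_cong:
  assumes "b C D = b' C D"
  shows "trace b C D = trace b' C D"
proof (cases "C = D")
  case True
  then have "b C C = b' C C" using assms by simp
  then show ?thesis unfolding trace_def if_P[OF True] by simp
next
  case False
  show ?thesis unfolding trace_def if_not_P[OF False] assms ..
qed

lemma trace_sym:
  assumes "valid b" "C \<in> P" "i < n C" "j < n C"
  shows "trace b C D i j = trace b C D j i"
proof (cases "C = D")
  case True
  show ?thesis unfolding trace_def if_P[OF True] by (rule validD(1)[OF assms(1,2,2,3,4)])
next
  case False
  show ?thesis unfolding trace_def if_not_P[OF False] by blast
qed

lemma trace_iso:
  assumes iso: "template_iso P n \<sigma> b b'" and "C \<in> P" "D \<in> P" "i < n C" "j < n C"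
  shows "trace b C D i j = trace b' C D (\<sigma> C i) (\<sigma> C j)"
proof (cases "C = D")
  case True
  then show ?thesis using assms by (simp add: trace_def template_iso_def)
next
  case False
  have bij: "bij_betw (\<sigma> C) {..<n C} {..<n C}" "\<sigma> D ` {..<n D} = {..<n D}"
    using assms by (auto simp: template_iso_def bij_betw_def)
  have "(\<forall>k\<in>{..<n D}. b C D i k = b C D j k) \<longleftrightarrow>
      (\<forall>k\<in>{..<n D}. b' C D (\<sigma> C i) (\<sigma> D k) = b' C D (\<sigma> C j) (\<sigma> D k))"
    using assms by (simp add: template_iso_def)
  also have "\<dots> \<longleftrightarrow> (\<forall>k\<in>\<sigma> D ` {..<n D}. b' C D (\<sigma> C i) k = b' C D (\<sigma> C j) k)" by blast
  finally have "(\<forall>k<n D. b C D i k = b C D j k) \<longleftrightarrow> (\<forall>k<n D. b' C D (\<sigma> C i) k = b' C D (\<sigma> C j) k)"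
    unfolding bij(2) by (simp add: lessThan_def)
  moreover have "i = j \<longleftrightarrow> \<sigma> C i = \<sigma> C j"
    using bij(1) assms(4,5) by (auto simp: bij_betw_def inj_on_def)
  ultimately show ?thesis using False by (simp add: trace_def)
qed

text \<open>A heterogeneous cell is regular of degree between 1 and \<open>n C - 2\<close>. For a
  smaller neighbor, the trace consists of at least two cliques of size at least 2 on consecutive
  blocks of labels; the square takes two vertices from each of the first two.\<close>

lemma slot_alternating:
  assumes "slot C D"
  shows "alternating_square (n C) (trace canonical C D)"
proof (cases "C = D")
  case True
  then have h: "C \<in> P" "0 < d C C" "d C C + 1 < n C" using assms by (auto simp: slot_def het_def aniso_def)
  have eq: "trace canonical C D = canonical C C" using True by (auto simp: trace_def fun_eq_iff)
  show ?thesis unfolding eq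
    by (rule alternating_square_if_regular[where d = "d C C"])
      (use h validD[OF valid_canonical] in auto)
next
  case False
  then have a: "aniso D C" "n D < n C" using assms aniso_sym by (auto simp: slot_def)
  define t where "t = n C div n D"
  have s: "n C = n D * t" using aniso_degree_small(1)[OF a(1)] a(2) by (simp add: t_def)
  have nD: "2 \<le> n D" using aniso_size(1)[OF a(1)] .
  have t: "2 \<le> t"
  proof (rule ccontr)
    assume "\<not> 2 \<le> t"
    then have "t = 0 \<or> t = 1" by auto
    then show False using s a(2) by auto
  qed
  have "canonical C D i k \<longleftrightarrow> (k = i div t) \<noteq> (d C D + 1 = n D)" for i k
    using canonical_aniso(2)[OF a(1)] a(2) by (simp add: star_template_def t_def)
  then have tr: "trace canonical C D i j \<longleftrightarrow> i \<noteq> j \<and> (\<forall>k<n D. (k = i div t) = (k = j div t))" for i j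
    using False by (auto simp: trace_def)
  have "2 * t \<le> n C" using s nD by (simp add: mult_le_mono1)
  then have lt: "0 < n C" "t < n C" "1 < n C" "t + 1 < n C" using t by auto
  have div: "0 div t = 0" "1 div t = 0" "t div t = 1" "(t + 1) div t = 1"
    using t by (auto simp: div_nat_eqI)
  have "0 < n D" using nD by simp
  then have "trace canonical C D 0 1" "trace canonical C D t (t + 1)"
    "\<not> trace canonical C D 0 (t + 1)" "\<not> trace canonical C D t 1"
    unfolding tr div using t by (auto intro!: exI[of _ 0])
  moreover have "distinct [0, t, 1, t + 1]" using t by auto
  ultimately show ?thesis unfolding alternating_square_def using lt by blast
qed

text \<open>The labels of C are permuted in this one entry only, which keeps all degrees. The trace
  is permuted alike, while the rest of the template still uses the old labels.\<close>

lemma twist_slot: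
  assumes slot: "slot C D" and \<tau>: "bij_betw \<tau> {..<n C} {..<n C}"
  shows "\<exists>b. valid b \<and> (\<forall>X Y. (X, Y) \<noteq> (C, D) \<and> (X, Y) \<noteq> (D, C) \<longrightarrow> b X Y = canonical X Y) \<and>
    (\<forall>i<n C. \<forall>j<n C. trace b C D i j = trace canonical C D (\<tau> i) (\<tau> j))"
proof -
  have \<tau>lt: "\<tau> i < n C" if "i < n C" for i using \<tau> that by (auto simp: bij_betw_def)
  have \<tau>inj: "\<tau> i = \<tau> j \<longleftrightarrow> i = j" if "i < n C" "j < n C" for i j
    using \<tau> that by (auto simp: bij_betw_def inj_on_def)
  show ?thesis
  proof (cases "C = D")
    case True
    then have C: "C \<in> P" using slot by (auto simp: slot_def het_def aniso_def)
    define b where "b = replace_inside canonical C (\<lambda>i j. canonical C C (\<tau> i) (\<tau> j))"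
    have "valid b" unfolding b_def
    proof (rule valid_replace_inside[OF valid_canonical])
      fix i assume i: "i < n C"
      show "card {j. j < n C \<and> canonical C C (\<tau> i) (\<tau> j)} = d C C"
        using card_bij_preimage[OF \<tau>, of "canonical C C (\<tau> i)"]
          validD(3)[OF valid_canonical C C \<tau>lt[OF i]] by simp
    qed (use validD(1,2)[OF valid_canonical] C \<tau>lt in blast)+
    moreover have "trace b C D i j = trace canonical C D (\<tau> i) (\<tau> j)" for i j
      using True by (simp add: trace_def b_def replace_inside_def)
    moreover have "b X Y = canonical X Y" if "(X, Y) \<noteq> (C, D)" for X Y
      unfolding b_def by (rule replace_inside_other) (use that True in blast)
    ultimately show ?thesis by blast
  next
    case False
    then have CD: "C \<in> P" "D \<in> P" using slot by (auto simp: slot_def aniso_def)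
    define b where "b = replace_between canonical C D (\<lambda>i j. canonical C D (\<tau> i) j)"
    have "valid b" unfolding b_def
      by (intro valid_replace_between[OF valid_canonical False] biregular_permute[OF \<tau>]
        biregular_canonical CD False)
    moreover have "trace b C D i j = trace canonical C D (\<tau> i) (\<tau> j)" if "i < n C" "j < n C" for i j
      using False \<tau>inj that by (simp add: trace_def b_def replace_between_def)
    moreover have "b X Y = canonical X Y" if "(X, Y) \<noteq> (C, D) \<and> (X, Y) \<noteq> (D, C)" for X Y
      unfolding b_def by (rule replace_between_other) (use that in blast)+
    ultimately show ?thesis by (intro exI[of _ b] conjI allI impI)
  qed
qed

text \<open>
  Two different slots in the same uniform class can be permuted against each other, which changes
  the number of common edges of their traces.
\<close>

lemma unique_slot:
  assumes s1: "slot C1 D1" and s2: "slot C2 D2" and path: "(C1, C2) \<in> uniform\<^sup>*"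
  shows "C1 = C2 \<and> D1 = D2"
proof (rule ccontr)
  assume ne: "\<not> ?thesis"
  have P: "C1 \<in> P" "D1 \<in> P" "C2 \<in> P" "D2 \<in> P" using s1 s2 by (auto simp: slot_def het_def aniso_def)
  define N where "N = n C1"
  have N2: "n C2 = N"
    using path by induction (auto simp: uniform_def N_def)
  \<comment> \<open>Twisting the second slot therefore leaves the entry of the first one
    canonical.\<close>
  have ne': "(C1, D1) \<noteq> (C2, D2)" "(C1, D1) \<noteq> (D2, C2)"
    using ne s1 s2 N2 by (auto simp: slot_def N_def)
  define e1 where "e1 = trace canonical C1 D1"
  define e2 where "e2 = trace canonical C2 D2"
  \<comment> \<open>An isomorphism between two twists acts on C1 and C2 by one permutation
    \<open>s\<close>, because uniform pairs join them. It preserves \<open>e1\<close> and takes one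
    twist of \<open>e2\<close> to the other, so the common edges are in bijection.\<close>
  have const: "card {(i, j). i < N \<and> j < N \<and> e1 i j \<and> e2 (\<tau> i) (\<tau> j)} =
      card {(i, j). i < N \<and> j < N \<and> e1 i j \<and> e2 (\<tau>' i) (\<tau>' j)}"
    if \<tau>: "bij_betw \<tau> {..<N} {..<N}" and \<tau>': "bij_betw \<tau>' {..<N} {..<N}" for \<tau> \<tau>'
  proof -
    obtain b where b: "valid b"
        "\<forall>X Y. (X, Y) \<noteq> (C2, D2) \<and> (X, Y) \<noteq> (D2, C2) \<longrightarrow> b X Y = canonical X Y"
        "\<forall>i<N. \<forall>j<N. trace b C2 D2 i j = e2 (\<tau> i) (\<tau> j)"
      using twist_slot[OF s2, of \<tau>, unfolded N2, OF \<tau>] unfolding e2_def by blast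
    obtain b' where b': "valid b'"
        "\<forall>X Y. (X, Y) \<noteq> (C2, D2) \<and> (X, Y) \<noteq> (D2, C2) \<longrightarrow> b' X Y = canonical X Y"
        "\<forall>i<N. \<forall>j<N. trace b' C2 D2 i j = e2 (\<tau>' i) (\<tau>' j)"
      using twist_slot[OF s2, of \<tau>', unfolded N2, OF \<tau>'] unfolding e2_def by blast
    obtain \<sigma> where \<sigma>: "template_iso P n \<sigma> b b'" using rigid b(1) b'(1) by blast
    have nu: "(X, Y) \<noteq> (C2, D2) \<and> (X, Y) \<noteq> (D2, C2)" if "(X, Y) \<in> uniform" for X Y
      using that s2 by (auto simp: uniform_def slot_def aniso_def)
    have bu: "b X Y = canonical X Y" "b' X Y = canonical X Y" if "(X, Y) \<in> uniform" for X Y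
      using b(2) b'(2) nu[OF that] by simp_all
    have eq: "\<sigma> C2 i = \<sigma> C1 i" if "i < N" for i
      using template_iso_uniform[OF \<sigma> subset_refl bu path P(1)] that unfolding N_def by simp
    define s where "s = \<sigma> C1"
    have sbij: "bij_betw s {..<N} {..<N}"
      using \<sigma> P(1) unfolding s_def N_def template_iso_def by blast
    have slt: "s i < N" if "i < N" for i using sbij that by (auto simp: bij_betw_def)
    have e1s: "e1 i j = e1 (s i) (s j)" if "i < N" "j < N" for i j
    proof -
      have "b C1 D1 = canonical C1 D1" "b' C1 D1 = canonical C1 D1"
        using ne' b(2) b'(2) by simp_all
      note tr = trace_cong[of b C1 D1 canonical, OF this(1)] trace_cong[of b' C1 D1 canonical, OF this(2)]
      have "trace b C1 D1 i j = trace b' C1 D1 (s i) (s j)"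
        using trace_iso[OF \<sigma> P(1,2)] that unfolding N_def s_def .
      then show ?thesis unfolding tr e1_def .
    qed
    have e2s: "e2 (\<tau> i) (\<tau> j) = e2 (\<tau>' (s i)) (\<tau>' (s j))" if "i < N" "j < N" for i j
    proof -
      have "e2 (\<tau> i) (\<tau> j) = trace b C2 D2 i j" by (rule b(3)[rule_format, OF that, symmetric])
      also have "\<dots> = trace b' C2 D2 (\<sigma> C2 i) (\<sigma> C2 j)"
        using trace_iso[OF \<sigma> P(3,4)] that unfolding N2 .
      also have "\<dots> = trace b' C2 D2 (s i) (s j)"
        unfolding s_def eq[OF that(1)] eq[OF that(2)] ..
      also have "\<dots> = e2 (\<tau>' (s i)) (\<tau>' (s j))"
        by (rule b'(3)[rule_format, OF slt[OF that(1)] slt[OF that(2)]])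
      finally show ?thesis .
    qed
    let ?A = "{(i, j). i < N \<and> j < N \<and> e1 i j \<and> e2 (\<tau> i) (\<tau> j)}"
    let ?B = "{(i, j). i < N \<and> j < N \<and> e1 i j \<and> e2 (\<tau>' i) (\<tau>' j)}"
    have img: "map_prod s s ` ?A = ?B"
    proof (intro equalityI subsetI)
      fix p assume "p \<in> ?B"
      then obtain i j where p: "p = (i, j)" "i < N" "j < N" "e1 i j" "e2 (\<tau>' i) (\<tau>' j)" by blast
      have "i \<in> s ` {..<N}" "j \<in> s ` {..<N}" using p(2,3) sbij by (simp_all add: bij_betw_def)
      then obtain i' j' where ij: "i = s i'" "j = s j'" "i' < N" "j' < N" by blast
      then have "(i', j') \<in> ?A" using p e1s[OF ij(3,4)] e2s[OF ij(3,4)] by simp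
      then show "p \<in> map_prod s s ` ?A" using p(1) ij(1,2) by (intro image_eqI[of _ _ "(i', j')"]) simp_all
    next
      fix p assume "p \<in> map_prod s s ` ?A"
      then obtain i j where p: "p = (s i, s j)" "i < N" "j < N" "e1 i j" "e2 (\<tau> i) (\<tau> j)" by auto
      then show "p \<in> ?B" using e1s[OF p(2,3)] e2s[OF p(2,3)] slt by simp
    qed
    have "inj_on (map_prod s s) ?A"
      using sbij by (intro inj_on_subset[OF map_prod_inj_on[of s "{..<N}" s "{..<N}"]])
        (auto simp: bij_betw_def)
    then show ?thesis unfolding img[symmetric] by (rule card_image[symmetric])
  qed
  have "\<exists>\<tau> \<tau>'. bij_betw \<tau> {..<N} {..<N} \<and> bij_betw \<tau>' {..<N} {..<N} \<and>
    card {(i, j). i < N \<and> j < N \<and> e1 i j \<and> e2 (\<tau> i) (\<tau> j)} \<noteq>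
    card {(i, j). i < N \<and> j < N \<and> e1 i j \<and> e2 (\<tau>' i) (\<tau>' j)}"
  proof (rule overlap_not_constant)
    show "alternating_square N e1" using slot_alternating[OF s1] by (simp add: N_def e1_def)
    show "alternating_square N e2" using slot_alternating[OF s2] by (simp add: N2 e2_def)
  next
    fix i j assume "i < N" "j < N"
    then show "e1 i j = e1 j i" "e2 i j = e2 j i"
      using trace_sym[OF valid_canonical P(1), of i j D1] trace_sym[OF valid_canonical P(3), of i j D2]
      by (simp_all add: e1_def e2_def N2 N_def[symmetric])
  qed
  then show False using const by blast
qed

section \<open>The anisotropic components are trees\<close>

text \<open>\<open>rank\<close> descends towards the root and so makes \<open>par\<close> acyclic.
  Non-decreasing sizes belong to the invariant because \<open>ex_top\<close> climbs along parents of
  equal size.\<close>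

definition partial_tree :: "'c set \<Rightarrow> 'c \<Rightarrow> 'c set \<Rightarrow> ('c \<Rightarrow> 'c) \<Rightarrow> ('c \<Rightarrow> nat) \<Rightarrow> bool" where
  "partial_tree A R S par rank \<longleftrightarrow> R \<in> S \<and> S \<subseteq> A \<and>
     (\<forall>C\<in>S - {R}. par C \<in> S \<and> aniso C (par C) \<and> rank (par C) < rank C \<and> n (par C) \<le> n C)"

definition tree_edges :: "'c \<Rightarrow> 'c set \<Rightarrow> ('c \<Rightarrow> 'c) \<Rightarrow> ('c \<times> 'c) set" where
  "tree_edges R S par = {(X, Y). X \<in> S - {R} \<and> Y = par X \<or> Y \<in> S - {R} \<and> X = par Y}"

lemma uniform_sym: "(X, Y) \<in> uniform \<Longrightarrow> (Y, X) \<in> uniform"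
  using aniso_sym by (simp add: uniform_def)

lemma sym_uniform: "sym uniform"
  using uniform_sym by (rule symI)

lemma sym_tree_edges: "sym (uniform \<inter> tree_edges R S par)"
  using uniform_sym by (intro symI) (auto simp: tree_edges_def)

text \<open>Climbing to the parent while the size stays the same uses only tree edges in
  \<open>uniform\<close>. The climb ends where a slot is to be expected: at the root or below a
  smaller parent.\<close>

lemma ex_top:
  assumes T: "partial_tree A R S par rank" and C: "C \<in> S"
  shows "\<exists>T\<in>S. (C, T) \<in> (uniform \<inter> tree_edges R S par)\<^sup>* \<and> n T = n C \<and>
    (T = R \<or> n (par T) < n T)"
  using C
proof (induction "rank C" arbitrary: C rule: less_induct)
  case less
  show ?case
  proof (cases "C = R \<or> n (par C) < n C")
    case True
    then show ?thesis using less.prems by blast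
  next
    case False
    then have C: "par C \<in> S" "aniso C (par C)" "rank (par C) < rank C" "n (par C) \<le> n C"
      using T less.prems by (auto simp: partial_tree_def)
    then have C4: "n (par C) = n C" using False by simp
    have "(C, par C) \<in> uniform \<inter> tree_edges R S par"
      using False less.prems C C4 by (simp add: uniform_def tree_edges_def)
    with less.hyps[OF C(3,1)] C4 show ?thesis
      by (metis converse_rtrancl_into_rtrancl)
  qed
qed

end

locale rigid_component = rigid_type P n d
  for P :: "'c set" and n d +
  fixes A :: "'c set" and R :: 'c
  assumes A: "A \<subseteq> P" "finite A" and RA: "R \<in> A"
    and closed: "X \<in> A \<Longrightarrow> aniso X Y \<Longrightarrow> Y \<in> A"
    and conn: "X \<in> A \<Longrightarrow> (R, X) \<in> {(X, Y). aniso X Y}\<^sup>*"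
    and root: "het R \<or> (\<forall>X\<in>A. \<not> het X) \<and> (\<forall>X\<in>A. n R \<le> n X)"
begin

text \<open>Away from the root, the smaller parent gives the slot. At the root, a cell that is
  heterogeneous or smaller than R refutes the second alternative of \<open>root\<close>, so R is
  heterogeneous.\<close>

lemma top_slot:
  assumes T: "partial_tree A R S par rank" "T \<in> S" "T = R \<or> n (par T) < n T"
    and small: "T = R \<Longrightarrow> \<exists>C\<in>A. n C < n R \<or> het C"
  shows "slot T (if T = R then R else par T)"
proof (cases "T = R")
  case True
  then have "het R" using small root by force
  then show ?thesis using True by (simp add: slot_def)
next
  case False
  then show ?thesis using T by (auto simp: partial_tree_def slot_def)
qed

text \<open>The top of the uniform class of C carries a slot; if the top is R, then the smaller D or
  the heterogeneous C is the witness required by \<open>top_slot\<close>. By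
  \<open>unique_slot\<close> it coincides with the given slot.\<close>

lemma unique_top_slot:
  assumes T: "partial_tree A R S par rank" and C: "C \<in> S" "slot C D"
    and small: "n D < n C \<and> D \<in> A \<or> D = C"
  shows "C = R \<and> D = R \<or> C \<noteq> R \<and> D = par C \<and> n (par C) < n C"
proof -
  obtain T where T': "T \<in> S" "(C, T) \<in> (uniform \<inter> tree_edges R S par)\<^sup>*" "n T = n C"
      "T = R \<or> n (par T) < n T" using ex_top[OF T C(1)] by blast
  have SA: "S \<subseteq> A" using T by (simp add: partial_tree_def)
  have "slot T (if T = R then R else par T)"
  proof (rule top_slot[OF T T'(1,4)])
    assume "T = R"
    show "\<exists>C\<in>A. n C < n R \<or> het C"
    proof (cases "D = C")
      case True
      then have "het C" using C(2) by (simp add: slot_def)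
      then show ?thesis using C(1) SA by blast
    next
      case False
      then show ?thesis using small T'(3) \<open>T = R\<close> by auto
    qed
  qed
  moreover have "(C, T) \<in> uniform\<^sup>*" using T'(2) rtrancl_mono[of "uniform \<inter> _" uniform] by blast
  ultimately have "C = T" "D = (if T = R then R else par T)" using unique_slot[OF C(2)] by blast+
  then show ?thesis using T'(4) by auto
qed

text \<open>By connectedness some anisotropic pair BC leaves S. If C were smaller it would give a
  slot at B; but the only possible slot at B leads to R or to the parent of B, both in S.\<close>

lemma extend_partial_tree:
  assumes T: "partial_tree A R S par rank" and ne: "S \<noteq> A"
  shows "\<exists>C par' rank'. C \<in> A - S \<and> partial_tree A R (insert C S) par' rank'"
proof -
  have SA: "S \<subseteq> A" and RS: "R \<in> S" using T by (auto simp: partial_tree_def)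
  obtain X where X: "X \<in> A" "X \<notin> S" using SA ne by blast
  have "X \<in> S \<or> (\<exists>Y Z. Y \<in> S \<and> Z \<notin> S \<and> aniso Y Z)"
    using conn[OF X(1)] by induction (use RS in blast)+
  then obtain B C where BC: "B \<in> S" "C \<notin> S" "aniso B C" using X by blast
  have CA: "C \<in> A" using closed BC SA by blast
  have "n B \<le> n C"
  proof (rule ccontr)
    assume "\<not> n B \<le> n C"
    then have "slot B C" "n C < n B" using BC(3) by (auto simp: slot_def)
    then have "B = R \<and> C = R \<or> B \<noteq> R \<and> C = par B" using unique_top_slot[OF T BC(1)] CA by blast
    then show False using T BC RS by (auto simp: partial_tree_def)
  qed
  moreover have "B \<noteq> C" "aniso C B" using BC aniso_sym by auto
  ultimately have "partial_tree A R (insert C S) (par(C := B)) (rank(C := Suc (rank B)))"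
    using T BC CA unfolding partial_tree_def by auto
  then show ?thesis using CA BC(2) by blast
qed

lemma ex_spanning_tree: "\<exists>par rank. partial_tree A R A par rank"
proof -
  have "\<exists>S par rank. partial_tree A R S par rank \<and> card S = Suc k" if "Suc k \<le> card A" for k
    using that
  proof (induction k)
    case 0
    have "partial_tree A R {R} id (\<lambda>_. 0)" using RA by (simp add: partial_tree_def)
    then show ?case by (intro exI[of _ "{R}"] exI conjI) simp_all
  next
    case (Suc k)
    then obtain S par rank where S: "partial_tree A R S par rank" "card S = Suc k" by auto
    then have "S \<noteq> A" using Suc.prems by auto
    then obtain C par' rank' where C: "C \<in> A - S" "partial_tree A R (insert C S) par' rank'"
      using extend_partial_tree[OF S(1)] by blast
    have "finite S" using S A(2) by (auto simp: partial_tree_def intro: finite_subset)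
    then show ?case using C S(2) by (intro exI[of _ "insert C S"] exI conjI) auto
  qed
  moreover have "0 < card A" using A(2) RA by (auto simp: card_gt_0_iff)
  ultimately obtain S par rank where S: "partial_tree A R S par rank" "card S = card A"
    by (metis Suc_pred order_refl)
  then have "S = A" using A(2) by (intro card_subset_eq) (auto simp: partial_tree_def)
  then show ?thesis using S(1) by blast
qed

text \<open>A smaller neighbor is a slot of X and hence its parent. A neighbor of equal size either
  has the same top, and then XY closes a uniform cycle with tree edges, or a different one, and then
  XY joins two slots within one uniform class.\<close>

lemma spanning_tree_edges_le:
  assumes T: "partial_tree A R A par rank" and XY: "X \<in> A" "aniso X Y" "n Y \<le> n X"
  shows "(X, Y) \<in> tree_edges R A par"
proof (rule ccontr)
  assume nt: "(X, Y) \<notin> tree_edges R A par"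
  have YA: "Y \<in> A" and neq: "X \<noteq> Y" using closed XY by (auto simp: aniso_def)
  show False
  proof (cases "n Y < n X")
    case True
    then have "slot X Y" using XY(2) by (simp add: slot_def)
    then have "X = R \<and> Y = R \<or> X \<noteq> R \<and> Y = par X"
      using unique_top_slot[OF T XY(1)] True YA by blast
    then show False using nt neq XY(1) by (auto simp: tree_edges_def)
  next
    case False
    let ?F = "uniform \<inter> tree_edges R A par"
    have XYu: "(X, Y) \<in> uniform" using False XY by (simp add: uniform_def)
    have sub: "(U, V) \<in> uniform\<^sup>*" if "(U, V) \<in> ?F\<^sup>*" for U V
      using that rtrancl_mono[of ?F uniform] by blast
    have usym: "(V, U) \<in> uniform\<^sup>*" if "(U, V) \<in> uniform\<^sup>*" for U V
      using that sym_rtrancl[OF sym_uniform] by (rule symD[rotated])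
    obtain T1 where T1: "T1 \<in> A" "(X, T1) \<in> ?F\<^sup>*" "n T1 = n X" "T1 = R \<or> n (par T1) < n T1"
      using ex_top[OF T XY(1)] by blast
    obtain T2 where T2: "T2 \<in> A" "(Y, T2) \<in> ?F\<^sup>*" "n T2 = n Y" "T2 = R \<or> n (par T2) < n T2"
      using ex_top[OF T YA] by blast
    have "T1 \<noteq> T2"
    proof
      assume "T1 = T2"
      then have "(T1, Y) \<in> ?F\<^sup>*" using T2(2) sym_rtrancl[OF sym_tree_edges] by (metis symD)
      then have "(X, Y) \<in> ?F\<^sup>*" using T1(2) by simp
      moreover have "(X, Y) \<notin> ?F" "(Y, X) \<notin> ?F" using nt by (auto simp: tree_edges_def)
      ultimately show False using no_uniform_cycle[of ?F, OF Int_lower1 XYu] by metis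
    qed
    have nT: "n T1 = n T2" using False T1(3) T2(3) XY(3) by simp
    \<comment> \<open>If one top is R, the parent of the other is smaller than R, which makes R
      heterogeneous and thus a slot.\<close>
    have small: "\<exists>C\<in>A. n C < n R \<or> het C" if "T1 = R \<or> T2 = R"
    proof -
      define U where "U = (if T1 = R then T2 else T1)"
      have "U \<noteq> R" "U \<in> A" "n (par U) < n U" "n U = n R"
        using that \<open>T1 \<noteq> T2\<close> T1 T2 nT by (auto simp: U_def)
      then have "par U \<in> A" "n (par U) < n R" using T by (auto simp: partial_tree_def)
      then show ?thesis by blast
    qed
    have "slot T1 (if T1 = R then R else par T1)" "slot T2 (if T2 = R then R else par T2)"
      using top_slot[OF T T1(1,4)] top_slot[OF T T2(1,4)] small by blast+
    moreover have "(T1, T2) \<in> uniform\<^sup>*"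
      using usym[OF sub[OF T1(2)]] XYu sub[OF T2(2)] by (meson rtrancl.rtrancl_into_rtrancl rtrancl_trans)
    ultimately show False using unique_slot \<open>T1 \<noteq> T2\<close> by blast
  qed
qed

lemma spanning_tree_edges:
  assumes T: "partial_tree A R A par rank" and XY: "X \<in> A" "aniso X Y"
  shows "X \<noteq> R \<and> Y = par X \<or> Y \<noteq> R \<and> X = par Y"
proof -
  have "Y \<in> A" "aniso Y X" using closed XY aniso_sym by blast+
  then have "(X, Y) \<in> tree_edges R A par \<or> (Y, X) \<in> tree_edges R A par"
    using spanning_tree_edges_le[OF T XY] spanning_tree_edges_le[OF T, of Y X]
    by (meson nat_le_linear)
  then show ?thesis by (auto simp: tree_edges_def)
qed

lemma het_imp_root:
  assumes "X \<in> A" "het X"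
  shows "X = R"
proof -
  obtain par rank where T: "partial_tree A R A par rank" using ex_spanning_tree by blast
  have "slot X X" using assms by (simp add: slot_def)
  then have "X = R \<or> X \<noteq> R \<and> X = par X" using unique_top_slot[OF T assms(1)] by blast
  then show ?thesis using T assms(1) by (auto simp: partial_tree_def aniso_def)
qed

end

section \<open>Color refinement and amenable graphs\<close>

text \<open>Color refinement as a descending chain of equivalence relations: inclusion of relations
  reduces termination to a decreasing cardinality.\<close>

primrec color_rel :: "'a pair_pre_digraph \<Rightarrow> nat \<Rightarrow> 'a rel" where
  "color_rel K 0 = pverts K \<times> pverts K"
| "color_rel K (Suc i) = {(u, v) \<in> color_rel K i. \<forall>Y\<in>pverts K // color_rel K i.
     card {w \<in> Y. (u, w) \<in> parcs K} = card {w \<in> Y. (v, w) \<in> parcs K}}"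

lemma equiv_color_rel: "equiv (pverts K) (color_rel K i)"
proof (induction i)
  case 0
  show ?case by (intro equivI refl_onI symI transI) auto
next
  case (Suc i)
  then have "refl_on (pverts K) (color_rel K i)" "sym (color_rel K i)" "trans (color_rel K i)"
    "color_rel K i \<subseteq> pverts K \<times> pverts K"
    by (auto elim: equivE)
  then show ?case
    by (intro equivI refl_onI symI transI)
      (auto dest: refl_onD symD, metis transD)
qed

text \<open>The empty graph is an exception in round 0, where the partition is \<open>{{}}\<close>
  but the quotient is empty.\<close>

lemma color_refinement_eq_quotient:
  assumes "pverts K \<noteq> {}"
  shows "color_refinement K i = pverts K // color_rel K i"
proof (induction i)
  case 0
  show ?case using assms by (auto simp: quotient_def)
next
  case (Suc i)
  note eq = equiv_color_rel[of K i]
  have "(\<exists>X\<in>pverts K // color_rel K i. u \<in> X \<and> v \<in> X) \<longleftrightarrow> (u, v) \<in> color_rel K i" for u v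
  proof
    assume "\<exists>X\<in>pverts K // color_rel K i. u \<in> X \<and> v \<in> X"
    then show "(u, v) \<in> color_rel K i" using in_quotient_imp_in_rel[OF eq] by blast
  next
    assume uv: "(u, v) \<in> color_rel K i"
    then have "u \<in> pverts K" using eq by (auto elim: equivE)
    moreover have "u \<in> color_rel K i `` {u}" using equiv_class_self[OF eq calculation] .
    ultimately show "\<exists>X\<in>pverts K // color_rel K i. u \<in> X \<and> v \<in> X"
      using uv by (intro bexI[of _ "color_rel K i `` {u}"] quotientI) auto
  qed
  moreover have "color_rel K i \<subseteq> pverts K \<times> pverts K" using eq by (auto elim: equivE)
  ultimately have "{(u, v) \<in> pverts K \<times> pverts K.
     (\<exists>X\<in>pverts K // color_rel K i. u \<in> X \<and> v \<in> X) \<and>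
     (\<forall>Y\<in>pverts K // color_rel K i. card {w \<in> Y. (u, w) \<in> parcs K} = card {w \<in> Y. (v, w) \<in> parcs K})} =
     color_rel K (Suc i)"
    by auto
  then show ?case by (simp add: refine_def Suc.IH)
qed

lemma color_rel_antimono: "i \<le> j \<Longrightarrow> color_rel K j \<subseteq> color_rel K i"
  by (rule lift_Suc_antimono_le) auto

lemma color_rel_stabilizes:
  assumes "finite (pverts K)"
  shows "\<exists>i. color_rel K (Suc i) = color_rel K i"
proof (rule ccontr)
  assume contra: "\<nexists>i. color_rel K (Suc i) = color_rel K i"
  have fin: "finite (color_rel K i)" for i
    using equiv_color_rel[of K i] assms by (auto elim!: equivE intro: finite_subset)
  have less: "card (color_rel K (Suc i)) < card (color_rel K i)" for i
  proof (rule psubset_card_mono[OF fin psubsetI])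
    show "color_rel K (Suc i) \<subseteq> color_rel K i" by (rule color_rel_antimono) simp
    show "color_rel K (Suc i) \<noteq> color_rel K i" using contra by metis
  qed
  have dec: "card (color_rel K i) + i \<le> card (color_rel K 0)" for i
  proof (induction i)
    case (Suc i)
    then show ?case using less[of i] by linarith
  qed simp
  show False using dec[of "Suc (card (color_rel K 0))"] by simp
qed

lemma stable_partition_fixpoint:
  assumes "finite (pverts K)"
  shows "\<exists>N. stable_partition K = color_refinement K N \<and>
    color_refinement K (Suc N) = color_refinement K N"
proof -
  have "\<exists>i. color_refinement K (Suc i) = color_refinement K i"
  proof (cases "pverts K = {}")
    case True
    \<comment> \<open>Round 0 is \<open>{{}}\<close>, and every later round is empty.\<close>
    then have "color_refinement K (Suc 1) = color_refinement K 1" by (simp add: refine_def)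
    then show ?thesis by blast
  next
    case False
    then show ?thesis
      using color_rel_stabilizes[OF assms] by (metis color_refinement_eq_quotient)
  qed
  from LeastI_ex[OF this] show ?thesis unfolding stable_partition_def by blast
qed

lemma stable_partition_empty:
  assumes "pverts K = {}"
  shows "stable_partition K = {}"
proof -
  obtain N where "stable_partition K = color_refinement K N"
      "color_refinement K (Suc N) = color_refinement K N"
    using stable_partition_fixpoint[of K] assms by auto
  then have "stable_partition K = refine K (color_refinement K N)" by simp
  then show ?thesis using assms by (simp add: refine_def)
qed

text \<open>Lifts equal neighbor counts from cells to unions of cells, such as the coarser color
  classes of earlier rounds.\<close>

lemma card_union_cells:
  assumes fin: "finite V" and W: "W \<subseteq> V" and P: "\<Union>P = V" "\<And>X Y. X \<in> P \<Longrightarrow> Y \<in> P \<Longrightarrow> X = Y \<or> X \<inter> Y = {}"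
    and union: "\<And>Y. Y \<in> P \<Longrightarrow> Y \<subseteq> W \<or> Y \<inter> W = {}"
    and eq: "\<And>Y. Y \<in> P \<Longrightarrow> card {w \<in> Y. f w} = card {w \<in> Y. g w}"
  shows "card {w \<in> W. f w} = card {w \<in> W. g w}"
proof -
  define Q where "Q = {Y \<in> P. Y \<subseteq> W \<and> Y \<noteq> {}}"
  have WQ: "W = \<Union>Q" using W P(1) union by (fastforce simp: Q_def)
  have finW: "finite W" using W fin by (rule finite_subset)
  have "finite Q" by (rule finite_subset[of _ "Pow W"]) (auto simp: Q_def finW)
  have *: "card {w \<in> W. h w} = (\<Sum>Y\<in>Q. card {w \<in> Y. h w})" for h
  proof -
    have "{w \<in> W. h w} = (\<Union>Y\<in>Q. {w \<in> Y. h w})" using WQ by auto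
    also have "card \<dots> = (\<Sum>Y\<in>Q. card {w \<in> Y. h w})"
    proof (rule card_UN_disjoint[OF \<open>finite Q\<close>])
      show "\<forall>Y\<in>Q. finite {w \<in> Y. h w}"
        by (auto simp: Q_def intro: finite_subset[OF _ finW])
      show "\<forall>X\<in>Q. \<forall>Y\<in>Q. X \<noteq> Y \<longrightarrow> {w \<in> X. h w} \<inter> {w \<in> Y. h w} = {}"
        using P(2) unfolding Q_def by blast
    qed
    finally show ?thesis .
  qed
  show ?thesis unfolding * by (rule sum.cong) (auto simp: Q_def eq)
qed

section \<open>The stable partition and graphs with the same degrees\<close>

locale nonempty_graph = pair_graph G for G :: "'a pair_pre_digraph" +
  assumes nonempty: "pverts G \<noteq> {}"
begin

abbreviation "V \<equiv> pverts G"
abbreviation "P \<equiv> stable_partition G"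

definition N :: nat where
  "N = (SOME N. P = color_refinement G N \<and> color_refinement G (Suc N) = color_refinement G N)"

lemma finite_V: "finite V"
  by (rule pair_finite_verts)

lemma P_eq: "P = V // color_rel G N" and stable: "V // color_rel G (Suc N) = V // color_rel G N"
proof -
  have "P = color_refinement G N \<and> color_refinement G (Suc N) = color_refinement G N"
    unfolding N_def by (rule someI_ex) (rule stable_partition_fixpoint[OF finite_V])
  then show "P = V // color_rel G N" "V // color_rel G (Suc N) = V // color_rel G N"
    using color_refinement_eq_quotient[OF nonempty] by metis+
qed

lemma Union_P: "\<Union>P = V"
  unfolding P_eq by (rule Union_quotient[OF equiv_color_rel])

lemma P_disjoint: "X \<in> P \<Longrightarrow> Y \<in> P \<Longrightarrow> X = Y \<or> X \<inter> Y = {}"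
  unfolding P_eq by (rule quotient_disj[OF equiv_color_rel])

lemma P_nonempty: "X \<in> P \<Longrightarrow> X \<noteq> {}"
  unfolding P_eq by (rule in_quotient_imp_non_empty[OF equiv_color_rel])

lemma P_subset: "X \<in> P \<Longrightarrow> X \<subseteq> V"
  using Union_P by blast

lemma finite_P: "finite P"
  using finite_V unfolding Union_P[symmetric] by (rule finite_UnionD)

lemma finite_cell: "X \<in> P \<Longrightarrow> finite X"
  using finite_subset[OF P_subset finite_V] .

lemma cell_unique: "X \<in> P \<Longrightarrow> Y \<in> P \<Longrightarrow> v \<in> X \<Longrightarrow> v \<in> Y \<Longrightarrow> X = Y"
  using P_disjoint by blast

lemma same_cell_rel: "X \<in> P \<Longrightarrow> u \<in> X \<Longrightarrow> v \<in> X \<Longrightarrow> i \<le> N \<Longrightarrow> (u, v) \<in> color_rel G i"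
proof -
  assume X: "X \<in> P" "u \<in> X" "v \<in> X" and i: "i \<le> N"
  have "(u, v) \<in> color_rel G N"
    by (rule in_quotient_imp_in_rel[OF equiv_color_rel X(1)[unfolded P_eq]]) (use X in simp)
  then show ?thesis using color_rel_antimono[OF i] by (rule subsetD[rotated])
qed

lemma rel_same_cell: "X \<in> P \<Longrightarrow> u \<in> X \<Longrightarrow> (u, v) \<in> color_rel G N \<Longrightarrow> v \<in> X"
  unfolding P_eq by (rule in_quotient_imp_closed[OF equiv_color_rel])

lemma equitable:
  assumes "X \<in> P" "Y \<in> P" "u \<in> X" "v \<in> X"
  shows "card {w \<in> Y. (u, w) \<in> parcs G} = card {w \<in> Y. (v, w) \<in> parcs G}"
proof -
  have "X \<in> V // color_rel G (Suc N)" using assms(1) P_eq stable by simp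
  then have "(u, v) \<in> color_rel G (Suc N)"
    by (rule in_quotient_imp_in_rel[OF equiv_color_rel]) (use assms in simp)
  moreover have "Y \<in> V // color_rel G N" using assms(2) unfolding P_eq .
  ultimately show ?thesis by simp
qed

lemma color_class_union:
  assumes "Y \<in> V // color_rel G i" "i \<le> N" "X \<in> P"
  shows "X \<subseteq> Y \<or> X \<inter> Y = {}"
proof (rule disjCI)
  assume "X \<inter> Y \<noteq> {}"
  then obtain u where "u \<in> X" "u \<in> Y" by blast
  then show "X \<subseteq> Y"
    using same_cell_rel[OF assms(3) _ _ assms(2)] in_quotient_imp_closed[OF equiv_color_rel assms(1)]
    by blast
qed

definition same_degrees :: "'a pair_pre_digraph \<Rightarrow> bool" where
  "same_degrees H \<longleftrightarrow> pair_graph H \<and> pverts H = V \<and>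
     (\<forall>v\<in>V. \<forall>Y\<in>P. card {w \<in> Y. (v, w) \<in> parcs H} = card {w \<in> Y. (v, w) \<in> parcs G})"

text \<open>Induction over the rounds on G: \<open>\<pi>\<close> maps each color class Y onto
  itself, so it carries G-neighbors in Y to H-neighbors in Y. As Y is a union of cells, a vertex has
  as many H-neighbors as G-neighbors in Y, and the next round cannot separate v from its
  image.\<close>

lemma iso_preserves_cells:
  assumes H: "same_degrees H" and \<pi>: "graph_isomorphism \<pi> G H" and X: "X \<in> P" "v \<in> X"
  shows "\<pi> v \<in> X"
proof -
  have bij: "bij_betw \<pi> V V" and edge: "\<And>u v. u \<in> V \<Longrightarrow> v \<in> V \<Longrightarrow> (u, v) \<in> parcs G \<longleftrightarrow> (\<pi> u, \<pi> v) \<in> parcs H"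
    using \<pi> H by (auto simp: graph_isomorphism_def same_degrees_def)
  have degH: "\<And>v Y. v \<in> V \<Longrightarrow> Y \<in> P \<Longrightarrow> card {w \<in> Y. (v, w) \<in> parcs H} = card {w \<in> Y. (v, w) \<in> parcs G}"
    using H by (auto simp: same_degrees_def)
  have \<pi>V: "\<pi> v \<in> V" if "v \<in> V" for v using bij that by (auto simp: bij_betw_def)
  have "\<forall>v\<in>V. (v, \<pi> v) \<in> color_rel G i" if "i \<le> N" for i
    using that
  proof (induction i)
    case 0
    then show ?case using \<pi>V by simp
  next
    case (Suc i)
    have "card {w \<in> Y. (v, w) \<in> parcs G} = card {w \<in> Y. (\<pi> v, w) \<in> parcs G}"
      if v: "v \<in> V" and Y: "Y \<in> V // color_rel G i" for v Y
    proof -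
      have YV: "Y \<subseteq> V" using in_quotient_imp_subset[OF equiv_color_rel Y] .
      have "\<pi> w \<in> Y" if "w \<in> Y" for w
        using Suc that YV in_quotient_imp_closed[OF equiv_color_rel Y that, of "\<pi> w"] by auto
      then have "\<pi> ` Y \<subseteq> Y" by blast
      moreover have "inj_on \<pi> Y" using bij YV by (auto simp: bij_betw_def intro: inj_on_subset)
      ultimately have \<pi>Y: "\<pi> ` Y = Y"
        using YV finite_V by (intro endo_inj_surj) (auto intro: finite_subset)
      have "\<pi> ` {w \<in> Y. (v, w) \<in> parcs G} = {w \<in> Y. (\<pi> v, w) \<in> parcs H}"
      proof (intro equalityI subsetI)
        fix x assume x: "x \<in> {w \<in> Y. (\<pi> v, w) \<in> parcs H}"
        then obtain w where "w \<in> Y" "x = \<pi> w" using \<pi>Y by blast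
        then show "x \<in> \<pi> ` {w \<in> Y. (v, w) \<in> parcs G}" using x edge[OF v] YV by blast
      next
        fix x assume "x \<in> \<pi> ` {w \<in> Y. (v, w) \<in> parcs G}"
        then show "x \<in> {w \<in> Y. (\<pi> v, w) \<in> parcs H}" using \<pi>Y edge[OF v] YV by blast
      qed
      moreover have "inj_on \<pi> {w \<in> Y. (v, w) \<in> parcs G}"
        using \<open>inj_on \<pi> Y\<close> by (rule inj_on_subset) auto
      ultimately have "card {w \<in> Y. (v, w) \<in> parcs G} = card {w \<in> Y. (\<pi> v, w) \<in> parcs H}"
        using card_image[of \<pi> "{w \<in> Y. (v, w) \<in> parcs G}"] by simp
      also have "\<dots> = card {w \<in> Y. (\<pi> v, w) \<in> parcs G}"
        by (rule card_union_cells[OF finite_V YV Union_P P_disjoint])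
          (use color_class_union[OF Y] Suc.prems degH \<pi>V[OF v] in auto)
      finally show ?thesis .
    qed
    then show ?case using Suc by simp
  qed
  then show ?thesis using rel_same_cell[OF X] X P_subset by blast
qed

text \<open>Induction over the rounds: if both copies of every cell share a color, then a color
  class W meets the two copies in the same set of vertices, and this set is a union of cells. Hence
  corresponding vertices of G and H have equally many neighbors in W.\<close>

lemma same_color_in_disj_union:
  fixes h :: "'a \<Rightarrow> 'b"
  assumes H: "same_degrees H" and h: "inj_on h V"
    and K: "K = disj_union G \<lparr> pverts = h ` V, parcs = map_prod h h ` parcs H \<rparr>"
    and X: "X \<in> P" and x: "x \<in> Inl ` X \<union> Inr ` h ` X" and y: "y \<in> Inl ` X \<union> Inr ` h ` X"
  shows "(x, y) \<in> color_rel K i"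
  using X x y
proof (induction i arbitrary: X x y)
  case 0
  then show ?case using P_subset[OF 0(1)] by (auto simp: K disj_union_def)
next
  case (Suc i)
  interpret H: pair_graph H using H by (simp add: same_degrees_def)
  have HV: "pverts H = V" using H by (simp add: same_degrees_def)
  have "card {w \<in> W. (x, w) \<in> parcs K} = card {w \<in> W. (y, w) \<in> parcs K}"
    if W: "W \<in> pverts K // color_rel K i" for W
  proof -
    define W0 where "W0 = {v \<in> V. Inl v \<in> W}"
    note clos = in_quotient_imp_closed[OF equiv_color_rel W]
    have inr: "Inr (h v) \<in> W \<longleftrightarrow> v \<in> W0" if v: "v \<in> V" for v
    proof -
      obtain Y where "Y \<in> P" "v \<in> Y" using v Union_P by blast
      then have "(Inl v, Inr (h v)) \<in> color_rel K i" "(Inr (h v), Inl v) \<in> color_rel K i"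
        using Suc.IH by blast+
      then show ?thesis using clos v by (auto simp: W0_def)
    qed
    have union: "Y \<subseteq> W0 \<or> Y \<inter> W0 = {}" if Y: "Y \<in> P" for Y
    proof -
      have "v \<in> W0" if "u \<in> Y" "u \<in> W0" "v \<in> Y" for u v
        using clos[of "Inl u" "Inl v"] Suc.IH[OF Y, of "Inl u" "Inl v"] that P_subset[OF Y]
        by (auto simp: W0_def)
      then show ?thesis by blast
    qed
    have W0: "W0 \<subseteq> V" by (auto simp: W0_def)
    note cells = card_union_cells[OF finite_V W0 Union_P P_disjoint union]
    define u0 where "u0 = (SOME u. u \<in> X)"
    have u0: "u0 \<in> X" unfolding u0_def using P_nonempty[OF Suc.prems(1)] by (simp add: some_in_eq)
    have XV: "X \<subseteq> V" using P_subset[OF Suc.prems(1)] .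
    have deg: "card {w \<in> W. (z, w) \<in> parcs K} = card {w \<in> W0. (u0, w) \<in> parcs G}"
      if z: "z \<in> Inl ` X \<union> Inr ` h ` X" for z
    proof -
      consider u where "u \<in> X" "z = Inl u" | u where "u \<in> X" "z = Inr (h u)" using z by blast
      then show ?thesis
      proof cases
        case 1
        have "{w \<in> W. (z, w) \<in> parcs K} = Inl ` {w \<in> W0. (u, w) \<in> parcs G}"
          using 1 by (auto simp: K disj_union_def W0_def dest: in_arcsD2)
        then have "card {w \<in> W. (z, w) \<in> parcs K} = card {w \<in> W0. (u, w) \<in> parcs G}"
          by (simp add: card_image)
        also have "\<dots> = card {w \<in> W0. (u0, w) \<in> parcs G}"
          by (rule cells) (use equitable[OF Suc.prems(1) _ 1(1) u0] in auto)
        finally show ?thesis .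
      next
        case 2
        have inj: "h a = h b \<longleftrightarrow> a = b" if "a \<in> V" "b \<in> V" for a b
          using h that by (auto simp: inj_on_def)
        have "{w \<in> W. (z, w) \<in> parcs K} = Inr ` h ` {w \<in> W0. (u, w) \<in> parcs H}"
        proof (intro equalityI subsetI)
          fix w :: "'a + 'b" assume w: "w \<in> {w \<in> W. (z, w) \<in> parcs K}"
          then obtain a b where ab: "(a, b) \<in> parcs H" "h u = h a" "w = Inr (h b)"
            using 2 by (auto simp: K disj_union_def)
          then have "a \<in> V" "b \<in> V" using H.in_arcsD1 H.in_arcsD2 HV by blast+
          then have "a = u" "b \<in> W0" using inj ab 2 XV w inr by auto
          then show "w \<in> Inr ` h ` {w \<in> W0. (u, w) \<in> parcs H}" using ab by blast
        next
          fix w :: "'a + 'b" assume "w \<in> Inr ` h ` {w \<in> W0. (u, w) \<in> parcs H}"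
          then obtain b where b: "b \<in> W0" "(u, b) \<in> parcs H" "w = Inr (h b)" by blast
          then show "w \<in> {w \<in> W. (z, w) \<in> parcs K}"
            using 2 inr W0 by (force simp: K disj_union_def)
        qed
        then have "card {w \<in> W. (z, w) \<in> parcs K} = card {w \<in> W0. (u, w) \<in> parcs H}"
          using inj_on_subset[OF h, of "{w \<in> W0. (u, w) \<in> parcs H}"] W0
          by (simp add: card_image subset_iff)
        also have "\<dots> = card {w \<in> W0. (u0, w) \<in> parcs G}"
          by (rule cells) (use equitable[OF Suc.prems(1) _ 2(1) u0] H 2(1) XV in
              \<open>auto simp: same_degrees_def\<close>)
        finally show ?thesis .
      qed
    qed
    show ?thesis using deg[OF Suc.prems(2)] deg[OF Suc.prems(3)] by simp
  qed
  then show ?case using Suc.IH[OF Suc.prems] by simp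
qed

lemma balanced_disj_union:
  assumes H: "same_degrees H" and h: "inj_on h V"
    and K: "K = disj_union G H'" and H': "H' = \<lparr> pverts = h ` V, parcs = map_prod h h ` parcs H \<rparr>"
    and W: "W \<in> stable_partition K"
  shows "card {v \<in> V. Inl v \<in> W} = card {v \<in> pverts H'. Inr v \<in> W}"
proof -
  have ne: "pverts K \<noteq> {}" and fin: "finite (pverts K)"
    using nonempty finite_V by (auto simp: K H' disj_union_def)
  obtain M where "stable_partition K = color_refinement K M"
    using stable_partition_fixpoint[OF fin] by blast
  then have WM: "W \<in> pverts K // color_rel K M" using W color_refinement_eq_quotient[OF ne] by simp
  note clos = in_quotient_imp_closed[OF equiv_color_rel WM]
  have inr: "Inr (h v) \<in> W \<longleftrightarrow> Inl v \<in> W" if v: "v \<in> V" for v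
  proof -
    obtain Y where "Y \<in> P" "v \<in> Y" using v Union_P by blast
    then have "(Inl v, Inr (h v)) \<in> color_rel K M" "(Inr (h v), Inl v) \<in> color_rel K M"
      using same_color_in_disj_union[OF H h K[unfolded H']] by blast+
    then show ?thesis using clos by blast
  qed
  have "{v \<in> pverts H'. Inr v \<in> W} = h ` {v \<in> V. Inl v \<in> W}"
    using inr by (auto simp: H')
  moreover have "inj_on h {v \<in> V. Inl v \<in> W}" using h by (rule inj_on_subset) auto
  ultimately show ?thesis by (simp add: card_image)
qed

text \<open>Amenability quantifies over graphs on \<open>nat\<close>, so H is moved there by an
  injection and the isomorphism is pulled back. Color refinement accepts the copy by
  \<open>balanced_disj_union\<close>.\<close>

lemma amenable_iso:
  assumes am: "amenable G" and H: "same_degrees H"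
  shows "\<exists>\<pi>. graph_isomorphism \<pi> G H"
proof -
  interpret H: pair_graph H using H by (simp add: same_degrees_def)
  have HV: "pverts H = V" using H by (simp add: same_degrees_def)
  obtain h :: "'a \<Rightarrow> nat" where h: "inj_on h V" using finite_imp_inj_to_nat_seg[OF finite_V] by blast
  define H' where "H' = \<lparr> pverts = h ` V, parcs = map_prod h h ` parcs H \<rparr>"
  have H': "pair_graph H'"
  proof
    show "finite (pverts H')" "finite (parcs H')"
      using finite_V H.pair_finite_arcs by (auto simp: H'_def)
    show "symmetric (with_proj H')"
      using H.arcs_symmetric by (auto simp: H'_def symmetric_def intro!: symI)
    fix e assume "e \<in> parcs H'"
    then obtain a b where ab: "(a, b) \<in> parcs H" "e = (h a, h b)" by (auto simp: H'_def)
    moreover have abV: "a \<in> V" "b \<in> V" using ab H.in_arcsD1 H.in_arcsD2 HV by blast+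
    ultimately show "fst e \<in> pverts H'" "snd e \<in> pverts H'" by (auto simp: H'_def)
    show "fst e \<noteq> snd e" using ab abV h H.no_loops' by (auto simp: inj_on_def)
  qed
  have "digraph_iso (with_proj G) (with_proj H')"
    using am H' balanced_disj_union[OF H h refl H'_def] unfolding amenable_def by blast
  then obtain \<rho> where \<rho>: "graph_isomorphism \<rho> G H'"
    using digraph_iso_iff_graph_isomorphism[OF pair_graph_axioms H'] by blast
  have hb: "bij_betw h V (h ` V)" using h by (simp add: bij_betw_def)
  have \<rho>b: "bij_betw \<rho> V (h ` V)" using \<rho> by (simp add: graph_isomorphism_def H'_def)
  have bij: "bij_betw (inv_into V h \<circ> \<rho>) V V"
    using bij_betw_trans[OF \<rho>b bij_betw_inv_into[OF hb]] .
  have hinv: "h (inv_into V h (\<rho> v)) = \<rho> v" if "v \<in> V" for v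
    using bij_betw_apply[OF \<rho>b that] by (rule f_inv_into_f)
  have "(u, v) \<in> parcs G \<longleftrightarrow> (inv_into V h (\<rho> u), inv_into V h (\<rho> v)) \<in> parcs H"
    if uv: "u \<in> V" "v \<in> V" for u v
  proof -
    define a b where "a = inv_into V h (\<rho> u)" and "b = inv_into V h (\<rho> v)"
    have ab: "a \<in> V" "b \<in> V" using bij uv by (auto simp: a_def b_def bij_betw_def)
    have "(u, v) \<in> parcs G \<longleftrightarrow> (h a, h b) \<in> parcs H'"
      using \<rho> uv hinv by (simp add: graph_isomorphism_def a_def b_def)
    also have "\<dots> \<longleftrightarrow> (a, b) \<in> parcs H"
    proof
      assume "(h a, h b) \<in> parcs H'"
      then obtain a' b' where "(a', b') \<in> parcs H" "h a = h a'" "h b = h b'" by (auto simp: H'_def)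
      moreover from this have "a' \<in> V" "b' \<in> V" using H.in_arcsD1 H.in_arcsD2 HV by blast+
      ultimately show "(a, b) \<in> parcs H" using h ab by (auto dest: inj_onD)
    qed (auto simp: H'_def)
    finally show ?thesis by (simp add: a_def b_def)
  qed
  then have "graph_isomorphism (inv_into V h \<circ> \<rho>) G H"
    using bij HV by (simp add: graph_isomorphism_def)
  then show ?thesis by blast
qed

section \<open>Labelings and the templates that they realize\<close>

definition cell_of :: "'a \<Rightarrow> 'a set" where
  "cell_of v = (THE X. X \<in> P \<and> v \<in> X)"

lemma cell_of: "X \<in> P \<Longrightarrow> v \<in> X \<Longrightarrow> cell_of v = X"
  unfolding cell_of_def by (rule the_equality) (use cell_unique in blast)+

lemma cell_of_in: "v \<in> V \<Longrightarrow> cell_of v \<in> P"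
  and in_cell_of: "v \<in> V \<Longrightarrow> v \<in> cell_of v"
proof -
  assume "v \<in> V"
  then obtain X where "X \<in> P" "v \<in> X" using Union_P by blast
  then show "cell_of v \<in> P" "v \<in> cell_of v" using cell_of by simp_all
qed

definition deg :: "'a set \<Rightarrow> 'a set \<Rightarrow> nat" where
  "deg X Y = card {w \<in> Y. ((SOME v. v \<in> X), w) \<in> parcs G}"

lemma deg:
  assumes "X \<in> P" "Y \<in> P" "v \<in> X"
  shows "card {w \<in> Y. (v, w) \<in> parcs G} = deg X Y"
proof -
  have "(SOME v. v \<in> X) \<in> X" using assms(3) by (rule someI)
  then show ?thesis unfolding deg_def by (rule equitable[OF assms])
qed

definition labeling :: "('a \<Rightarrow> nat) \<Rightarrow> bool" where
  "labeling l \<longleftrightarrow> (\<forall>X\<in>P. bij_betw l X {..<card X})"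

definition realizes :: "('a \<Rightarrow> nat) \<Rightarrow> ('a set \<Rightarrow> 'a set \<Rightarrow> nat \<Rightarrow> nat \<Rightarrow> bool) \<Rightarrow> bool" where
  "realizes l b \<longleftrightarrow> labeling l \<and>
     (\<forall>X\<in>P. \<forall>Y\<in>P. \<forall>u\<in>X. \<forall>v\<in>Y. (u, v) \<in> parcs G \<longleftrightarrow> b X Y (l u) (l v))"

lemma ex_labeling: "\<exists>l. labeling l"
proof -
  have "\<exists>f. bij_betw f X {..<card X}" if "X \<in> P" for X
    using finite_cell[OF that] ex_bij_betw_finite_nat[of X] by (auto simp: atLeast0LessThan)
  then obtain f where f: "bij_betw (f X) X {..<card X}" if "X \<in> P" for X by metis
  have "bij_betw (\<lambda>v. f (cell_of v) v) X {..<card X}" if "X \<in> P" for X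
    using f[OF that] by (rule bij_betw_cong[THEN iffD1, rotated]) (simp add: cell_of[OF that])
  then show ?thesis unfolding labeling_def by blast
qed

lemma labelingD:
  assumes "labeling l" "X \<in> P"
  shows "bij_betw l X {..<card X}" "inj_on l X" "l ` X = {..<card X}" "v \<in> X \<Longrightarrow> l v < card X"
proof -
  show *: "bij_betw l X {..<card X}" using assms unfolding labeling_def by blast
  then show "inj_on l X" "l ` X = {..<card X}" by (rule bij_betw_imp_inj_on, rule bij_betw_imp_surj_on)
  show "l v < card X" if "v \<in> X" using bij_betw_apply[OF * that] by simp
qed

lemma card_label:
  assumes "labeling l" "Y \<in> P"
  shows "card {w \<in> Y. Q (l w)} = card {j. j < card Y \<and> Q j}"
proof -
  have "l ` {w \<in> Y. Q (l w)} = {j. j < card Y \<and> Q j}"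
  proof (intro equalityI subsetI)
    fix j assume j: "j \<in> {j. j < card Y \<and> Q j}"
    then have "j \<in> l ` Y" unfolding labelingD(3)[OF assms] by simp
    then show "j \<in> l ` {w \<in> Y. Q (l w)}" using j by blast
  qed (use labelingD(4)[OF assms] in blast)
  moreover have "inj_on l {w \<in> Y. Q (l w)}" using labelingD(2)[OF assms] by (rule inj_on_subset) auto
  ultimately show ?thesis using card_image[of l "{w \<in> Y. Q (l w)}"] by simp
qed

lemma realizes_valid:
  assumes r: "realizes l b"
  shows "valid_template P card deg b"
proof -
  have l: "labeling l" and b: "\<And>X Y u v. X \<in> P \<Longrightarrow> Y \<in> P \<Longrightarrow> u \<in> X \<Longrightarrow> v \<in> Y \<Longrightarrow>
      b X Y (l u) (l v) \<longleftrightarrow> (u, v) \<in> parcs G"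
    using r by (auto simp: realizes_def)
  have ex: "\<exists>u\<in>X. i = l u" if "X \<in> P" "i < card X" for X i
    using labelingD(3)[OF l that(1)] that(2) by (metis imageE lessThan_iff)
  show ?thesis unfolding valid_template_def
  proof (intro conjI ballI allI impI)
    fix X Y i j assume XY: "X \<in> P" "Y \<in> P" "i < card X" "j < card Y"
    then obtain u v where "u \<in> X" "v \<in> Y" "i = l u" "j = l v" using ex by blast
    then show "b X Y i j = b Y X j i" using b XY arcs_symmetric by metis
  next
    fix X i assume X: "X \<in> P" "i < card X"
    then obtain u where "u \<in> X" "i = l u" using ex by blast
    then show "\<not> b X X i i" using b X no_loops' by metis
  next
    fix X Y i assume XY: "X \<in> P" "Y \<in> P" "i < card X"
    then obtain u where u: "u \<in> X" "i = l u" using ex by blast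
    have "{w \<in> Y. (u, w) \<in> parcs G} = {w \<in> Y. b X Y (l u) (l w)}"
      using b[OF XY(1,2) u(1)] by blast
    then show "card {j. j < card Y \<and> b X Y i j} = deg X Y"
      using deg[OF XY(1,2) u(1)] card_label[OF l XY(2)] u(2) by simp
  qed
qed

text \<open>Drawn on V along any labeling \<open>l\<close>, the template is a graph with the degrees
  of G. It is isomorphic to G by some \<open>\<pi>\<close> that fixes every cell, and
  \<open>l \<circ> \<pi>\<close> realizes the template.\<close>

lemma ex_realizes:
  assumes am: "amenable G" and b: "valid_template P card deg b"
  shows "\<exists>l. realizes l b"
proof -
  obtain l where l: "labeling l" using ex_labeling by blast
  define H where "H = \<lparr> pverts = V,
    parcs = {(u, v). u \<in> V \<and> v \<in> V \<and> b (cell_of u) (cell_of v) (l u) (l v)} \<rparr>"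
  have lt: "l v < card (cell_of v)" if "v \<in> V" for v
    using labelingD(4)[OF l cell_of_in[OF that] in_cell_of[OF that]] .
  have "pair_graph H"
  proof
    show "finite (pverts H)" using finite_V by (simp add: H_def)
    show "finite (parcs H)"
      by (rule finite_subset[of _ "V \<times> V"]) (use finite_V in \<open>auto simp: H_def\<close>)
    have "b (cell_of v) (cell_of u) (l v) (l u)"
      if "u \<in> V" "v \<in> V" "b (cell_of u) (cell_of v) (l u) (l v)" for u v
      using that b cell_of_in lt unfolding valid_template_def by blast
    then show "symmetric (with_proj H)" by (auto simp: symmetric_def H_def intro!: symI)
    fix e assume "e \<in> parcs H"
    then show "fst e \<in> pverts H" "snd e \<in> pverts H" by (auto simp: H_def)
    show "fst e \<noteq> snd e"
      using \<open>e \<in> parcs H\<close> b cell_of_in lt unfolding valid_template_def H_def by (cases e) auto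
  qed
  moreover have "card {w \<in> Y. (v, w) \<in> parcs H} = card {w \<in> Y. (v, w) \<in> parcs G}"
    if v: "v \<in> V" and Y: "Y \<in> P" for v Y
  proof -
    have "{w \<in> Y. (v, w) \<in> parcs H} = {w \<in> Y. b (cell_of v) Y (l v) (l w)}"
      using v P_subset[OF Y] cell_of[OF Y] by (auto simp: H_def)
    then have "card {w \<in> Y. (v, w) \<in> parcs H} = card {j. j < card Y \<and> b (cell_of v) Y (l v) j}"
      using card_label[OF l Y] by simp
    also have "\<dots> = deg (cell_of v) Y"
      using b cell_of_in[OF v] Y lt[OF v] unfolding valid_template_def by blast
    finally show ?thesis using deg[OF cell_of_in[OF v] Y in_cell_of[OF v]] by simp
  qed
  ultimately have H: "same_degrees H" by (simp add: same_degrees_def H_def)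
  obtain \<pi> where \<pi>: "graph_isomorphism \<pi> G H" using amenable_iso[OF am H] by blast
  note cells = iso_preserves_cells[OF H \<pi>]
  have inj: "inj_on \<pi> V" using \<pi> by (simp add: graph_isomorphism_def bij_betw_def)
  have "bij_betw (l \<circ> \<pi>) X {..<card X}" if X: "X \<in> P" for X
  proof -
    have "inj_on \<pi> X" using inj P_subset[OF X] by (rule inj_on_subset)
    moreover have "\<pi> ` X \<subseteq> X" using cells[OF X] by blast
    ultimately have "bij_betw \<pi> X X" using endo_inj_surj[OF finite_cell[OF X]] by (simp add: bij_betw_def)
    then show ?thesis using labelingD(1)[OF l X] by (rule bij_betw_trans)
  qed
  moreover have "(u, v) \<in> parcs G \<longleftrightarrow> b X Y (l (\<pi> u)) (l (\<pi> v))"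
    if XY: "X \<in> P" "Y \<in> P" "u \<in> X" "v \<in> Y" for X Y u v
  proof -
    have uv: "u \<in> V" "v \<in> V" using XY P_subset by auto
    have "\<pi> u \<in> X" "\<pi> v \<in> Y" using cells XY by auto
    then have "cell_of (\<pi> u) = X" "cell_of (\<pi> v) = Y" "\<pi> u \<in> V" "\<pi> v \<in> V"
      using cell_of XY P_subset by auto
    then show ?thesis using \<pi> uv by (simp add: graph_isomorphism_def H_def)
  qed
  ultimately have "realizes (l \<circ> \<pi>) b" by (simp add: realizes_def labeling_def)
  then show ?thesis by blast
qed

text \<open>Any labeling pulls G itself back to a valid template. Two valid templates are realized
  by labelings \<open>l\<close> and \<open>l'\<close> of the same G, and the change from
  \<open>l\<close> to \<open>l'\<close> is the isomorphism.\<close>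

lemma rigid_type: "amenable G \<Longrightarrow> rigid_type P card deg"
proof
  assume am: "amenable G"
  fix X assume "X \<in> P"
  then show "0 < card X" using P_nonempty finite_cell by (simp add: card_gt_0_iff)
next
  obtain l where l: "labeling l" using ex_labeling by blast
  define b where "b X Y i j \<longleftrightarrow> (inv_into X l i, inv_into Y l j) \<in> parcs G" for X Y i j
  have "realizes l b"
    using l labelingD(2)[OF l] by (simp add: realizes_def b_def)
  then show "\<exists>b. valid_template P card deg b" using realizes_valid by blast
next
  fix b b' assume am: "amenable G" and b: "valid_template P card deg b" "valid_template P card deg b'"
  obtain l where l: "realizes l b" using ex_realizes[OF am b(1)] by blast
  obtain l' where l': "realizes l' b'" using ex_realizes[OF am b(2)] by blast
  have lab: "labeling l" "labeling l'" using l l' by (auto simp: realizes_def)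
  define \<sigma> where "\<sigma> X = l' \<circ> inv_into X l" for X
  have inv: "inv_into X l i \<in> X" "l (inv_into X l i) = i" if "X \<in> P" "i < card X" for X i
    using labelingD(3)[OF lab(1) that(1)] that(2)
    by (metis inv_into_into lessThan_iff, metis f_inv_into_f lessThan_iff)
  have "bij_betw (\<sigma> X) {..<card X} {..<card X}" if "X \<in> P" for X
    unfolding \<sigma>_def
    by (rule bij_betw_trans[OF bij_betw_inv_into]) (use labelingD(1) lab that in blast)+
  moreover have "b X Y i j = b' X Y (\<sigma> X i) (\<sigma> Y j)"
    if XY: "X \<in> P" "Y \<in> P" "i < card X" "j < card Y" for X Y i j
  proof -
    define u v where "u = inv_into X l i" and "v = inv_into Y l j"
    have uv: "u \<in> X" "v \<in> Y" "l u = i" "l v = j" using inv XY by (auto simp: u_def v_def)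
    have "b X Y (l u) (l v) \<longleftrightarrow> (u, v) \<in> parcs G" using l XY uv by (simp add: realizes_def)
    also have "\<dots> \<longleftrightarrow> b' X Y (l' u) (l' v)" using l' XY uv by (simp add: realizes_def)
    finally show ?thesis using uv by (simp add: \<sigma>_def u_def v_def)
  qed
  ultimately show "\<exists>\<sigma>. template_iso P card \<sigma> b b'" unfolding template_iso_def by blast
qed

end

section \<open>Cycles, matchings and stars\<close>

lemma cycle_if_cyclic_order:
  assumes "1 \<le> m" and arcs: "\<And>i. i < m \<Longrightarrow> (w i, w (Suc i)) \<in> parcs H" and close: "w m = w 0"
    and inj: "inj_on w {..<m}" and verts: "pverts H = w ` {..<m}"
  shows "\<exists>p. pre_digraph.cycle (with_proj H) p \<and> fst ` set p = pverts H"
proof -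
  define p where "p a = map (\<lambda>i. (w i, w (Suc i))) [a..<m]" for a
  have walk: "pcas (w a) (p a) (w m) \<and> pawalk_verts (w a) (p a) = map w [a..<m] @ [w m]" if "a \<le> m" for a
    using that
  proof (induction "m - a" arbitrary: a)
    case 0
    then show ?case by (simp add: p_def)
  next
    case (Suc k)
    then have "a < m" "k = m - Suc a" by auto
    then have "pcas (w (Suc a)) (p (Suc a)) (w m) \<and>
        pawalk_verts (w (Suc a)) (p (Suc a)) = map w [Suc a..<m] @ [w m]"
      using Suc.hyps(1)[of "Suc a"] by simp
    moreover have "p a = (w a, w (Suc a)) # p (Suc a)" "[a..<m] = a # [Suc a..<m]"
      using \<open>a < m\<close> by (simp_all add: p_def upt_conv_Cons)
    ultimately show ?case by simp
  qed
  have w0: "w 0 \<in> pverts H" using assms(1) verts by auto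
  have set: "set (p 0) \<subseteq> parcs H" using arcs by (auto simp: p_def)
  have "[0..<m] = 0 # [1..<m]" using assms(1) by (simp add: upt_conv_Cons)
  then have tl: "tl (pawalk_verts (w 0) (p 0)) = map w [1..<m] @ [w 0]"
    using walk[of 0] close by simp
  have "w 0 \<notin> w ` {1..<m}"
  proof
    assume "w 0 \<in> w ` {1..<m}"
    then obtain i where "w 0 = w i" "1 \<le> i" "i < m" by auto
    then show False using inj_onD[OF inj, of 0 i] by simp
  qed
  moreover have "inj_on w {1..<m}" using inj by (rule inj_on_subset) auto
  ultimately have "distinct (map w [1..<m] @ [w 0])" by (simp add: distinct_map)
  moreover have "p 0 \<noteq> []" using assms(1) by (simp add: p_def)
  ultimately have "pre_digraph.cycle (with_proj H) (p 0)"
    unfolding pre_digraph.cycle_def pre_digraph.awalk_def cas_with_proj_eq awalk_verts_with_proj_eq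
    using walk[of 0] close w0 set tl by (intro exI[of _ "w 0"]) simp
  moreover have "fst ` set (p 0) = pverts H" unfolding verts by (force simp: p_def)
  ultimately show ?thesis by blast
qed

lemma pcas_nth:
  assumes "pcas u p v"
  shows "length (pawalk_verts u p) = Suc (length p)"
    and "i < length p \<Longrightarrow> p ! i = (pawalk_verts u p ! i, pawalk_verts u p ! Suc i)"
    and "pawalk_verts u p ! 0 = u" and "pawalk_verts u p ! length p = v"
  using assms
proof (induction p arbitrary: u i)
  case (Cons e es)
  {
    case 1 then show ?case using Cons.IH(1)[of "snd e"] by simp
  next
    case 2
    then show ?case using Cons.IH(2)[of "i - 1" "snd e"] Cons.IH(3)[of "snd e"]
      by (cases i) (auto simp: prod_eq_iff)
  next
    case 3 then show ?case by simp
  next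
    case 4 then show ?case using Cons.IH(4)[of "snd e"] by simp
  }
qed simp_all

text \<open>On a cycle of length at least three, a vertex of maximal rank has two different lower neighbors.\<close>

lemma no_cycle_if_unique_lower_neighbor:
  fixes \<rho> :: "'a \<Rightarrow> nat"
  assumes sym: "\<And>x y. (x, y) \<in> parcs T \<Longrightarrow> (y, x) \<in> parcs T"
    and ne: "\<And>x y. (x, y) \<in> parcs T \<Longrightarrow> \<rho> x \<noteq> \<rho> y"
    and uniq: "\<And>x x' y. (x, y) \<in> parcs T \<Longrightarrow> (x', y) \<in> parcs T \<Longrightarrow> \<rho> x < \<rho> y \<Longrightarrow> \<rho> x' < \<rho> y \<Longrightarrow> x = x'"
  shows "\<not> (\<exists>p. pre_digraph.cycle (with_proj T) p \<and> 3 \<le> length p)"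
proof
  assume "\<exists>p. pre_digraph.cycle (with_proj T) p \<and> 3 \<le> length p"
  then obtain p u where p: "set p \<subseteq> parcs T" "pcas u p u" "distinct (tl (pawalk_verts u p))" "3 \<le> length p"
    unfolding pre_digraph.cycle_def pre_digraph.awalk_def cas_with_proj_eq awalk_verts_with_proj_eq
    by auto
  define k where "k = length p"
  define w where "w i = pawalk_verts u p ! i" for i
  note nth = pcas_nth[OF p(2)]
  have arc: "(w i, w (Suc i)) \<in> parcs T" if "i < k" for i
    using nth(2)[of i] p(1) that nth_mem[of i p] unfolding w_def k_def by (metis subsetD)
  have w0: "w 0 = w k" using nth(3,4) by (simp add: w_def k_def)
  have dist: "i = j" if "w i = w j" "1 \<le> i" "i \<le> k" "1 \<le> j" "j \<le> k" for i j
  proof -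
    have len: "length (tl (pawalk_verts u p)) = k" using nth(1) by (simp add: k_def)
    have "tl (pawalk_verts u p) ! (i - 1) = w i" "tl (pawalk_verts u p) ! (j - 1) = w j"
      using that nth(1) by (simp_all add: nth_tl w_def k_def)
    then have "i - 1 = j - 1"
      using p(3) that len by (subst nth_eq_iff_index_eq[OF p(3), symmetric]) auto
    then show ?thesis using that by simp
  qed
  define S where "S = (\<lambda>i. \<rho> (w i)) ` {1..k}"
  have S: "finite S" "S \<noteq> {}" using p(4) by (auto simp: S_def k_def)
  from Max_in[OF S] obtain j where j1: "j \<in> {1..k}" "Max S = \<rho> (w j)" unfolding S_def by blast
  have "\<rho> (w i) \<le> \<rho> (w j)" if "i \<in> {1..k}" for i
    unfolding j1(2)[symmetric] using that by (intro Max_ge[OF S(1)]) (simp add: S_def)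
  note j = j1(1) this
  \<comment> \<open>Positions run from 1 to k, as \<open>tl\<close> drops the repeated start; so the
    predecessor of 1 is k and the successor of k is 1. The two differ because k is at least
    3.\<close>
  define a where "a = (if j = 1 then k else j - 1)"
  define b where "b = (if j = k then 1 else Suc j)"
  have ab: "a \<in> {1..k}" "b \<in> {1..k}" "a \<noteq> b" using j(1) p(4) by (auto simp: a_def b_def k_def)
  have wa: "w a = w (j - 1)" using w0 by (simp add: a_def)
  have "(w (j - 1), w j) \<in> parcs T" using arc[of "j - 1"] j(1) by auto
  then have arca: "(w a, w j) \<in> parcs T" using wa by simp
  have arcb: "(w b, w j) \<in> parcs T"
  proof (cases "j = k")
    case True
    have "0 < k" using p(4) unfolding k_def by linarith
    then have "(w k, w (Suc 0)) \<in> parcs T" using arc[of 0] w0 by simp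
    then show ?thesis using True sym by (simp add: b_def)
  next
    case False
    then show ?thesis using arc[of j] j(1) sym by (simp add: b_def)
  qed
  have "\<rho> (w a) < \<rho> (w j)" "\<rho> (w b) < \<rho> (w j)"
    using j(2)[OF ab(1)] j(2)[OF ab(2)] ne[OF arca] ne[OF arcb] by auto
  then have "w a = w b" using uniq[OF arca arcb] by blast
  then show False using dist[of a b] ab by auto
qed

lemma matching_graph_neighbor:
  assumes M: "matching_graph G" and v: "v \<in> pverts G"
  shows "card {w. (v, w) \<in> parcs G} = 1"
proof -
  obtain M where M: "partition_on (pverts G) M" "\<forall>e\<in>M. card e = 2"
      "parcs G = {(u, v). u \<noteq> v \<and> {u, v} \<in> M}"
    using M unfolding matching_graph_def by blast
  obtain e where e: "e \<in> M" "v \<in> e" using M(1) v by (auto simp: partition_on_def)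
  then obtain w where w: "e = {v, w}" "v \<noteq> w"
    using M(2) by (metis card_2_iff insertE insert_commute singletonD)
  have "{w. (v, w) \<in> parcs G} = {w}"
  proof (intro equalityI subsetI)
    fix x assume "x \<in> {w. (v, w) \<in> parcs G}"
    then have x: "v \<noteq> x" "{v, x} \<in> M" using M(3) by auto
    have "disjoint M" using M(1) by (simp add: partition_on_def)
    then have "{v, x} = e" using e x(2) disjointD by blast
    then show "x \<in> {w}" using w x by (auto simp: doubleton_eq_iff)
  qed (use w e M(3) in auto)
  then show ?thesis by simp
qed

lemma matching_graph_card:
  assumes M: "matching_graph G" and fin: "finite (pverts G)"
  shows "4 \<le> card (pverts G)"
proof -
  obtain M where M: "partition_on (pverts G) M" "\<forall>e\<in>M. card e = 2" "2 \<le> card M"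
    using M unfolding matching_graph_def by blast
  have "card (pverts G) = (\<Sum>e\<in>M. card e)"
    using product_partition[OF M(1)] fin M(1) by (auto simp: partition_on_def intro: finite_subset)
  then show ?thesis using M by simp
qed

text \<open>Three vertices exclude a single K_2, which is complete and does not count as a matching
  graph.\<close>

lemma matching_graph_if_one_neighbor:
  assumes G: "pair_graph G" and one: "\<And>v. v \<in> pverts G \<Longrightarrow> card {w. (v, w) \<in> parcs G} = 1"
    and three: "3 \<le> card (pverts G)"
  shows "matching_graph G"
proof -
  interpret pair_graph G by (rule G)
  define M where "M = (\<lambda>(u, v). {u, v}) ` parcs G"
  have uniq: "w = w'" if vw: "(v, w) \<in> parcs G" "(v, w') \<in> parcs G" for v w w'
  proof -
    obtain x where x: "{w. (v, w) \<in> parcs G} = {x}"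
      using one[OF in_arcsD1[OF vw(1)]] card_1_singletonE by blast
    have "w \<in> {w. (v, w) \<in> parcs G}" "w' \<in> {w. (v, w) \<in> parcs G}" using vw by simp_all
    then show ?thesis unfolding x by simp
  qed
  have ex: "\<exists>w. (v, w) \<in> parcs G" if "v \<in> pverts G" for v
    using one[OF that] by (auto simp: card_1_singleton_iff)
  have edge: "(u, v) \<in> parcs G \<longleftrightarrow> u \<noteq> v \<and> {u, v} \<in> M" for u v
  proof
    assume "(u, v) \<in> parcs G"
    then show "u \<noteq> v \<and> {u, v} \<in> M" using no_loops' by (auto simp: M_def)
  next
    assume "u \<noteq> v \<and> {u, v} \<in> M"
    then obtain a b where "(a, b) \<in> parcs G" "{u, v} = {a, b}" by (auto simp: M_def)
    then show "(u, v) \<in> parcs G" using arcs_symmetric by (auto simp: doubleton_eq_iff)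
  qed
  have "\<Union>M = pverts G" using ex in_arcsD1 in_arcsD2 by (fastforce simp: M_def)
  moreover have "disjoint M"
  proof (rule disjointI)
    fix e e' assume "e \<in> M" "e' \<in> M" "e \<noteq> e'"
    then obtain a b a' b' where ab: "e = {a, b}" "e' = {a', b'}" "(a, b) \<in> parcs G" "(a', b') \<in> parcs G"
      by (auto simp: M_def)
    show "e \<inter> e' = {}"
    proof (rule ccontr)
      assume "e \<inter> e' \<noteq> {}"
      then have "a = a' \<or> a = b' \<or> b = a' \<or> b = b'" using ab by auto
      then show False
        using \<open>e \<noteq> e'\<close> ab uniq arcs_symmetric[OF ab(3)] arcs_symmetric[OF ab(4)] by blast
    qed
  qed
  moreover have "{} \<notin> M" by (auto simp: M_def)
  ultimately have part: "partition_on (pverts G) M" by (simp add: partition_on_def)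
  have two: "\<forall>e\<in>M. card e = 2" using no_loops' by (auto simp: M_def)
  have "finite M" using pair_finite_arcs by (simp add: M_def)
  have "card (pverts G) \<le> (\<Sum>e\<in>M. card e)"
    using card_Union_le_sum_card[of M] \<open>\<Union>M = pverts G\<close> by simp
  then have "2 \<le> card M" using three two by simp
  then show ?thesis unfolding matching_graph_def using part two edge by auto
qed

lemma star_forest_unique_center:
  assumes "star_forest B X Y" "y \<in> Y" "x \<in> X" "x' \<in> X" "(x, y) \<in> B" "(x', y) \<in> B"
  shows "x = x'"
  using assms unfolding star_forest_def disjoint_family_on_def by blast

lemma bipartite_stars_converse: "bipartite_stars (B\<inverse>) Y X = bipartite_stars B X Y"
  unfolding bipartite_stars_def by auto

lemma modify_between_converse:
  assumes sym: "\<And>u v. (u, v) \<in> parcs K \<Longrightarrow> (v, u) \<in> parcs K"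
  shows "modify_between K Y X = (modify_between K X Y)\<inverse>"
proof -
  have b: "between K Y X = (between K X Y)\<inverse>" using sym by (auto simp: between_def)
  have "isotropic K Y X = isotropic K X Y" unfolding isotropic_def b by auto
  moreover have "Y \<times> X - between K Y X = (X \<times> Y - between K X Y)\<inverse>" unfolding b by auto
  moreover have "between K Y X = Y \<times> X \<longleftrightarrow> between K X Y = X \<times> Y" unfolding b by auto
  ultimately show ?thesis unfolding modify_between_def by (auto simp: bipartite_stars_converse b)
qed

section \<open>The modified component\<close>

locale amenable_graph = nonempty_graph G for G :: "'a pair_pre_digraph" +
  assumes amenable: "amenable G"
begin

sublocale T: rigid_type P card deg
  by (rule rigid_type[OF amenable])

lemma between_empty_iff:
  assumes "X \<in> P" "Y \<in> P"
  shows "between G X Y = {} \<longleftrightarrow> deg X Y = 0"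
proof -
  have "between G X Y = {} \<longleftrightarrow> (\<forall>x\<in>X. {w \<in> Y. (x, w) \<in> parcs G} = {})"
    by (auto simp: between_def)
  also have "\<dots> \<longleftrightarrow> (\<forall>x\<in>X. card {w \<in> Y. (x, w) \<in> parcs G} = 0)"
    using finite_cell[OF assms(2)] by (simp add: card_eq_0_iff)
  also have "\<dots> \<longleftrightarrow> deg X Y = 0" using deg[OF assms] P_nonempty[OF assms(1)] by auto
  finally show ?thesis .
qed

lemma between_full_iff:
  assumes "X \<in> P" "Y \<in> P"
  shows "between G X Y = X \<times> Y \<longleftrightarrow> deg X Y = card Y"
proof -
  have "between G X Y = X \<times> Y \<longleftrightarrow> (\<forall>x\<in>X. {w \<in> Y. (x, w) \<in> parcs G} = Y)"
    by (auto simp: between_def)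
  also have "\<dots> \<longleftrightarrow> (\<forall>x\<in>X. card {w \<in> Y. (x, w) \<in> parcs G} = card Y)"
    using card_subset_eq[OF finite_cell[OF assms(2)], of "{w \<in> Y. (_, w) \<in> parcs G}"] by auto
  also have "\<dots> \<longleftrightarrow> deg X Y = card Y" using deg[OF assms] P_nonempty[OF assms(1)] by auto
  finally show ?thesis .
qed

lemma isotropic_iff:
  assumes "X \<in> P" "Y \<in> P" "X \<noteq> Y"
  shows "isotropic G X Y \<longleftrightarrow> \<not> T.aniso X Y"
  using between_empty_iff[OF assms(1,2)] between_full_iff[OF assms(1,2)] T.degree_le[OF assms(1,2)]
    assms unfolding isotropic_def T.aniso_def by auto

lemma induced_empty_iff:
  assumes "X \<in> P"
  shows "empty_graph (induced G X) \<longleftrightarrow> deg X X = 0"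
  using between_empty_iff[OF assms assms] by (simp add: empty_graph_def induced_def between_def)

lemma induced_complete_iff:
  assumes X: "X \<in> P"
  shows "complete_graph (induced G X) \<longleftrightarrow> deg X X + 1 = card X"
proof -
  have "complete_graph (induced G X) \<longleftrightarrow> (\<forall>x\<in>X. {w \<in> X. (x, w) \<in> parcs G} = X - {x})"
    using no_loops' by (fastforce simp: complete_graph_def induced_def)
  also have "\<dots> \<longleftrightarrow> (\<forall>x\<in>X. card {w \<in> X. (x, w) \<in> parcs G} = card X - 1)"
  proof (rule ball_cong[OF refl])
    fix x assume x: "x \<in> X"
    have "{w \<in> X. (x, w) \<in> parcs G} \<subseteq> X - {x}" using no_loops' by blast
    note sub = this
    have cX: "card (X - {x}) = card X - 1" "finite (X - {x})" using x finite_cell[OF X] by simp_all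
    show "{w \<in> X. (x, w) \<in> parcs G} = X - {x} \<longleftrightarrow> card {w \<in> X. (x, w) \<in> parcs G} = card X - 1"
    proof
      assume "card {w \<in> X. (x, w) \<in> parcs G} = card X - 1"
      then show "{w \<in> X. (x, w) \<in> parcs G} = X - {x}"
        unfolding cX(1)[symmetric] by (rule card_subset_eq[OF cX(2) sub])
    qed (simp only: cX(1))
  qed
  also have "\<dots> \<longleftrightarrow> deg X X = card X - 1" using deg[OF X X] P_nonempty[OF X] by auto
  also have "\<dots> \<longleftrightarrow> deg X X + 1 = card X" using T.pos[OF X] by auto
  finally show ?thesis .
qed

lemma heterogeneous_iff: "X \<in> P \<Longrightarrow> heterogeneous G X \<longleftrightarrow> T.het X"
  using T.inner_degree_less[of X]
  by (auto simp: heterogeneous_def induced_empty_iff induced_complete_iff T.het_def)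

lemma parcs_anisotropic_graph: "parcs (anisotropic_graph G) = {(X, Y). T.aniso X Y}"
proof -
  have "X \<in> P \<and> Y \<in> P \<and> X \<noteq> Y \<and> \<not> isotropic G X Y \<longleftrightarrow> T.aniso X Y" for X Y
    using isotropic_iff[of X Y] unfolding T.aniso_def by blast
  then show ?thesis by (simp add: anisotropic_graph_def cell_graph_def)
qed

lemma rigid_component:
  assumes A: "A \<in> anisotropic_components G" and R: "root_cell G A R"
  shows "rigid_component P card deg A R"
proof -
  have verts: "pverts (anisotropic_graph G) = P" by (simp add: anisotropic_graph_def cell_graph_def)
  interpret an: pair_wf_digraph "anisotropic_graph G"
    by unfold_locales (auto simp: parcs_anisotropic_graph verts T.aniso_def)
  have reach: "X \<rightarrow>\<^sup>*\<^bsub>with_proj (anisotropic_graph G)\<^esub> Y" if "X \<in> A" "Y \<in> A" for X Y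
    using A that unfolding anisotropic_components_def pre_digraph.sccs_verts_def by blast
  have maximal: "Y \<in> A" if "X \<in> A" "X \<rightarrow>\<^sup>*\<^bsub>with_proj (anisotropic_graph G)\<^esub> Y"
    "Y \<rightarrow>\<^sup>*\<^bsub>with_proj (anisotropic_graph G)\<^esub> X" for X Y
    using A that unfolding anisotropic_components_def pre_digraph.sccs_verts_def by blast
  have AP: "A \<subseteq> P"
  proof
    fix X assume "X \<in> A"
    from reach[OF this this] show "X \<in> P" by (rule reachable_in_vertsE) (simp add: verts)
  qed
  have adj: "X \<rightarrow>\<^sup>*\<^bsub>with_proj (anisotropic_graph G)\<^esub> Y" if "T.aniso X Y" for X Y
    using an.reachable_adjI[of X Y] that by (simp add: parcs_anisotropic_graph)
  show ?thesis
  proof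
    show "A \<subseteq> P" by (rule AP)
    show "finite A" using AP finite_P by (rule finite_subset)
    show RA: "R \<in> A" using R by (simp add: root_cell_def)
    show "Y \<in> A" if "X \<in> A" "T.aniso X Y" for X Y
      using maximal[OF that(1) adj[OF that(2)] adj[OF T.aniso_sym[OF that(2)]]] .
    show "(R, X) \<in> {(X, Y). T.aniso X Y}\<^sup>*" if "X \<in> A" for X
      using reachable_rtranclI[OF reach[OF RA that]] by (simp add: parcs_anisotropic_graph)
    show "T.het R \<or> (\<forall>X\<in>A. \<not> T.het X) \<and> (\<forall>X\<in>A. card R \<le> card X)"
      using R AP heterogeneous_iff by (auto simp: root_cell_def)
  qed
qed

end

locale labeled_component = amenable_graph G for G :: "'a pair_pre_digraph" +
  fixes A :: "'a set set" and R :: "'a set" and l :: "'a \<Rightarrow> nat"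
    and par :: "'a set \<Rightarrow> 'a set" and rank :: "'a set \<Rightarrow> nat"
  assumes comp: "rigid_component P card deg A R"
    and l: "realizes l T.canonical"
    and tree: "T.partial_tree A R A par rank"
begin

sublocale C: rigid_component P card deg A R
  by (rule comp)

lemma AP: "X \<in> A \<Longrightarrow> X \<in> P" and RA: "R \<in> A" and RP: "R \<in> P"
  using C.A(1) C.RA by auto

lemma lab: "labeling l"
  using l by (simp add: realizes_def)

lemmas label = labelingD[OF lab AP]

lemma label_inj: "X \<in> A \<Longrightarrow> x \<in> X \<Longrightarrow> y \<in> X \<Longrightarrow> l x = l y \<Longrightarrow> x = y"
  using label(2) by (auto dest: inj_onD)

lemma label_surj: "X \<in> A \<Longrightarrow> i < card X \<Longrightarrow> \<exists>x\<in>X. l x = i"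
  using label(3)[of X] by (metis imageE lessThan_iff)

lemma edge_iff: "X \<in> P \<Longrightarrow> Y \<in> P \<Longrightarrow> u \<in> X \<Longrightarrow> v \<in> Y \<Longrightarrow>
    (u, v) \<in> parcs G \<longleftrightarrow> T.canonical X Y (l u) (l v)"
  using l by (simp add: realizes_def)

lemma parD:
  assumes "C \<in> A" "C \<noteq> R"
  shows "par C \<in> A" "T.aniso C (par C)" "rank (par C) < rank C" "card (par C) \<le> card C"
  using tree assms by (auto simp: T.partial_tree_def)

text \<open>The t of the star forest between \<open>par C\<close> and \<open>C\<close>: the number
  of leaves at each center.\<close>

definition ratio :: "'a set \<Rightarrow> nat" where
  "ratio C = card C div card (par C)"

lemma card_ratio:
  assumes "C \<in> A" "C \<noteq> R"
  shows "card C = card (par C) * ratio C" "0 < ratio C" "2 \<le> card (par C)"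
proof -
  note p = parD[OF assms]
  show *: "card C = card (par C) * ratio C"
    using T.aniso_degree_small(1)[OF T.aniso_sym[OF p(2)] p(4)] by (simp add: ratio_def)
  show "2 \<le> card (par C)" using T.aniso_size(2)[OF p(2)] .
  show "0 < ratio C" using * T.aniso_size(1)[OF p(2)] by (cases "ratio C") auto
qed

definition star :: "'a set \<Rightarrow> ('a \<times> 'a) set" where
  "star C = {(x, c). x \<in> par C \<and> c \<in> C \<and> l x = l c div ratio C}"

lemma star_forest_star:
  assumes C: "C \<in> A" "C \<noteq> R"
  shows "star_forest (star C) (par C) C"
proof -
  note p = parD[OF C] and r = card_ratio[OF C]
  define L where "L x = {c \<in> C. l x = l c div ratio C}" for x
  have "finite (L x) \<and> card (L x) = ratio C" if "x \<in> par C" for x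
  proof -
    have "card (L x) = card {j. j < card C \<and> l x = j div ratio C}"
      unfolding L_def by (rule card_label[OF lab AP[OF C(1)]])
    also have "\<dots> = ratio C"
      using biregular_star[OF r(2,1)] label(4)[OF p(1) that] by (simp add: biregular_def)
    finally show ?thesis using finite_cell[OF AP[OF C(1)]] by (simp add: L_def)
  qed
  moreover have "disjoint_family_on L (par C)"
    using label_inj[OF p(1)] by (auto simp: disjoint_family_on_def L_def)
  moreover have "C = (\<Union>x\<in>par C. L x)"
  proof (intro equalityI subsetI)
    fix c assume c: "c \<in> C"
    then have "l c div ratio C < card (par C)"
      using label(4)[OF C(1) c] r(1) by (simp add: less_mult_imp_div_less)
    then obtain x where "x \<in> par C" "l x = l c div ratio C" using label_surj[OF p(1)] by blast
    then show "c \<in> (\<Union>x\<in>par C. L x)" using c by (auto simp: L_def)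
  qed (auto simp: L_def)
  moreover have "star C = Sigma (par C) L" by (auto simp: star_def L_def)
  ultimately show ?thesis using r(2) unfolding star_forest_def by (intro exI[of _ L] exI[of _ "ratio C"]) auto
qed

text \<open>With three or more centers, every vertex of either side has at least two neighbors in
  the complement of the stars, so neither side can consist of leaves. With two centers the
  complement would be a star forest again.\<close>

lemma not_bipartite_stars_complement:
  assumes C: "C \<in> A" "C \<noteq> R" and three: "3 \<le> card (par C)"
  shows "\<not> bipartite_stars (par C \<times> C - star C) (par C) C"
proof
  note p = parD[OF C] and r = card_ratio[OF C]
  let ?D = "par C \<times> C - star C"
  have two: "\<exists>k1 k2. k1 \<noteq> k2 \<and> k1 \<noteq> k \<and> k2 \<noteq> k \<and> k1 < card (par C) \<and> k2 < card (par C)" for k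
  proof -
    have "card ({..<card (par C)} - {k}) \<ge> 2" using three by (auto simp: card_Diff_singleton_if)
    then obtain k1 k2 where "k1 \<in> {..<card (par C)} - {k}" "k2 \<in> {..<card (par C)} - {k}" "k1 \<noteq> k2"
      by (metis card_le_Suc0_iff_eq finite_Diff finite_lessThan not_less_eq_eq numeral_2_eq_2)
    then show ?thesis by blast
  qed
  assume "bipartite_stars ?D (par C) C"
  then consider "star_forest ?D (par C) C" | "star_forest (?D\<inverse>) C (par C)"
    unfolding bipartite_stars_def by blast
  then show False
  proof cases
    case 1
    obtain c where c: "c \<in> C" using P_nonempty[OF AP[OF C(1)]] by blast
    obtain k1 k2 where k: "k1 \<noteq> k2" "k1 \<noteq> l c div ratio C" "k2 \<noteq> l c div ratio C"
        "k1 < card (par C)" "k2 < card (par C)" using two by blast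
    obtain x1 x2 where "x1 \<in> par C" "l x1 = k1" "x2 \<in> par C" "l x2 = k2"
      using label_surj[OF p(1)] k by metis
    then show False using star_forest_unique_center[OF 1 c, of x1 x2] k c by (auto simp: star_def)
  next
    case 2
    obtain x where x: "x \<in> par C" using P_nonempty[OF AP[OF p(1)]] by blast
    obtain k1 k2 where k: "k1 \<noteq> k2" "k1 \<noteq> l x" "k2 \<noteq> l x"
        "k1 < card (par C)" "k2 < card (par C)" using two by blast
    \<comment> \<open>The first leaf of the center labeled k has the label
      \<open>k * ratio C\<close>.\<close>
    have "k1 * ratio C < card C" "k2 * ratio C < card C" using k r by simp_all
    then obtain c1 c2 where c: "c1 \<in> C" "l c1 = k1 * ratio C" "c2 \<in> C" "l c2 = k2 * ratio C"
      using label_surj[OF C(1)] by metis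
    then have "l c1 div ratio C = k1" "l c2 div ratio C = k2" using r(2) by simp_all
    then show False using star_forest_unique_center[OF 2 x, of c1 c2] k c x by (auto simp: star_def)
  qed
qed

abbreviation "K \<equiv> induced G (\<Union>A)"

lemma between_K: "X \<in> A \<Longrightarrow> Y \<in> A \<Longrightarrow> between K X Y = between G X Y"
  by (auto simp: between_def induced_def)

lemma isotropic_K: "X \<in> A \<Longrightarrow> Y \<in> A \<Longrightarrow> isotropic K X Y = isotropic G X Y"
  by (simp add: isotropic_def between_K)

lemma induced_K: "X \<in> A \<Longrightarrow> induced K X = induced G X"
  by (auto simp: induced_def)

lemma K_sym: "(u, v) \<in> parcs K \<Longrightarrow> (v, u) \<in> parcs K"
  using arcs_symmetric by (auto simp: induced_def)

lemma modify_between_isotropic: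
  assumes "X \<in> A" "Y \<in> A" "X \<noteq> Y" "\<not> T.aniso X Y"
  shows "modify_between K X Y = {}"
proof -
  have "isotropic K X Y" using assms AP isotropic_iff by (simp add: isotropic_K)
  then show ?thesis unfolding modify_between_def by (auto simp: isotropic_def)
qed

text \<open>\<open>neg\<close> records that the canonical pattern is complemented, and (M3) then
  undoes this. Otherwise each leaf has degree 1 towards \<open>par C\<close>, and the failure of
  \<open>neg\<close> excludes two centers, so (M3) leaves the stars alone.\<close>

lemma modify_between_par:
  assumes C: "C \<in> A" "C \<noteq> R"
  shows "modify_between K (par C) C = star C"
proof -
  note p = parD[OF C] and r = card_ratio[OF C]
  have a: "T.aniso (par C) C" using T.aniso_sym[OF p(2)] .
  have "\<not> isotropic G (par C) C" using a isotropic_iff by (auto simp: T.aniso_def)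
  then have ni: "\<not> isotropic K (par C) C" by (simp add: isotropic_K p(1) C(1))
  define neg where "neg \<longleftrightarrow> deg C (par C) + 1 = card (par C)"
  have B: "between K (par C) C = {(x, c). x \<in> par C \<and> c \<in> C \<and> (l x = l c div ratio C) \<noteq> neg}"
    using edge_iff[OF AP[OF p(1)] AP[OF C(1)]] T.canonical_aniso(1)[OF a p(4)]
    unfolding between_K[OF p(1) C(1)]
    unfolding between_def T.star_template_def ratio_def neg_def by auto
  show ?thesis
  proof (cases neg)
    case True
    then have "par C \<times> C - between K (par C) C = star C" unfolding B by (auto simp: star_def)
    moreover have "bipartite_stars (star C) (par C) C"
      using star_forest_star[OF C] by (simp add: bipartite_stars_def)
    ultimately show ?thesis using ni by (simp add: modify_between_def)
  next
    case False
    then have eq: "between K (par C) C = star C" unfolding B by (auto simp: star_def)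
    have "deg C (par C) = 1" using T.aniso_degree_small(2)[OF a p(4)] False by (auto simp: neg_def)
    then have "3 \<le> card (par C)" using False r(3) by (auto simp: neg_def)
    then show ?thesis using not_bipartite_stars_complement[OF C] ni eq by (simp add: modify_between_def)
  qed
qed

lemma modify_cell_empty:
  assumes C: "C \<in> A" "C \<noteq> R"
  shows "modify_cell K C = {}"
proof -
  have "\<not> T.het C" using C.het_imp_root C by blast
  then have "empty_graph (induced G C) \<or> complete_graph (induced G C)"
    using heterogeneous_iff[OF AP[OF C(1)]] by (simp add: heterogeneous_def)
  then show ?thesis
    unfolding modify_cell_def induced_K[OF C(1)]
    by (auto simp: complement_def complete_graph_def empty_graph_def)
qed

section \<open>The edges of the modified graph\<close>

definition forest_edges :: "('a \<times> 'a) set" where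
  "forest_edges = (\<Union>C\<in>A - {R}. star C \<union> (star C)\<inverse>)"

abbreviation "J \<equiv> modified_component G A R"
abbreviation "head_edges \<equiv> modify_root K R"

lemma J_verts: "pverts J = \<Union>A"
  by (simp add: modified_component_def Let_def)

text \<open>By \<open>spanning_tree_edges\<close> every anisotropic pair is a cell with its parent
  and contributes its stars. Isotropic pairs and the cells other than R lose all their
  edges.\<close>

lemma J_arcs: "parcs J = head_edges \<union> forest_edges"
proof -
  have "(\<Union>X\<in>A. \<Union>Y\<in>A - {X}. modify_between K X Y) = forest_edges"
  proof (intro equalityI subsetI)
    fix e assume "e \<in> (\<Union>X\<in>A. \<Union>Y\<in>A - {X}. modify_between K X Y)"
    then obtain X Y where XY: "X \<in> A" "Y \<in> A" "X \<noteq> Y" "e \<in> modify_between K X Y" by blast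
    then have "T.aniso X Y" using modify_between_isotropic by blast
    then consider "X \<noteq> R" "Y = par X" | "Y \<noteq> R" "X = par Y"
      using C.spanning_tree_edges[OF tree XY(1)] by blast
    then show "e \<in> forest_edges"
    proof cases
      case 1
      then have "e \<in> (star X)\<inverse>"
        using XY(4) modify_between_converse[of K X Y, OF K_sym] modify_between_par[OF XY(1)] by simp
      then show ?thesis unfolding forest_edges_def using XY(1) 1(1) by blast
    next
      case 2
      then have "e \<in> star Y" using XY modify_between_par by simp
      then show ?thesis unfolding forest_edges_def using XY(2) 2(1) by blast
    qed
  next
    fix e assume "e \<in> forest_edges"
    then obtain C where C: "C \<in> A" "C \<noteq> R" "e \<in> star C \<union> (star C)\<inverse>"
      unfolding forest_edges_def by blast
    have neq: "C \<noteq> par C" and pA: "par C \<in> A" using parD[OF C(1,2)] by (auto simp: T.aniso_def)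
    have "e \<in> modify_between K (par C) C \<union> modify_between K C (par C)"
      using C(3) modify_between_converse[of K C "par C", OF K_sym] modify_between_par[OF C(1,2)] by simp
    then show "e \<in> (\<Union>X\<in>A. \<Union>Y\<in>A - {X}. modify_between K X Y)" using C(1) neq pA by blast
  qed
  moreover have "(\<Union>X\<in>A - {R}. modify_cell K X) = {}" using modify_cell_empty by blast
  ultimately show ?thesis by (simp add: modified_component_def Let_def)
qed

lemma head_edges_subset: "head_edges \<subseteq> R \<times> R"
  by (auto simp: modify_root_def complement_def induced_def)

lemma star_cells: "C \<in> A \<Longrightarrow> C \<noteq> R \<Longrightarrow> (x, c) \<in> star C \<Longrightarrow> c \<notin> R"
  using cell_unique[OF AP RP] by (auto simp: star_def)

lemma induced_J_arcs: "parcs (induced J R) = head_edges"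
proof -
  have "forest_edges \<inter> (R \<times> R) = {}" using star_cells by (auto simp: forest_edges_def)
  then show ?thesis using head_edges_subset by (auto simp: induced_def J_arcs)
qed

lemma pair_graph_induced: "X \<in> P \<Longrightarrow> pair_graph (induced G X)"
  using finite_cell[of X] arcs_symmetric no_loops'
  by unfold_locales (auto simp: induced_def symmetric_def intro!: symI intro: finite_subset[of _ "X \<times> X"])

section \<open>The head and its Hamiltonian cycle\<close>

lemma pair_graph_head: "pair_graph (induced J R)"
proof
  interpret R: pair_graph "induced G R" by (rule pair_graph_induced[OF RP])
  have fin: "finite R" using finite_cell[OF RP] .
  show "finite (pverts (induced J R))" using fin by (simp add: induced_def)
  show "finite (parcs (induced J R))"
    unfolding induced_J_arcs using head_edges_subset fin by (meson finite_SigmaI finite_subset)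
  have "(y, x) \<in> head_edges" if "(x, y) \<in> head_edges" for x y
    using that R.arcs_symmetric arcs_symmetric
    unfolding modify_root_def induced_K[OF RA] by (auto simp: complement_def split: if_splits)
  then show "symmetric (with_proj (induced J R))"
    by (auto simp: symmetric_def induced_J_arcs intro: symI)
  fix e assume e: "e \<in> parcs (induced J R)"
  then show "fst e \<in> pverts (induced J R)" "snd e \<in> pverts (induced J R)"
    by (auto simp: induced_def)
  show "fst e \<noteq> snd e"
    using e R.no_loops unfolding induced_J_arcs modify_root_def induced_K[OF RA]
    by (auto simp: complement_def split: if_splits)
qed

lemma edge_in_root: "u \<in> R \<Longrightarrow> v \<in> R \<Longrightarrow> (u, v) \<in> parcs G \<longleftrightarrow> circulant (card R) (deg R R) (l u) (l v)"
  using edge_iff[OF RP RP] by (simp add: T.canonical_def)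

lemma matching_root_iff: "matching_graph (induced G R) \<longleftrightarrow> deg R R = 1 \<and> 3 \<le> card R"
proof -
  have nb: "card {w. (v, w) \<in> parcs (induced G R)} = deg R R" if "v \<in> R" for v
  proof -
    have "{w. (v, w) \<in> parcs (induced G R)} = {w \<in> R. (v, w) \<in> parcs G}"
      using that by (auto simp: induced_def)
    then show ?thesis using deg[OF RP RP that] by simp
  qed
  have verts: "pverts (induced G R) = R" by (simp add: induced_def)
  obtain v where v: "v \<in> R" using P_nonempty[OF RP] by blast
  show ?thesis
  proof
    assume M: "matching_graph (induced G R)"
    have "deg R R = 1" using matching_graph_neighbor[OF M, of v] nb[OF v] v verts by simp
    moreover have "4 \<le> card R" using matching_graph_card[OF M] finite_cell[OF RP] verts by simp
    ultimately show "deg R R = 1 \<and> 3 \<le> card R" by simp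
  next
    assume "deg R R = 1 \<and> 3 \<le> card R"
    then show "matching_graph (induced G R)"
      by (intro matching_graph_if_one_neighbor pair_graph_induced[OF RP]) (simp_all add: nb verts)
  qed
qed

lemma head_edges_iff:
  assumes "u \<in> R" "v \<in> R"
  shows "(u, v) \<in> head_edges \<longleftrightarrow>
    (if deg R R = 0 \<or> deg R R = 1 \<and> 3 \<le> card R then u \<noteq> v \<and> (u, v) \<notin> parcs G
     else (u, v) \<in> parcs G)"
  unfolding modify_root_def induced_K[OF RA] matching_root_iff induced_empty_iff[OF RP]
  using assms by (auto simp: complement_def induced_def)

text \<open>By the degree inside R: for 0 the head is complete; for 1 and at least three vertices it
  is the complement of the antipodal matching; K_2 is no matching graph and is kept; from 2 on the
  circulant graph is kept, and it contains the steps of the cyclic order.\<close>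

lemma head_edge_next:
  assumes u: "u \<in> R" and v: "v \<in> R" and m: "2 \<le> card R"
    and succ: "l v = Suc (l u) \<or> l u = card R - 1 \<and> l v = 0"
  shows "(u, v) \<in> head_edges"
proof -
  have lt: "l u < card R" "l v < card R" using label(4)[OF RA] u v by auto
  have neq: "u \<noteq> v" using succ m by auto
  have d: "deg R R < card R" using T.inner_degree_less[OF RP] .
  consider "deg R R = 0" | "deg R R = 1" "3 \<le> card R" | "deg R R = 1" "card R = 2" | "2 \<le> deg R R"
    using m by linarith
  then show ?thesis
  proof cases
    case 1
    then have "(u, v) \<notin> parcs G"
      using deg[OF RP RP u] finite_cell[OF RP] v by auto
    then show ?thesis using 1 neq head_edges_iff[OF u v] by simp
  next
    case 2
    have "\<not> circulant (card R) 1 (l u) (l v)"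
      using succ not_circulant_one_Suc[OF 2(2), of "l u"] not_circulant_one_last[OF 2(2)] lt by auto
    then have "(u, v) \<notin> parcs G" using edge_in_root[OF u v] 2(1) by simp
    then show ?thesis using 2 neq head_edges_iff[OF u v] by simp
  next
    case 3
    then have "l u = 0 \<and> l v = 1 \<or> l u = 1 \<and> l v = 0" using succ lt by auto
    then have "circulant (card R) (deg R R) (l u) (l v)"
      using 3 by (elim disjE conjE) (simp_all add: circulant_def)
    then show ?thesis using 3 edge_in_root[OF u v] head_edges_iff[OF u v] by simp
  next
    case 4
    then have "circulant (card R) (deg R R) (l u) (l v)"
      using succ circulant_Suc[OF 4, of "l u" "card R"] circulant_last[OF 4 m] lt by auto
    then show ?thesis using 4 edge_in_root[OF u v] head_edges_iff[OF u v] by simp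
  qed
qed

lemma hamiltonian_head: "hamiltonian (induced J R)"
proof (cases "card R = 1")
  case True
  then show ?thesis by (simp add: hamiltonian_def induced_def)
next
  case False
  then have m: "2 \<le> card R" using T.pos[OF RP] by linarith
  define w where "w i = inv_into R l (i mod card R)" for i
  have w: "w i \<in> R" "l (w i) = i mod card R" for i
  proof -
    have "i mod card R \<in> l ` R" unfolding label(3)[OF RA] using m by simp
    then show "w i \<in> R" "l (w i) = i mod card R"
      unfolding w_def by (rule inv_into_into, rule f_inv_into_f)
  qed
  have "\<exists>p. pre_digraph.cycle (with_proj (induced J R)) p \<and> fst ` set p = pverts (induced J R)"
  proof (rule cycle_if_cyclic_order[where w = w and m = "card R"])
    show "1 \<le> card R" using m by simp
    fix i assume i: "i < card R"
    have "l (w (Suc i)) = Suc (l (w i)) \<or> l (w i) = card R - 1 \<and> l (w (Suc i)) = 0"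
      using i by (auto simp: w(2) mod_Suc)
    then show "(w i, w (Suc i)) \<in> parcs (induced J R)"
      unfolding induced_J_arcs by (rule head_edge_next[OF w(1) w(1) m])
  next
    show "w (card R) = w 0" by (simp add: w_def)
    show "inj_on w {..<card R}"
    proof (rule inj_onI)
      fix i j assume "i \<in> {..<card R}" "j \<in> {..<card R}" "w i = w j"
      then have "i mod card R = j mod card R" using w(2) by metis
      then show "i = j" using \<open>i \<in> _\<close> \<open>j \<in> _\<close> by simp
    qed
    show "pverts (induced J R) = w ` {..<card R}"
    proof
      show "pverts (induced J R) \<subseteq> w ` {..<card R}"
      proof
        fix x assume "x \<in> pverts (induced J R)"
        then have x: "x \<in> R" by (simp add: induced_def)
        then have "l x < card R" using label(4)[OF RA] by simp
        moreover from this have "w (l x) = x" using label_inj[OF RA w(1) x] w(2) by simp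
        ultimately show "x \<in> w ` {..<card R}" by force
      qed
      show "w ` {..<card R} \<subseteq> pverts (induced J R)" using w(1) by (auto simp: induced_def)
    qed
  qed
  then show ?thesis by (simp add: hamiltonian_def)
qed

section \<open>The legs\<close>

definition mult :: "'a set \<Rightarrow> nat" where
  "mult X = card X div card R"

lemma card_mult:
  assumes "X \<in> A"
  shows "card X = card R * mult X"
  using assms
proof (induction "rank X" arbitrary: X rule: less_induct)
  case less
  show ?case
  proof (cases "X = R")
    case True
    then show ?thesis using T.pos[OF RP] by (simp add: mult_def)
  next
    case False
    note p = parD[OF less.prems False]
    have "card X = card R * (mult (par X) * ratio X)"
      using less.hyps[OF p(3,1)] card_ratio(1)[OF less.prems False] by (simp add: mult.assoc)
    then show ?thesis using T.pos[OF RP] by (simp add: mult_def)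
  qed
qed

lemma mult_pos: "X \<in> A \<Longrightarrow> 0 < mult X"
  using card_mult[of X] T.pos[OF AP, of X] by (cases "mult X") auto

lemma mult_root: "mult R = 1"
  using T.pos[OF RP] by (simp add: mult_def)

lemma mult_par:
  assumes "C \<in> A" "C \<noteq> R"
  shows "mult C = mult (par C) * ratio C"
proof -
  have "card R * mult C = card R * (mult (par C) * ratio C)"
    using card_ratio(1)[OF assms] card_mult[OF parD(1)[OF assms]] card_mult[OF assms(1)]
    by (simp add: mult.assoc)
  then show ?thesis using T.pos[OF RP] by simp
qed

text \<open>The label of a parent is that of the child divided by \<open>ratio\<close>, and
  \<open>mult\<close>, the number of vertices of a cell in each leg, is the product of the ratios up
  to the root. A single division thus yields the label of the root vertex above x.\<close>

definition leg_index :: "'a \<Rightarrow> nat" where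
  "leg_index x = l x div mult (cell_of x)"

definition leg_verts :: "'a \<Rightarrow> 'a set" where
  "leg_verts v = {x \<in> \<Union>A. leg_index x = l v}"

definition leg :: "'a \<Rightarrow> 'a pair_pre_digraph" where
  "leg v = \<lparr> pverts = leg_verts v, parcs = forest_edges \<inter> leg_verts v \<times> leg_verts v \<rparr>"

lemma starD:
  assumes C: "C \<in> A" "C \<noteq> R" and xc: "(x, c) \<in> star C"
  shows "x \<in> par C" "c \<in> C" "l x = l c div ratio C" "cell_of x = par C" "cell_of c = C"
    "leg_index x = leg_index c" "x \<in> \<Union>A" "c \<in> \<Union>A" "rank (cell_of x) < rank (cell_of c)"
proof -
  note p = parD[OF C]
  show *: "x \<in> par C" "c \<in> C" "l x = l c div ratio C" using xc by (auto simp: star_def)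
  show **: "cell_of x = par C" "cell_of c = C" using cell_of AP p(1) C(1) * by auto
  show "leg_index x = leg_index c"
    unfolding leg_index_def ** mult_par[OF C] *(3) by (simp add: div_mult2_eq mult.commute)
  show "x \<in> \<Union>A" "c \<in> \<Union>A" using * p(1) C(1) by auto
  show "rank (cell_of x) < rank (cell_of c)" using p(3) by (simp add: **)
qed

lemma forest_edgeE:
  assumes "(x, y) \<in> forest_edges"
  obtains C where "C \<in> A" "C \<noteq> R" "(x, y) \<in> star C" | C where "C \<in> A" "C \<noteq> R" "(y, x) \<in> star C"
  using assms unfolding forest_edges_def by blast

lemma forest_edgeI: "C \<in> A \<Longrightarrow> C \<noteq> R \<Longrightarrow> (x, y) \<in> star C \<Longrightarrow> (x, y) \<in> forest_edges \<and> (y, x) \<in> forest_edges"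
  unfolding forest_edges_def by blast

lemma forest_sym: "(x, y) \<in> forest_edges \<Longrightarrow> (y, x) \<in> forest_edges"
  by (erule forest_edgeE) (auto dest: forest_edgeI)

lemma forest_edge_leg_index:
  assumes "(x, y) \<in> forest_edges"
  shows "leg_index x = leg_index y" "x \<in> \<Union>A" "y \<in> \<Union>A" "rank (cell_of x) \<noteq> rank (cell_of y)"
proof -
  have "leg_index x = leg_index y \<and> x \<in> \<Union>A \<and> y \<in> \<Union>A \<and> rank (cell_of x) \<noteq> rank (cell_of y)"
    using assms
  proof (rule forest_edgeE)
    fix C assume "C \<in> A" "C \<noteq> R" "(x, y) \<in> star C"
    from starD(6-9)[OF this] show ?thesis by simp
  next
    fix C assume "C \<in> A" "C \<noteq> R" "(y, x) \<in> star C"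
    from starD(6-9)[OF this] show ?thesis by simp
  qed
  then show "leg_index x = leg_index y" "x \<in> \<Union>A" "y \<in> \<Union>A" "rank (cell_of x) \<noteq> rank (cell_of y)"
    by blast+
qed

lemma unique_parent:
  assumes "(x, y) \<in> forest_edges" "(x', y) \<in> forest_edges"
    and "rank (cell_of x) < rank (cell_of y)" "rank (cell_of x') < rank (cell_of y)"
  shows "x = x'"
proof -
  obtain C where C: "C \<in> A" "C \<noteq> R" "(x, y) \<in> star C"
    using assms(1,3) starD(9) by (elim forest_edgeE) (blast, metis less_asym)
  obtain C' where C': "C' \<in> A" "C' \<noteq> R" "(x', y) \<in> star C'"
    using assms(2,4) starD(9) by (elim forest_edgeE) (blast, metis less_asym)
  have "C = C'" using starD(5)[OF C] starD(5)[OF C'] by simp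
  then show ?thesis
    using starD(1,3)[OF C] starD(1,3)[OF C'] label_inj[OF parD(1)[OF C(1,2)]] by simp
qed

lemma finite_leg: "finite (leg_verts v)"
proof -
  have "\<Union>A \<subseteq> V" using AP P_subset by blast
  then have "leg_verts v \<subseteq> V" by (auto simp: leg_verts_def)
  then show ?thesis using finite_V by (rule finite_subset)
qed

lemma leg_in_root:
  assumes "v \<in> R" "x \<in> leg_verts v" "x \<in> R"
  shows "x = v"
proof -
  have "l x = l v" using assms cell_of[OF RP assms(3)] by (simp add: leg_verts_def leg_index_def mult_root)
  then show ?thesis using label_inj[OF RA] assms by blast
qed

lemma root_in_leg: "v \<in> R \<Longrightarrow> v \<in> leg_verts v"
  using cell_of[OF RP] RA by (auto simp: leg_verts_def leg_index_def mult_root)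

lemma pair_graph_leg: "pair_graph (leg v)"
proof
  show "finite (pverts (leg v))" "finite (parcs (leg v))"
    using finite_leg by (simp_all add: leg_def)
  show "symmetric (with_proj (leg v))"
    using forest_sym by (auto simp: symmetric_def leg_def intro: symI)
  fix e assume e: "e \<in> parcs (leg v)"
  then show "fst e \<in> pverts (leg v)" "snd e \<in> pverts (leg v)" by (auto simp: leg_def)
  have "(fst e, snd e) \<in> forest_edges" using e by (simp add: leg_def)
  from forest_edge_leg_index(4)[OF this] show "fst e \<noteq> snd e" by metis
qed

text \<open>The center above a vertex lies in a cell of smaller rank, which gives a path to v; its
  uniqueness excludes cycles of length at least three.\<close>

lemma rooted_tree_leg:
  assumes v: "v \<in> R"
  shows "rooted_tree (leg v) v"
proof -
  interpret L: pair_graph "leg v" by (rule pair_graph_leg)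
  have reach: "v \<rightarrow>\<^sup>*\<^bsub>with_proj (leg v)\<^esub> x" if "x \<in> leg_verts v" for x
    using that
  proof (induction "rank (cell_of x)" arbitrary: x rule: less_induct)
    case less
    obtain C where C: "C \<in> A" "x \<in> C" using less.prems by (auto simp: leg_verts_def)
    show ?case
    proof (cases "C = R")
      case True
      then have "x = v" using leg_in_root[OF v less.prems] C by simp
      moreover have "x \<in> pverts (leg v)" using less.prems by (simp add: leg_def)
      ultimately show ?thesis using L.reachable_refl by simp
    next
      case False
      obtain L where L: "C = (\<Union>y\<in>par C. L y)" "star C = Sigma (par C) L"
        using star_forest_star[OF C(1) False] unfolding star_forest_def by blast
      have "x \<in> (\<Union>y\<in>par C. L y)" using C(2) L(1) by (rule subst[rotated])
      then obtain y where y: "(y, x) \<in> star C" using L(2) by blast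
      note s = starD[OF C(1) False y]
      have yl: "y \<in> leg_verts v" using s less.prems by (simp add: leg_verts_def)
      have "v \<rightarrow>\<^sup>*\<^bsub>with_proj (leg v)\<^esub> y" using less.hyps[OF s(9) yl] .
      moreover have "(y, x) \<in> parcs (leg v)"
        using forest_edgeI[OF C(1) False y] yl less.prems by (simp add: leg_def)
      ultimately show ?thesis by (rule L.reachable_adj_trans)
    qed
  qed
  have "Digraph_Component.connected (with_proj (leg v))"
  proof (rule L.connectedI)
    show "pverts (leg v) \<noteq> {}" using root_in_leg[OF v] by (auto simp: leg_def)
    fix x y assume "x \<in> pverts (leg v)" "y \<in> pverts (leg v)"
    then have "x \<in> leg_verts v" "y \<in> leg_verts v" by (simp_all add: leg_def)
    then have "x \<rightarrow>\<^sup>*\<^bsub>with_proj (leg v)\<^esub> y"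
      using symmetric_reachable[OF L.sym_arcs reach] reach L.reachable_trans by blast
    then show "x \<rightarrow>\<^sup>*\<^bsub>with_proj (mk_symmetric (leg v))\<^esub> y"
      using L.reachable_mk_symmetric_eq[OF L.sym_arcs] by simp
  qed
  moreover have "\<not> (\<exists>p. pre_digraph.cycle (with_proj (leg v)) p \<and> 3 \<le> length p)"
  proof (rule no_cycle_if_unique_lower_neighbor[where \<rho> = "\<lambda>x. rank (cell_of x)"])
    show "(y, x) \<in> parcs (leg v)" if "(x, y) \<in> parcs (leg v)" for x y
      using that forest_sym by (auto simp: leg_def)
    show "rank (cell_of x) \<noteq> rank (cell_of y)" if "(x, y) \<in> parcs (leg v)" for x y
      using that forest_edge_leg_index(4) by (simp add: leg_def)
    show "x = x'" if "(x, y) \<in> parcs (leg v)" "(x', y) \<in> parcs (leg v)"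
      "rank (cell_of x) < rank (cell_of y)" "rank (cell_of x') < rank (cell_of y)" for x x' y
      using that unique_parent[of x y x'] by (simp add: leg_def)
  qed
  ultimately show ?thesis
    using pair_graph_leg root_in_leg[OF v] by (simp add: rooted_tree_def leg_def)
qed

text \<open>
  The vertices of the cell \<open>X\<close> in the leg rooted at \<open>w\<close> are those whose labels lie between
  \<open>l w * mult X\<close> and \<open>(l w + 1) * mult X\<close>.
\<close>

definition shift :: "'a \<Rightarrow> 'a \<Rightarrow> 'a" where
  "shift w x = inv_into (cell_of x) l (l w * mult (cell_of x) + l x mod mult (cell_of x))"

lemma shift:
  assumes w: "w \<in> R" and X: "X \<in> A" "x \<in> X"
  shows "shift w x \<in> X" "l (shift w x) = l w * mult X + l x mod mult X" "shift w x \<in> leg_verts w"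
proof -
  have c: "cell_of x = X" using cell_of AP X by auto
  have "l x mod mult X < mult X" using mult_pos[OF X(1)] by simp
  then have "l w * mult X + l x mod mult X < (l w + 1) * mult X" by simp
  also have "\<dots> \<le> card R * mult X" using label(4)[OF RA w] by (intro mult_le_mono1) simp
  finally have "l w * mult X + l x mod mult X \<in> l ` X"
    unfolding label(3)[OF X(1)] using card_mult[OF X(1)] by simp
  then show 1: "shift w x \<in> X" "l (shift w x) = l w * mult X + l x mod mult X"
    unfolding shift_def c by (rule inv_into_into, rule f_inv_into_f)
  then have "cell_of (shift w x) = X" using cell_of AP X by auto
  then have "leg_index (shift w x) = l w" using 1(2) mult_pos[OF X(1)] by (simp add: leg_index_def)
  then show "shift w x \<in> leg_verts w" using 1(1) X(1) by (auto simp: leg_verts_def)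
qed

lemma shift_shift:
  assumes v: "v \<in> R" and w: "w \<in> R" and x: "x \<in> leg_verts v"
  shows "shift v (shift w x) = x"
proof -
  obtain X where X: "X \<in> A" "x \<in> X" using x by (auto simp: leg_verts_def)
  note s = shift[OF w X]
  have "cell_of x = X" using cell_of AP X by auto
  then have "l x div mult X = l v" using x by (simp add: leg_verts_def leg_index_def)
  then have "l (shift v (shift w x)) = l x"
    using shift(2)[OF v X(1) s(1)] s(2) by (metis div_mult_mod_eq mod_mult_self3 mod_mod_trivial)
  then show ?thesis using label_inj[OF X(1) shift(1)[OF v X(1) s(1)] X(2)] by blast
qed

text \<open>As \<open>mult C\<close> is \<open>mult (par C)\<close> times \<open>ratio C\<close>,
  the remainder of \<open>l c\<close> modulo \<open>mult C\<close> encodes the remainder of the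
  parent and the position of c among its siblings. The shift changes neither, so it commutes with
  division by \<open>ratio C\<close>.\<close>

lemma star_shift:
  assumes w: "w \<in> R" and C: "C \<in> A" "C \<noteq> R" and xc: "(x, c) \<in> star C"
  shows "(shift w x, shift w c) \<in> star C"
proof -
  note s = starD[OF C xc] and p = parD[OF C]
  have r: "0 < ratio C" using card_ratio(2)[OF C] .
  have "l c mod mult C = ratio C * (l x mod mult (par C)) + l c mod ratio C"
    unfolding mult_par[OF C] s(3) by (simp add: mod_mult2_eq mult.commute[of "mult (par C)"])
  then have "l (shift w c) = ratio C * (l w * mult (par C) + l x mod mult (par C)) + l c mod ratio C"
    using shift(2)[OF w C(1) s(2)] mult_par[OF C] by (simp add: algebra_simps)
  then have "l (shift w c) div ratio C = l w * mult (par C) + l x mod mult (par C)"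
    using r by simp
  then show ?thesis
    using shift[OF w p(1) s(1)] shift(1)[OF w C(1) s(2)] by (simp add: star_def)
qed

lemma forest_shift:
  assumes "w \<in> R" "(x, y) \<in> forest_edges"
  shows "(shift w x, shift w y) \<in> forest_edges"
  using assms(2)
proof (rule forest_edgeE)
  fix C assume "C \<in> A" "C \<noteq> R" "(x, y) \<in> star C"
  with star_shift[OF assms(1) this] show ?thesis using forest_edgeI by blast
next
  fix C assume "C \<in> A" "C \<noteq> R" "(y, x) \<in> star C"
  with star_shift[OF assms(1) this] show ?thesis using forest_edgeI by blast
qed

lemma rooted_isomorphism_shift:
  assumes v: "v \<in> R" and w: "w \<in> R"
  shows "rooted_isomorphism (shift w) (leg v) v (leg w) w"
proof -
  have into: "shift w x \<in> leg_verts w" if "w \<in> R" "x \<in> leg_verts v" for v w x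
    using that shift(3)[OF that(1)] by (auto simp: leg_verts_def)
  have "bij_betw (shift w) (leg_verts v) (leg_verts w)"
    by (rule bij_betw_byWitness[where f' = "shift v"]) (use v w shift_shift into in auto)
  moreover have "(x, y) \<in> parcs (leg v) \<longleftrightarrow> (shift w x, shift w y) \<in> parcs (leg w)"
    if "x \<in> leg_verts v" "y \<in> leg_verts v" for x y
    using forest_shift[OF w, of x y] forest_shift[OF v, of "shift w x" "shift w y"]
      shift_shift[OF v w that(1)] shift_shift[OF v w that(2)] into[OF w] that
    by (auto simp: leg_def)
  moreover have "shift w v = w"
    using shift(1,2)[OF w RA v] label_inj[OF RA _ w] by (simp add: mult_root)
  ultimately show ?thesis by (simp add: rooted_isomorphism_def graph_isomorphism_def leg_def)
qed

lemma jellyfish_J: "jellyfish J (induced J R) leg"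
  unfolding jellyfish_def
proof (intro conjI ballI)
  have R: "pverts (induced J R) = R" by (simp add: induced_def)
  show "pair_graph (induced J R)" by (rule pair_graph_head)
  show "hamiltonian (induced J R)" by (rule hamiltonian_head)
  show "rooted_tree (leg v) v" if "v \<in> pverts (induced J R)" for v
    using rooted_tree_leg that R by simp
  show "disjoint_family_on (\<lambda>v. pverts (leg v)) (pverts (induced J R))"
    unfolding R using label_inj[OF RA] by (auto simp: disjoint_family_on_def leg_def leg_verts_def)
  show "\<exists>\<pi>. rooted_isomorphism \<pi> (leg v) v (leg w) w"
    if "v \<in> pverts (induced J R)" "w \<in> pverts (induced J R)" for v w
    using rooted_isomorphism_shift that R by auto
  have cover: "\<exists>v\<in>R. x \<in> leg_verts v" if x: "x \<in> \<Union>A" for x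
  proof -
    obtain X where X: "X \<in> A" "x \<in> X" using x by blast
    then have "cell_of x = X" using cell_of AP by auto
    then have "leg_index x < card R"
      using label(4)[OF X] card_mult[OF X(1)] by (simp add: leg_index_def less_mult_imp_div_less)
    then obtain v where v: "v \<in> R" "l v = leg_index x" using label_surj[OF RA] by metis
    then have "x \<in> leg_verts v" using x by (simp add: leg_verts_def)
    then show ?thesis using v(1) by blast
  qed
  show "pverts J = (\<Union>v\<in>pverts (induced J R). pverts (leg v))"
    unfolding R J_verts using cover by (auto simp: leg_def) (auto simp: leg_verts_def)
  have "forest_edges = (\<Union>v\<in>R. parcs (leg v))"
  proof (intro equalityI subsetI)
    fix e assume e: "e \<in> forest_edges"
    obtain x y where xy: "e = (x, y)" by (cases e)
    obtain v where v: "v \<in> R" "x \<in> leg_verts v" using cover forest_edge_leg_index(2) e xy by blast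
    then have "y \<in> leg_verts v" using forest_edge_leg_index(1,3) e xy by (simp add: leg_verts_def)
    then show "e \<in> (\<Union>v\<in>R. parcs (leg v))" using v e xy by (auto simp: leg_def)
  qed (auto simp: leg_def)
  then show "parcs J = parcs (induced J R) \<union> (\<Union>v\<in>pverts (induced J R). parcs (leg v))"
    unfolding R induced_J_arcs J_arcs by simp
qed

lemma cell_isomorphic_legs:
  assumes v: "v \<in> R" and w: "w \<in> R"
  shows "cell_isomorphic G (leg v) v (leg w) w"
proof -
  have "\<exists>X\<in>P. a \<in> X \<and> shift w a \<in> X" if a: "a \<in> pverts (leg v)" for a
  proof -
    obtain X where "X \<in> A" "a \<in> X" using a by (auto simp: leg_def leg_verts_def)
    then show ?thesis using shift(1)[OF w] AP by blast
  qed
  then show ?thesis unfolding cell_isomorphic_def using rooted_isomorphism_shift[OF v w] by blast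
qed

end

theorem theorem8:
  fixes G :: "'a pair_pre_digraph" and A :: "'a set set" and R :: "'a set"
  assumes "pair_graph G" and "amenable G"
    and "A \<in> anisotropic_components G"
    and "root_cell G A R"
  shows "let J = modified_component G A R in
    \<exists>L. jellyfish J (induced J R) L \<and>
      (\<forall>v\<in>R. \<forall>w\<in>R. cell_isomorphic G (L v) v (L w) w)"
proof -
  \<comment> \<open>The empty graph has no cells and hence no component with a root.\<close>
  have "pverts G \<noteq> {}"
  proof
    assume "pverts G = {}"
    then have "pverts (anisotropic_graph G) = {}"
      using stable_partition_empty by (simp add: anisotropic_graph_def cell_graph_def)
    moreover have "R \<in> A" using assms(4) by (simp add: root_cell_def)
    then have "R \<rightarrow>\<^sup>*\<^bsub>with_proj (anisotropic_graph G)\<^esub> R"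
      using assms(3) unfolding anisotropic_components_def pre_digraph.sccs_verts_def by blast
    ultimately show False by (auto elim: reachable_in_vertsE)
  qed
  then interpret amenable_graph G
    using assms(1,2) by (intro amenable_graph.intro nonempty_graph.intro)
      (simp_all add: nonempty_graph_axioms_def amenable_graph_axioms_def)
  have comp: "rigid_component P card deg A R" using rigid_component assms(3,4) .
  interpret C: rigid_component P card deg A R by (rule comp)
  obtain l where l: "realizes l T.canonical" using ex_realizes[OF amenable T.valid_canonical] by blast
  obtain par rank where tree: "T.partial_tree A R A par rank" using C.ex_spanning_tree by blast
  interpret labeled_component G A R l par rank
    using comp l tree by unfold_locales
  show ?thesis unfolding Let_def using jellyfish_J cell_isomorphic_legs by blast
qed

end
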